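(* In the setting described in the context (a coefficient $\mu$ satisfying (A1)--(A3), an abstract Wiener space $(\Omega,\mathcal H,\mathbb P)$ with a continuous strictly monotone resolution of identity $\{\pi_t\}_{t\in[0,1]}$ on $\mathcal H$ satisfying the filtration assumption (F), and a fixed $x_0\in\mathbb R^d$), suppose that $\varphi\colon C([0,1];\mathbb R^d)\to\mathbb R$ is bounded and uniformly continuous, and let $C(v,u):=\varphi(\mathbb S(v,u))-\frac12\|u\|_{\mathcal H}^2$ for $v\in\mathcal C$, $u\in\mathcal H$. Assume that $C$ is convex in the first variable and concave in the second variable, in the (extended) sense defined in the context. Then the game with cost $C$ is fair, i.e. $I^-=I^+$, and $$\lim_{\varepsilon\downarrow0}V^\varepsilon=I^-=I^+=\inf_{v\in\mathcal C}\max_{u\in\mathcal H}C(v,u)=\max_{u\in\mathcal H}\inf_{v\in\mathcal C}C(v,u),$$ where $V^\varepsilon:=\varepsilon\inf_{a\in\mathbb A}\log\mathbb E\big[\exp\big(\varphi(\mathbb S(a,\sqrt\varepsilon\,\mathbb X))/\varepsilon\big)\big]$, $I^-:=\sup_{\alpha\in\mathscr A}\inf_{v\in\mathcal C}C(v,\alpha[v])$ and $I^+:=\inf_{\beta\in\mathscr B}\sup_{u\in\mathcal H}C(\beta[u],u)$.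
   Context: Convexity notions. $C$ is convex in the first variable if for all $v_1,v_2\in\mathcal C$ and $\lambda\in(0,1)$ there is $v_0\in\mathcal C$ with $C(v_0,u)\le\lambda C(v_1,u)+(1-\lambda)C(v_2,u)$ for all $u\in\mathcal H$. $C$ is concave in the second variable if for all $u_1,u_2\in\mathcal H$ and $\lambda\in(0,1)$ there is $u_0\in\mathcal H$ with $\|u_0\|_{\mathcal H}\le\max\{\|u_1\|_{\mathcal H},\|u_2\|_{\mathcal H}\}$ and $\lambda C(v,u_1)+(1-\lambda)C(v,u_2)\le C(v,u_0)$ for all $v\in\mathcal C$. Path space. Fix $d\in\mathbb N$. $\Omega:=C_0([0,1];\mathbb R^d)$ is the space of continuous functions $[0,1]\to\mathbb R^d$ starting at $0$, with norm $\|\omega\|_\infty:=\|\omega\|_1$, where $\|\omega\|_t:=\sup_{s\in[0,t]}\|\omega(s)\|$ (the latter also used on $C([0,1];\mathbb R^d)$, which carries the uniform topology). $\mathcal F$ is the Borel $\sigma$-field of $\Omega$ and $\mathbb X_t(\omega)=\omega(t)$ is the coordinate process. Coefficient. $\Lambda$ is a nonempty Polish space with a complete metric $d_\Lambda$ inducing its topology; $x_0\in\mathbb R^d$ is fixed. $\mu\colon[0,1]\times C([0,1];\mathbb R^d)\times\Lambda\to\mathbb R^d$ is Borel and satisfies: (A1) if $\alpha=\alpha'$ on $[0,t]$ then $\mu(t,\alpha,\lambda)=\mu(t,\alpha',\lambda)$ for all $\lambda\in\Lambda$; (A2) there is $L>0$ with $\|\mu(t,\alpha,\lambda)-\mu(t,\alpha',\lambda)\|\le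 L\|\alpha-\alpha'\|_t$ and $\|\mu(t,\alpha,\lambda)\|\le L(1+\|\alpha\|_t)$ for all $t,\alpha,\alpha',\lambda$; (A3) there is a modulus of continuity $m_\mu$ with $\|\mu(t,\alpha,\lambda)-\mu(t,\alpha,\lambda')\|\le m_\mu(d_\Lambda(\lambda,\lambda'))$ for all $t,\alpha,\lambda,\lambda'$. Noise. $\mathbb P$ is a non-degenerate centered Gaussian measure on $(\Omega,\mathcal F)$ (every nonzero $\gamma\in\Omega^*$ is, under $\mathbb P$, a centered Gaussian random variable with nonzero variance), with expectation $\mathbb E$. $\mathcal H$ is its Cameron--Martin space: the unique separable Hilbert space densely and continuously embedded in $\Omega$ as a subspace with $\mathbb E[e^{i\gamma}]=e^{-\frac12\|h_\gamma\|_{\mathcal H}^2}$ for all $\gamma\in\Omega^*$, where $h_\gamma\in\mathcal H$ is determined by $\langle h,h_\gamma\rangle_{\mathcal H}=\gamma(h)$ for all $h\in\mathcal H$. $(\Omega,\mathcal H,\mathbb P)$ is called an abstract Wiener space. $\mathcal I\colon\mathcal H\to L^2(\Omega,\mathbb P)$ is the unique linear isometry with $\mathcal I(h_\gamma)=\gamma$ ($\mathbb P$-a.s.) for all $\gamma\in\Omega^*$. Resolution of identity. $\{\pi_t\}_{t\in[0,1]}$ is a continuous strictly monotone resolution of identity on $\mathcal H$: each $\pi_t\colon\mathcal H\to\mathcal H$ is an orthogonal projection, $\pi_0=0$, $\pi_1=\mathrm{id}$, $\pi_s\mathcal H\subsetneq\pi_t\mathcal H$ for $0\le s<t\le1$,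 and $\lim_{s\to t}\pi_sh=\pi_th$ for all $t\in[0,1]$, $h\in\mathcal H$. Filtration. With $\mathcal N$ the $\mathbb P$-null sets, $\mathcal F_t:=\sigma(\mathbb X_s,s\in[0,t])\vee\mathcal N$. Assumption (F): for all $t\in[0,1]$, $\mathcal F_t=\sigma(\mathcal I(\pi_th):h\in\mathcal H)\vee\mathcal N$. Controls and solution map. $\mathcal C$ is the set of Borel functions $v\colon[0,1]\to\Lambda$, identified when equal Lebesgue-a.e., with the (Polish) topology of convergence in Lebesgue measure and its Borel $\sigma$-field. $\mathbb S\colon\mathcal C\times\Omega\to C([0,1];\mathbb R^d)$ is the map such that $\mathbb S(v,w)$ is the unique continuous solution of $\mathbb S_t(v,w)=x_0+\int_0^t\mu(s,\mathbb S(v,w),v_s)\,ds+w_t$, $t\in[0,1]$. $\mathbb A$ is the set of all $\Lambda$-valued $(\mathcal F_t)$-progressively measurable processes on $\Omega$; $\mathbb S(a,\sqrt\varepsilon\,\mathbb X)$ denotes $\omega\mapsto\mathbb S(a_\cdot(\omega),\sqrt\varepsilon\,\omega)$. Strategies. $\mathscr A$ is the set of measurable $\alpha\colon\mathcal C\to\mathcal H$ such that for all $t\in[0,1]$: $v=v'$ a.e. on $[0,t]$ implies $\pi_t\alpha[v]=\pi_t\alpha[v']$. $\mathscr B$ is the set of measurable $\beta\colon\mathcal H\to\mathcal C$ such that for all $t\in[0,1]$: $\pi_tu=\pi_tu'$ implies $\beta[u]=\beta[u']$ a.e. on $[0,t]$. *)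

theory Defs
  imports "HOL-Probability.Probability"
begin

text \<open>Continuous functions on \<open>[0,1]\<close> are represented by their constant extension to the real line,
  so that the norm and the topology of the type of bounded continuous functions restrict to the
  supremum norm on \<open>[0,1]\<close> and the uniform topology.\<close>

type_synonym 'd path = "real \<Rightarrow>\<^sub>C (real ^ 'd)"

definition C01 :: "'d::finite path set" where
  "C01 = {f. \<forall>t. apply_bcontfun f t = apply_bcontfun f (max 0 (min 1 t))}"

definition C01_0 :: "'d::finite path set" where
  "C01_0 = {\<omega> \<in> C01. apply_bcontfun \<omega> 0 = 0}"

definition norm_upto :: "real \<Rightarrow> 'd::finite path \<Rightarrow> real" where
  "norm_upto t f = (SUP s\<in>{0..t}. norm (apply_bcontfun f s))"

text \<open>Members of the dual of \<open>C01_0\<close> are total functions of which only the values on \<open>C01_0\<close> matter.\<close>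

definition dual_C01_0 :: "('d::finite path \<Rightarrow> real) set" where
  "dual_C01_0 = {\<gamma>. (\<forall>x\<in>C01_0. \<forall>y\<in>C01_0. \<gamma> (x + y) = \<gamma> x + \<gamma> y) \<and>
                    (\<forall>c. \<forall>x\<in>C01_0. \<gamma> (c *\<^sub>R x) = c * \<gamma> x) \<and>
                    continuous_on C01_0 \<gamma>}"


section \<open>Coefficient\<close>

text \<open>Monotonicity is deliberately not required.\<close>

definition modulus_of_continuity :: "(real \<Rightarrow> real) \<Rightarrow> bool" where
  "modulus_of_continuity m \<longleftrightarrow> (\<forall>r\<ge>0. m r \<ge> 0) \<and> m 0 = 0 \<and> (m \<longlongrightarrow> 0) (at_right 0)"

locale coefficient =
  fixes \<mu> :: "real \<Rightarrow> 'd::finite path \<Rightarrow> 'l::polish_space \<Rightarrow> real ^ 'd"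
  assumes borel_mu:
      "(\<lambda>(t, \<alpha>, l). \<mu> t \<alpha> l) \<in> borel_measurable (restrict_space borel ({0..1} \<times> C01 \<times> UNIV))"
    and nonanticipative_mu:
      "\<forall>t\<in>{0..1}. \<forall>\<alpha>\<in>C01. \<forall>\<alpha>'\<in>C01. (\<forall>s\<in>{0..t}. apply_bcontfun \<alpha> s = apply_bcontfun \<alpha>' s) \<longrightarrow>
         (\<forall>l. \<mu> t \<alpha> l = \<mu> t \<alpha>' l)"
    and lipschitz_growth_mu:
      "\<exists>L>0. \<forall>t\<in>{0..1}. \<forall>\<alpha>\<in>C01. \<forall>\<alpha>'\<in>C01. \<forall>l.
         norm (\<mu> t \<alpha> l - \<mu> t \<alpha>' l) \<le> L * norm_upto t (\<alpha> - \<alpha>') \<and>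
         norm (\<mu> t \<alpha> l) \<le> L * (1 + norm_upto t \<alpha>)"
    and modulus_mu:
      "\<exists>m. modulus_of_continuity m \<and>
         (\<forall>t\<in>{0..1}. \<forall>\<alpha>\<in>C01. \<forall>l l'. norm (\<mu> t \<alpha> l - \<mu> t \<alpha> l') \<le> m (dist l l'))"


section \<open>Noise\<close>

locale nondegenerate_gaussian = prob_space P for P :: "'d::finite path measure" +
  assumes sets_P: "sets P = sets (restrict_space borel C01_0)"
    and gaussian: "\<forall>\<gamma>\<in>dual_C01_0. (\<exists>\<omega>\<in>C01_0. \<gamma> \<omega> \<noteq> 0) \<longrightarrow>
           (\<exists>\<sigma>>0. distributed P lborel \<gamma> (normal_density 0 \<sigma>))"

definition riesz :: "('h::real_inner \<Rightarrow> 'd::finite path) \<Rightarrow> ('d path \<Rightarrow> real) \<Rightarrow> 'h" where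
  "riesz \<iota> \<gamma> = (THE h. \<forall>k. inner k h = \<gamma> (\<iota> k))"

text \<open>The Cameron--Martin space is a separable Hilbert space type together with its embedding
  \<open>\<iota>\<close> into the path space.\<close>

locale abstract_wiener_space = nondegenerate_gaussian P
    for P :: "'d::finite path measure" +
  fixes \<iota> :: "'h::{real_inner, polish_space} \<Rightarrow> 'd path"
  assumes bounded_linear_embedding: "bounded_linear \<iota>"
    and inj_embedding: "inj \<iota>"
    and dense_embedding: "range \<iota> \<subseteq> C01_0" "C01_0 \<subseteq> closure (range \<iota>)"
    and cameron_martin: "\<forall>\<gamma>\<in>dual_C01_0.
      (LINT \<omega>|P. exp (\<i> * complex_of_real (\<gamma> \<omega>))) =
        complex_of_real (exp (- (1/2) * (norm (riesz \<iota> \<gamma>))\<^sup>2))"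

text \<open>Elements of \<open>L\<^sup>2(\<Omega>, P)\<close> are represented by functions, hence all identities between them hold
  almost surely only.\<close>

definition paley_wiener ::
  "'d::finite path measure \<Rightarrow> ('h::real_inner \<Rightarrow> 'd path) \<Rightarrow> ('h \<Rightarrow> 'd path \<Rightarrow> real) \<Rightarrow> bool" where
  "paley_wiener P \<iota> J \<longleftrightarrow>
     (\<forall>h. J h \<in> borel_measurable P \<and> integrable P (\<lambda>\<omega>. (J h \<omega>)\<^sup>2)) \<and>
     (\<forall>h k. AE \<omega> in P. J (h + k) \<omega> = J h \<omega> + J k \<omega>) \<and>
     (\<forall>c h. AE \<omega> in P. J (c *\<^sub>R h) \<omega> = c * J h \<omega>) \<and>
     (\<forall>h. sqrt (LINT \<omega>|P. (J h \<omega>)\<^sup>2) = norm h) \<and>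
     (\<forall>\<gamma>\<in>dual_C01_0. AE \<omega> in P. J (riesz \<iota> \<gamma>) \<omega> = \<gamma> \<omega>)"

definition orthogonal_projection :: "('h::real_inner \<Rightarrow> 'h) \<Rightarrow> bool" where
  "orthogonal_projection p \<longleftrightarrow>
     bounded_linear p \<and> p \<circ> p = p \<and> (\<forall>x y. inner (p x) y = inner x (p y))"

locale resolution_of_identity =
  fixes \<pi> :: "real \<Rightarrow> 'h::real_inner \<Rightarrow> 'h"
  assumes projection: "\<forall>t\<in>{0..1}. orthogonal_projection (\<pi> t)"
    and at_0: "\<pi> 0 = (\<lambda>h. 0)"
    and at_1: "\<pi> 1 = id"
    and strictly_monotone: "\<forall>s t. 0 \<le> s \<and> s < t \<and> t \<le> 1 \<longrightarrow> range (\<pi> s) \<subset> range (\<pi> t)"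
    and continuous: "\<forall>t\<in>{0..1}. \<forall>h. ((\<lambda>s. \<pi> s h) \<longlongrightarrow> \<pi> t h) (at t within {0..1})"

text \<open>Only null sets belonging to the Borel field of \<open>P\<close> are adjoined, so that the filtration consists
  of sub-\<open>\<sigma>\<close>-fields of \<open>sets P\<close>. It does not depend on the representatives chosen for the
  members of \<open>L\<^sup>2\<close>.\<close>

definition augmented_sigma ::
  "'d::finite path measure \<Rightarrow> ('d path \<Rightarrow> 'b::topological_space) set \<Rightarrow> 'd path measure" where
  "augmented_sigma P Z =
     sigma (space P) ((\<Union>f\<in>Z. {f -` B \<inter> space P | B. B \<in> sets borel}) \<union> null_sets P)"

definition coordinate_filtration :: "'d::finite path measure \<Rightarrow> real \<Rightarrow> 'd path measure" where
  "coordinate_filtration P t = augmented_sigma P ((\<lambda>s \<omega>. apply_bcontfun \<omega> s) ` {0..t})"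

definition filtration_assumption ::
  "'d::finite path measure \<Rightarrow> ('h \<Rightarrow> 'd path \<Rightarrow> real) \<Rightarrow> (real \<Rightarrow> 'h \<Rightarrow> 'h) \<Rightarrow> bool" where
  "filtration_assumption P J \<pi> \<longleftrightarrow>
     (\<forall>t\<in>{0..1}. sets (coordinate_filtration P t) =
        sets (augmented_sigma P (range (\<lambda>h. J (\<pi> t h)))))"


section \<open>Controls\<close>

definition control_eq :: "(real \<Rightarrow> 'l::polish_space) \<Rightarrow> (real \<Rightarrow> 'l) \<Rightarrow> bool" where
  "control_eq v v' \<longleftrightarrow>
     v \<in> borel_measurable (restrict_space borel {0..1}) \<and>
     v' \<in> borel_measurable (restrict_space borel {0..1}) \<and>
     (AE t\<in>{0..1} in lborel. v t = v' t)"

lemma part_equivp_control_eq: "part_equivp control_eq"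
proof (rule part_equivpI)
  show "\<exists>v. control_eq v (v :: real \<Rightarrow> 'a)"
    by (rule exI[of _ "\<lambda>_. undefined"]) (simp add: control_eq_def)
  show "symp (control_eq :: (real \<Rightarrow> 'a) \<Rightarrow> _)"
    by (rule sympI) (auto simp: control_eq_def eq_commute)
  show "transp (control_eq :: (real \<Rightarrow> 'a) \<Rightarrow> _)"
    by (rule transpI) (auto simp: control_eq_def)
qed

quotient_type (overloaded) 'l control = "real \<Rightarrow> 'l::polish_space" / partial: control_eq
  by (rule part_equivp_control_eq)

lemma control_eq_rep: "control_eq (rep_control v) (rep_control v)"
  by (rule Quotient3_rep_reflp[OF Quotient3_control])

lemma borel_rep_control: "rep_control v \<in> borel_measurable (restrict_space borel {0..1})"
  using control_eq_rep[of v] by (simp add: control_eq_def)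

lemma control_eqI:
  assumes "AE t\<in>{0..1} in lborel. rep_control v t = rep_control w t"
  shows "v = w"
proof -
  have "control_eq (rep_control v) (rep_control w)"
    unfolding control_eq_def by (intro conjI borel_rep_control assms)
  then show ?thesis
    by (rule Quotient3_rel_rep[OF Quotient3_control, THEN iffD1])
qed

definition control_gap :: "'l::polish_space control \<Rightarrow> 'l control \<Rightarrow> real \<Rightarrow> real" where
  "control_gap v w t = indicator {0..1} t * min 1 (dist (rep_control v t) (rep_control w t))"

lemma borel_control_dist:
  "(\<lambda>t. dist (rep_control v t) (rep_control w t)) \<in> borel_measurable (restrict_space borel {0..1})"
  by (intro borel_measurable_dist borel_rep_control)

lemma borel_control_gap [measurable]: "control_gap v w \<in> borel_measurable borel"
proof -
  have "(\<lambda>t. min 1 (dist (rep_control v t) (rep_control w t)))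
      \<in> borel_measurable (restrict_space borel {0..1})"
    by (intro borel_measurable_min borel_measurable_const borel_control_dist)
  then have "(\<lambda>t. indicator {0..1} t *\<^sub>R min 1 (dist (rep_control v t) (rep_control w t)))
      \<in> borel_measurable borel"
    by (rule borel_measurable_restrict_space_iff[THEN iffD1, rotated]) simp
  then show ?thesis
    by (simp only: control_gap_def[abs_def] real_scaleR_def)
qed

lemma integrable_control_gap: "integrable lborel (control_gap v w)"
proof (rule Bochner_Integration.integrable_bound)
  show "integrable lborel (indicator {0..1::real} :: real \<Rightarrow> real)" by simp
qed (auto simp: control_gap_def indicator_def)

text \<open>The metric below induces the topology of convergence in Lebesgue measure; see
  \<open>tendsto_control_iff\<close>.\<close>

instantiation control :: (polish_space) metric_space
begin

definition dist_control :: "'a control \<Rightarrow> 'a control \<Rightarrow> real" where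
  "dist_control v w = (LINT t|lborel. control_gap v w t)"

definition uniformity_control :: "('a control \<times> 'a control) filter" where
  "uniformity_control = (INF e\<in>{0<..}. principal {(x, y). dist x y < e})"

definition open_control :: "'a control set \<Rightarrow> bool" where
  "open_control U \<longleftrightarrow> (\<forall>x\<in>U. \<forall>\<^sub>F (x', y) in uniformity. x' = x \<longrightarrow> y \<in> U)"

instance
proof
  fix u v w :: "'a control"
  have nn: "control_gap v w t \<ge> 0" for t
    by (simp add: control_gap_def)
  have "dist v w = 0 \<longleftrightarrow> (AE t in lborel. control_gap v w t = 0)"
    unfolding dist_control_def
    by (rule integral_nonneg_eq_0_iff_AE) (auto simp: integrable_control_gap nn)
  also have "\<dots> \<longleftrightarrow> (AE t\<in>{0..1} in lborel. rep_control v t = rep_control w t)"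
    by (intro AE_cong) (auto simp: control_gap_def indicator_def min_def)
  also have "\<dots> \<longleftrightarrow> v = w"
    using control_eqI by auto
  finally show "dist v w = 0 \<longleftrightarrow> v = w" .
  have "dist v w \<le> (LINT t|lborel. control_gap v u t + control_gap w u t)"
    unfolding dist_control_def
  proof (rule integral_mono)
    fix t
    have "dist (rep_control v t) (rep_control w t)
        \<le> dist (rep_control v t) (rep_control u t) + dist (rep_control w t) (rep_control u t)"
      by (rule dist_triangle2)
    then show "control_gap v w t \<le> control_gap v u t + control_gap w u t"
      using zero_le_dist[of "rep_control v t" "rep_control u t"]
        zero_le_dist[of "rep_control w t" "rep_control u t"]
      by (cases "t \<in> {0..1}") (simp_all add: control_gap_def min_def del: zero_le_dist)
  qed (auto intro: integrable_control_gap)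
  then show "dist v w \<le> dist v u + dist w u"
    by (simp add: dist_control_def integrable_control_gap)
qed (simp_all add: uniformity_control_def open_control_def)

end

lemma tendsto_control_iff:
  "(V \<longlongrightarrow> w) F \<longleftrightarrow>
     (\<forall>e>0. ((\<lambda>n. measure lborel {t\<in>{0..1}. dist (rep_control (V n) t) (rep_control w t) \<ge> e})
        \<longlongrightarrow> 0) F)"
proof -
  define B where "B v e = {t\<in>{0..1}. dist (rep_control v t) (rep_control w t) \<ge> e}" for v e
  have B_sets: "B v e \<in> sets lborel" for v e
  proof -
    have "{t\<in>space (restrict_space borel {0..1}).
        dist (rep_control v t) (rep_control w t) \<in> {e..}} \<in> sets (restrict_space borel {0..1})"
      using measurable_sets[OF borel_control_dist[of v w], of "{e..}"]
      by (simp add: vimage_def Int_def conj_commute)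
    then show ?thesis
      by (auto simp: B_def space_restrict_space sets_restrict_space_iff)
  qed
  have I_int: "integrable lborel (indicator {0..1::real} :: real \<Rightarrow> real)" by simp
  have B_int: "integrable lborel (indicator (B v e) :: real \<Rightarrow> real)" for v e
  proof (rule Bochner_Integration.integrable_bound)
    show "integrable lborel (indicator {0..1::real} :: real \<Rightarrow> real)" by simp
  qed (use B_sets[of v e] in \<open>auto simp: B_def indicator_def\<close>)
  have markov: "min 1 e * measure lborel (B v e) \<le> dist v w" if "e > 0" for v e
  proof -
    have "(LINT t|lborel. min 1 e * indicator (B v e) t) \<le> (LINT t|lborel. control_gap v w t)"
      by (intro integral_mono integrable_mult_right B_int integrable_control_gap)
         (use that in \<open>auto simp: control_gap_def B_def indicator_def\<close>)
    then show ?thesis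
      using B_sets by (simp add: dist_control_def)
  qed
  have bound: "dist v w \<le> e + measure lborel (B v e)" if "e > 0" for v e
  proof -
    have "(LINT t|lborel. control_gap v w t)
        \<le> (LINT t|lborel. e * indicator {0..1} t + indicator (B v e) t)"
      by (intro integral_mono Bochner_Integration.integrable_add integrable_mult_right B_int
            integrable_control_gap I_int)
         (use that in \<open>auto simp: control_gap_def B_def indicator_def\<close>)
    also have "\<dots> = e + measure lborel (B v e)"
      using B_sets
      by (subst Bochner_Integration.integral_add)
         (intro integrable_mult_right I_int B_int | simp)+
    finally show ?thesis by (simp add: dist_control_def)
  qed
  have "(V \<longlongrightarrow> w) F \<longleftrightarrow> (\<forall>e>0. ((\<lambda>n. measure lborel (B (V n) e)) \<longlongrightarrow> 0) F)"
  proof (intro iffI allI impI)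
    fix e :: real
    assume lim: "(V \<longlongrightarrow> w) F" and e: "e > 0"
    have "((\<lambda>n. dist (V n) w / min 1 e) \<longlongrightarrow> 0) F"
      using tendsto_dist[OF lim tendsto_const[of w]] by (auto intro: tendsto_divide_zero)
    then show "((\<lambda>n. measure lborel (B (V n) e)) \<longlongrightarrow> 0) F"
    proof (rule Lim_null_comparison[rotated], intro always_eventually allI)
      fix n
      show "norm (measure lborel (B (V n) e)) \<le> dist (V n) w / min 1 e"
        using markov[OF e, of "V n"] e by (simp add: pos_le_divide_eq mult.commute)
    qed
  next
    assume lim: "\<forall>e>0. ((\<lambda>n. measure lborel (B (V n) e)) \<longlongrightarrow> 0) F"
    show "(V \<longlongrightarrow> w) F"
    proof (rule tendstoI)
      fix r :: real
      assume r: "r > 0"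
      then have "\<forall>\<^sub>F n in F. measure lborel (B (V n) (r / 2)) < r / 2"
        using order_tendstoD(2)[OF lim[rule_format, of "r / 2"], of "r / 2"] by simp
      then show "\<forall>\<^sub>F n in F. dist (V n) w < r"
      proof eventually_elim
        case (elim n)
        then show ?case using bound[of "r / 2" "V n"] r by linarith
      qed
    qed
  qed
  then show ?thesis by (simp add: B_def)
qed


section \<open>Solution map\<close>

definition solution_map ::
  "(real \<Rightarrow> 'd::finite path \<Rightarrow> 'l::polish_space \<Rightarrow> real ^ 'd) \<Rightarrow> real ^ 'd \<Rightarrow>
   'l control \<Rightarrow> 'd path \<Rightarrow> 'd path" where
  "solution_map \<mu> x0 v w = (THE x. x \<in> C01 \<and>
     (\<forall>t\<in>{0..1}. apply_bcontfun x t =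
        x0 + (LINT s:{0..t}|lborel. \<mu> s x (rep_control v s)) + apply_bcontfun w t))"

definition progressive :: "'d::finite path measure \<Rightarrow> (real \<Rightarrow> 'd path \<Rightarrow> 'l::polish_space) set" where
  "progressive P = {a. \<forall>t\<in>{0..1}. (\<lambda>(s, \<omega>). a s \<omega>) \<in>
     borel_measurable (restrict_space borel {0..t} \<Otimes>\<^sub>M coordinate_filtration P t)}"


section \<open>The game\<close>

text \<open>The embedding \<open>\<iota>\<close> is where a Cameron--Martin element is regarded as a path.\<close>

definition game_cost ::
  "(real \<Rightarrow> 'd::finite path \<Rightarrow> 'l::polish_space \<Rightarrow> real ^ 'd) \<Rightarrow> real ^ 'd \<Rightarrow>
   ('h::real_inner \<Rightarrow> 'd path) \<Rightarrow> ('d path \<Rightarrow> real) \<Rightarrow> 'l control \<Rightarrow> 'h \<Rightarrow> real" where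
  "game_cost \<mu> x0 \<iota> \<phi> v u = \<phi> (solution_map \<mu> x0 v (\<iota> u)) - (1/2) * (norm u)\<^sup>2"

definition convex_in_first :: "('v \<Rightarrow> 'u \<Rightarrow> real) \<Rightarrow> bool" where
  "convex_in_first C \<longleftrightarrow> (\<forall>v1 v2. \<forall>\<theta>\<in>{0<..<1}. \<exists>v0. \<forall>u.
     C v0 u \<le> \<theta> * C v1 u + (1 - \<theta>) * C v2 u)"

definition concave_in_second :: "('v \<Rightarrow> 'u::real_normed_vector \<Rightarrow> real) \<Rightarrow> bool" where
  "concave_in_second C \<longleftrightarrow> (\<forall>u1 u2. \<forall>\<theta>\<in>{0<..<1}. \<exists>u0. norm u0 \<le> max (norm u1) (norm u2) \<and>
     (\<forall>v. \<theta> * C v u1 + (1 - \<theta>) * C v u2 \<le> C v u0))"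

definition strategies_max ::
  "(real \<Rightarrow> 'h::real_inner \<Rightarrow> 'h) \<Rightarrow> ('l::polish_space control \<Rightarrow> 'h) set" where
  "strategies_max \<pi> = {\<alpha> \<in> borel_measurable borel. \<forall>t\<in>{0..1}. \<forall>v v'.
     (AE s\<in>{0..t} in lborel. rep_control v s = rep_control v' s) \<longrightarrow> \<pi> t (\<alpha> v) = \<pi> t (\<alpha> v')}"

definition strategies_min ::
  "(real \<Rightarrow> 'h::real_inner \<Rightarrow> 'h) \<Rightarrow> ('h \<Rightarrow> 'l::polish_space control) set" where
  "strategies_min \<pi> = {\<beta> \<in> borel_measurable borel. \<forall>t\<in>{0..1}. \<forall>u u'.
     \<pi> t u = \<pi> t u' \<longrightarrow> (AE s\<in>{0..t} in lborel. rep_control (\<beta> u) s = rep_control (\<beta> u') s)}"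

text \<open>The values live in \<open>ereal\<close> because \<open>C v (\<alpha> v)\<close> need not be bounded below in \<open>v\<close>.\<close>

definition lower_value ::
  "(real \<Rightarrow> 'h::real_inner \<Rightarrow> 'h) \<Rightarrow> ('l::polish_space control \<Rightarrow> 'h \<Rightarrow> real) \<Rightarrow> ereal" where
  "lower_value \<pi> C = (SUP \<alpha>\<in>strategies_max \<pi>. INF v. ereal (C v (\<alpha> v)))"

definition upper_value ::
  "(real \<Rightarrow> 'h::real_inner \<Rightarrow> 'h) \<Rightarrow> ('l::polish_space control \<Rightarrow> 'h \<Rightarrow> real) \<Rightarrow> ereal" where
  "upper_value \<pi> C = (INF \<beta>\<in>strategies_min \<pi>. SUP u. ereal (C (\<beta> u) u))"

definition noisy_value ::
  "(real \<Rightarrow> 'd::finite path \<Rightarrow> 'l::polish_space \<Rightarrow> real ^ 'd) \<Rightarrow> real ^ 'd \<Rightarrow>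
   'd path measure \<Rightarrow> ('d path \<Rightarrow> real) \<Rightarrow> real \<Rightarrow> ereal" where
  "noisy_value \<mu> x0 P \<phi> \<epsilon> = ereal \<epsilon> * (INF a\<in>progressive P. ereal (ln (LINT \<omega>|P.
     exp (\<phi> (solution_map \<mu> x0 (abs_control (\<lambda>t. a t \<omega>)) (sqrt \<epsilon> *\<^sub>R \<omega>)) / \<epsilon>))))"

end

theory Submission
  imports Defs "HOL-Complex_Analysis.Great_Picard" "HOL-Real_Asymp.Real_Asymp"
begin

text \<open>Constant strategies give \<open>sup inf C \<le> I\<^sup>-, I\<^sup>+ \<le> inf sup C\<close>, so fairness reduces to the minimax theorem:
  \<open>\<phi>\<close> being bounded, only a ball of the Cameron--Martin space matters, its image under the embedding is compact,
  and \<open>C(v, \<cdot>)\<close> is upper semicontinuous there.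

  For the lower bound on \<open>V\<^sup>\<epsilon>\<close>, shift the noise by \<open>u / \<surd>\<epsilon>\<close> and apply Jensen's inequality. The solution map is
  Lipschitz in the noise uniformly in the control, so this gives \<open>V\<^sup>\<epsilon> \<ge> inf\<^sub>v C(v, u) - o(1)\<close> for every \<open>u\<close>.
  For the upper bound, insert a deterministic control and use
  \<open>log E exp f(X) \<le> E sup\<^sub>u (f(X + u) - |u|\<^sup>2 / 2)\<close> with \<open>f = \<phi>(S(v, \<surd>\<epsilon> \<cdot>)) / \<epsilon>\<close>. This inequality is proved in
  dimension one by monotone transport, extends to finite dimensions by tensorization, and to paths by
  Bernstein approximation.\<close>

section \<open>Hilbert spaces\<close>

text \<open>The two asymptotic bounds do not meet by themselves. The shift gives
  \<open>sup inf C\<close> from below, because at each sample point the shifted control is just some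
  element of the control set; deterministic controls give \<open>inf sup C\<close> from above. The
  minimax theorem closes exactly this gap, and the norm condition in the concavity assumption is
  what lets it run inside one ball. Two obstacles shape the rest. Shifts are made only along
  representatives of the dual, where the density is a function defined at every path, so the saddle
  point has to be approximated from there, uniformly in the control. And the upper bound must
  survive the passage to infinitely many dimensions: the Gaussian inequality carries no dimensional
  constant, and the Bernstein operator, linear of norm at most one and blind to all but finitely
  many values of a path, leaves an error term that does not depend on the degree. Since
  \<open>\<phi>\<close> is only uniformly continuous, its continuity enters as
  \<open>\<delta> + L * min 1 (norm (w - w'))\<close>, whose noise part vanishes in expectation as
  the noise does.\<close>

lemma nested_convex_limit:
  fixes A :: "nat \<Rightarrow> 'h::{real_inner,complete_space} set"
  assumes conv: "\<And>n. convex (A n)" and dec: "decseq A"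
    and bdd: "\<And>n. \<exists>b\<in>A n. norm b \<le> R"
  obtains a u where "\<And>n. a n \<in> A n" "a \<longlonglongrightarrow> u"
    "\<And>r. (\<And>n. \<exists>b\<in>A n. norm b \<le> r) \<Longrightarrow> norm u \<le> r"
proof -
  \<comment> \<open>The squared distance of \<open>A n\<close> from the origin. It increases because
    the sets shrink and stays below \<open>R\<^sup>2\<close>, so it converges, and points that
    nearly attain it turn out to be Cauchy. The sets need not be closed, so the limit is described
    by norm bounds and not by membership.\<close>
  define d where "d n = (INF b\<in>A n. (norm b)\<^sup>2)" for n
  have ne: "A n \<noteq> {}" for n using bdd by auto
  have bb: "bdd_below ((\<lambda>b. (norm b)\<^sup>2) ` A n)" for n
    by (rule bdd_belowI[of _ 0]) auto
  have d_le: "d n \<le> (norm b)\<^sup>2" if "b \<in> A n" for n b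
    unfolding d_def by (rule cINF_lower[OF bb that])
  have d_r: "d n \<le> r\<^sup>2" if r: "\<And>n. \<exists>b\<in>A n. norm b \<le> r" for n r
  proof -
    obtain b where "b \<in> A n" "norm b \<le> r" using r[of n] by blast
    then show ?thesis using d_le[of b n] power_mono[of "norm b" r 2] by simp
  qed
  have inc: "incseq d"
  proof (rule incseq_SucI)
    fix n show "d n \<le> d (Suc n)"
      unfolding d_def
      by (rule cINF_superset_mono[OF ne bb]) (use dec in \<open>auto simp: decseq_Suc_iff\<close>)
  qed
  have "\<exists>D. d \<longlonglongrightarrow> D"
    by (rule incseq_convergent[OF inc, of "R\<^sup>2"]) (use d_r[OF bdd] in auto)
  then obtain D where D: "d \<longlonglongrightarrow> D" by blast
  have "\<exists>a\<in>A n. (norm a)\<^sup>2 < d n + 1 / real (Suc n)" for n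
    using cINF_less_iff[OF ne bb, of n "d n + 1 / real (Suc n)"] unfolding d_def by simp
  then obtain a where a: "\<And>n. a n \<in> A n" "\<And>n. (norm (a n))\<^sup>2 < d n + 1 / real (Suc n)"
    by metis
  \<comment> \<open>Parallelogram law: \<open>a m\<close> also lies in \<open>A n\<close>, hence so
    does the midpoint, whose squared norm is therefore at least \<open>d n\<close>.\<close>
  have key: "(norm (a n - a m))\<^sup>2 \<le> 2 * (d m - d n) + 4 * (1 / real (Suc n))" if "n \<le> m" for n m
  proof -
    let ?c = "(1/2) *\<^sub>R a n + (1/2) *\<^sub>R a m"
    have "a m \<in> A n" using dec that a(1) by (auto simp: decseq_def)
    then have "?c \<in> A n" using conv[of n] a(1)[of n] unfolding convex_def by auto
    then have "d n \<le> (norm ?c)\<^sup>2" by (rule d_le)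
    moreover have "(norm (a n - a m))\<^sup>2 = 2 * (norm (a n))\<^sup>2 + 2 * (norm (a m))\<^sup>2 - 4 * (norm ?c)\<^sup>2"
      by (simp add: power2_norm_eq_inner inner_add_left inner_add_right inner_diff_left
          inner_diff_right inner_commute algebra_simps)
    moreover have "1 / real (Suc m) \<le> 1 / real (Suc n)" using that by (simp add: frac_le)
    moreover have "X \<le> 2 * (y - x) + 4 * p"
      if "x \<le> M" "X = 2 * N + 2 * N' - 4 * M" "q \<le> p" "N < x + p" "N' < y + q"
      for x y p q M N N' X :: real using that by argo
    ultimately show ?thesis using a(2)[of n] a(2)[of m] by blast
  qed
  have "Cauchy a"
  proof (rule metric_CauchyI)
    fix e :: real assume e: "e > 0"
    have "(\<lambda>n. 2 * (D - d n) + 4 * (1 / real (Suc n))) \<longlonglongrightarrow> 2 * (D - D) + 4 * 0"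
      by (intro tendsto_intros D LIMSEQ_Suc[OF lim_1_over_n])
    then have "\<forall>\<^sub>F n in sequentially. 2 * (D - d n) + 4 * (1 / real (Suc n)) < (e/2)\<^sup>2"
      by (rule order_tendstoD) (use e in simp)
    then obtain N where N: "\<And>n. n \<ge> N \<Longrightarrow> 2 * (D - d n) + 4 * (1 / real (Suc n)) < (e/2)\<^sup>2"
      by (auto simp: eventually_sequentially)
    have dD: "d m \<le> D" for m by (rule incseq_le[OF inc D])
    have half: "norm (a N - a m) < e / 2" if "m \<ge> N" for m
    proof -
      have "(norm (a N - a m))\<^sup>2 < (e/2)\<^sup>2"
        using key[OF that] N[of N] dD[of m] by simp
      then show ?thesis using e power_less_imp_less_base[of "norm (a N - a m)" 2 "e / 2"] by linarith
    qed
    show "\<exists>M. \<forall>m\<ge>M. \<forall>n\<ge>M. dist (a m) (a n) < e"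
    proof (intro exI allI impI)
      fix m n assume "m \<ge> N" "n \<ge> N"
      then show "dist (a m) (a n) < e"
        using half[of m] half[of n] dist_triangle3[of "a m" "a n" "a N"] by (simp add: dist_norm)
    qed
  qed
  then obtain u where u: "a \<longlonglongrightarrow> u"
    using Cauchy_convergent convergent_def by blast
  show thesis
  proof (rule that[OF a(1) u])
    fix r assume r: "\<And>n. \<exists>b\<in>A n. norm b \<le> r"
    have "r \<ge> 0" using r[of 0] norm_ge_zero order_trans by blast
    have "(\<lambda>n. (norm (a n))\<^sup>2) \<longlonglongrightarrow> (norm u)\<^sup>2"
      by (intro tendsto_intros u)
    moreover have "(\<lambda>n. r\<^sup>2 + 1 / real (Suc n)) \<longlonglongrightarrow> r\<^sup>2 + 0"
      by (intro tendsto_intros LIMSEQ_Suc[OF lim_1_over_n])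
    moreover have "(norm (a n))\<^sup>2 \<le> r\<^sup>2 + 1 / real (Suc n)" for n
      using a(2)[of n] d_r[OF r, of n] by simp
    ultimately have "(norm u)\<^sup>2 \<le> r\<^sup>2"
      by (intro LIMSEQ_le) auto
    then show "norm u \<le> r" using \<open>r \<ge> 0\<close> power2_le_imp_le by blast
  qed
qed

lemma nearest_point:
  fixes A :: "'h::{real_inner,complete_space} set"
  assumes "closed A" "convex A" "A \<noteq> {}"
  obtains u where "u \<in> A" "\<And>b. b \<in> A \<Longrightarrow> norm u \<le> norm b"
proof -
  obtain b0 where b0: "b0 \<in> A" using assms by auto
  obtain a u where a: "\<And>n::nat. a n \<in> A" "a \<longlonglongrightarrow> u"
    "\<And>r. (\<And>n::nat. \<exists>b\<in>A. norm b \<le> r) \<Longrightarrow> norm u \<le> r"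
    by (rule nested_convex_limit[of "\<lambda>_. A" "norm b0"])
       (use assms b0 in \<open>auto simp: decseq_def\<close>)
  show thesis
  proof (rule that)
    show "u \<in> A" using closed_sequentially[OF assms(1)] a by blast
    show "norm u \<le> norm b" if "b \<in> A" for b using a(3)[of "norm b"] that by auto
  qed
qed

lemma min_norm_orthogonal:
  fixes u k :: "'h::real_inner"
  assumes "\<And>t::real. norm u \<le> norm (u + t *\<^sub>R k)"
  shows "inner u k = 0"
proof (cases "k = 0")
  case False
  \<comment> \<open>The minimiser of the quadratic
    \<open>t \<mapsto> (norm (u + t *\<^sub>R k))\<^sup>2\<close>.\<close>
  let ?t = "- inner u k / inner k k"
  have "inner k k > 0" using False by simp
  have "(norm u)\<^sup>2 \<le> (norm (u + ?t *\<^sub>R k))\<^sup>2" by (intro power_mono assms) simp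
  also have "\<dots> = (norm u)\<^sup>2 - (inner u k)\<^sup>2 / inner k k"
    using \<open>inner k k > 0\<close>
    by (simp only: power2_norm_eq_inner inner_add_left inner_add_right inner_commute
          inner_scaleR_left inner_scaleR_right)
       (simp add: field_simps power2_eq_square inner_commute)
  finally have "(inner u k)\<^sup>2 / inner k k \<le> 0" by simp
  then show ?thesis using \<open>inner k k > 0\<close> by (simp add: field_simps)
qed simp

text \<open>The shortest vector of the hyperplane \<open>f = 1\<close> is orthogonal to the kernel
  of \<open>f\<close>; dividing it by its squared norm gives the representative.\<close>

lemma riesz_representation:
  fixes f :: "'h::{real_inner,complete_space} \<Rightarrow> real"
  assumes "bounded_linear f"
  obtains h where "\<And>k. inner k h = f k"
proof (cases "\<forall>k. f k = 0")
  case True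
  then show thesis using that[of 0] by auto
next
  case False
  interpret f: bounded_linear f by fact
  obtain k0 where k0: "f k0 \<noteq> 0" using False by auto
  have "closed {u. f u = 1}"
    by (intro closed_Collect_eq continuous_intros f.continuous_on)
  moreover have "convex {u. f u = 1}"
    by (auto simp: convex_def f.add f.scaleR algebra_simps)
  moreover have "k0 /\<^sub>R f k0 \<in> {u. f u = 1}" using k0 by (simp add: f.scaleR)
  ultimately obtain u where "u \<in> {u. f u = 1}" "\<And>b. b \<in> {u. f u = 1} \<Longrightarrow> norm u \<le> norm b"
    using nearest_point[of "{u. f u = 1}"] by (metis (no_types, lifting) empty_iff)
  then have u: "f u = 1" "\<And>b. f b = 1 \<Longrightarrow> norm u \<le> norm b" by auto
  have orth: "inner u k = 0" if "f k = 0" for k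
    by (rule min_norm_orthogonal) (use u that in \<open>auto simp: f.add f.scaleR\<close>)
  have "u \<noteq> 0" using u(1) f.zero by auto
  show thesis
  proof (rule that[of "u /\<^sub>R inner u u"])
    fix k
    have "inner u (k - f k *\<^sub>R u) = 0" by (rule orth) (simp add: f.diff f.scaleR u(1))
    then have "inner u k = f k * inner u u" by (simp add: inner_diff_right)
    then show "inner k (u /\<^sub>R inner u u) = f k"
      using \<open>u \<noteq> 0\<close> by (simp add: inner_commute)
  qed
qed

lemma subspace_closure:
  fixes D :: "'a::real_normed_vector set"
  assumes "subspace D"
  shows "subspace (closure D)"
proof -
  have "x + y \<in> closure D" if x: "x \<in> closure D" and y: "y \<in> closure D" for x y
  proof -
    obtain a where a: "\<And>n. a n \<in> D" "a \<longlonglongrightarrow> x"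
      using x unfolding closure_sequential by blast
    obtain b where b: "\<And>n. b n \<in> D" "b \<longlonglongrightarrow> y"
      using y unfolding closure_sequential by blast
    have "(\<lambda>n. a n + b n) \<longlonglongrightarrow> x + y" by (intro tendsto_intros a b)
    moreover have "a n + b n \<in> D" for n using a b assms by (simp add: subspace_add)
    ultimately show ?thesis unfolding closure_sequential by (metis (no_types, lifting))
  qed
  moreover have "c *\<^sub>R x \<in> closure D" if x: "x \<in> closure D" for c x
  proof -
    obtain a where a: "\<And>n. a n \<in> D" "a \<longlonglongrightarrow> x"
      using x unfolding closure_sequential by blast
    have "(\<lambda>n. c *\<^sub>R a n) \<longlonglongrightarrow> c *\<^sub>R x" by (intro tendsto_intros a)
    moreover have "c *\<^sub>R a n \<in> D" for n using a assms by (simp add: subspace_scale)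
    ultimately show ?thesis unfolding closure_sequential by (metis (no_types, lifting))
  qed
  moreover have "0 \<in> closure D" using subspace_0[OF assms] closure_subset by blast
  ultimately show ?thesis unfolding subspace_def by blast
qed

text \<open>A shortest vector of the affine set \<open>x + closure D\<close> is orthogonal to
  \<open>D\<close>, hence zero, and that puts \<open>x\<close> into
  \<open>closure D\<close>.\<close>

lemma closure_subspace_eq_UNIV:
  fixes D :: "'h::{real_inner,complete_space} set"
  assumes "subspace D" "\<And>h. (\<And>d. d \<in> D \<Longrightarrow> inner h d = 0) \<Longrightarrow> h = 0"
  shows "closure D = UNIV"
proof -
  have "x \<in> closure D" for x
  proof -
    have S: "subspace (closure D)" by (rule subspace_closure[OF assms(1)])
    define A where "A = (\<lambda>d. x + d) ` closure D"
    have "convex A" unfolding A_def by (intro convex_translation subspace_imp_convex S)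
    moreover have "closed A" unfolding A_def by (intro closed_translation) simp
    moreover have "A \<noteq> {}" unfolding A_def using subspace_0[OF S] by auto
    ultimately obtain u where u: "u \<in> A" "\<And>b. b \<in> A \<Longrightarrow> norm u \<le> norm b"
      using nearest_point[of A] by blast
    obtain d0 where d0: "u = x + d0" "d0 \<in> closure D" using u(1) unfolding A_def by blast
    have "u = 0"
    proof (rule assms(2), rule min_norm_orthogonal)
      fix d t assume "d \<in> D"
      then have "d \<in> closure D" using closure_subset by auto
      then have "d0 + t *\<^sub>R d \<in> closure D" using S d0(2) by (simp add: subspace_add subspace_scale)
      then have "x + (d0 + t *\<^sub>R d) \<in> A" unfolding A_def by blast
      then show "norm u \<le> norm (u + t *\<^sub>R d)" using u(2) by (simp add: d0(1) add.assoc)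
    qed
    then have "x = - d0" using d0(1) by (simp add: add_eq_0_iff2)
    then show ?thesis using d0(2) S subspace_neg by blast
  qed
  then show ?thesis by blast
qed

text \<open>Convex combinations of the tails of \<open>u\<close> converge strongly while their images still
  converge to \<open>x\<close>; no weak topology is needed.\<close>

lemma image_cball_limit:
  fixes \<iota> :: "'h::{real_inner,complete_space} \<Rightarrow> 'b::real_normed_vector"
  assumes "bounded_linear \<iota>" and u: "\<And>n::nat. norm (u n) \<le> r" and lim: "(\<lambda>n. \<iota> (u n)) \<longlonglongrightarrow> x"
  shows "x \<in> \<iota> ` cball 0 r"
proof -
  interpret bounded_linear \<iota> by fact
  define A where "A n = convex hull (u ` {n..})" for n
  have uA: "u n \<in> A n" for n unfolding A_def by (intro hull_inc) auto
  obtain a l where a: "\<And>n. a n \<in> A n" "a \<longlonglongrightarrow> l"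
    "\<And>r. (\<And>n. \<exists>b\<in>A n. norm b \<le> r) \<Longrightarrow> norm l \<le> r"
  proof (rule nested_convex_limit[of A r])
    show "decseq A" unfolding A_def decseq_def by (auto intro!: hull_mono image_mono del: subsetI)
    show "convex (A n)" for n unfolding A_def by simp
    show "\<exists>b\<in>A n. norm b \<le> r" for n using uA u by blast
  qed blast
  have "norm l \<le> r" using a(3) uA u by blast
  have "(\<lambda>n. \<iota> (a n)) \<longlonglongrightarrow> x"
  proof (rule tendstoI)
    fix e :: real assume e: "e > 0"
    obtain N where N: "\<And>n. n \<ge> N \<Longrightarrow> dist (\<iota> (u n)) x < e"
      using tendstoD[OF lim e] by (auto simp: eventually_sequentially)
    have "dist (\<iota> (a n)) x < e" if "n \<ge> N" for n
    proof -
      have "\<iota> ` A n = convex hull (\<iota> ` u ` {n..})"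
        unfolding A_def by (simp add: convex_hull_linear_image linear_axioms)
      also have "\<dots> \<subseteq> ball x e"
        by (rule hull_minimal) (use N that in \<open>auto simp: dist_commute\<close>)
      finally show ?thesis using a(1)[of n] by (auto simp: dist_commute)
    qed
    then show "\<forall>\<^sub>F n in sequentially. dist (\<iota> (a n)) x < e"
      by (auto simp: eventually_sequentially)
  qed
  moreover have "(\<lambda>n. \<iota> (a n)) \<longlonglongrightarrow> \<iota> l" by (intro tendsto a(2))
  ultimately have "x = \<iota> l" using LIMSEQ_unique by blast
  then show ?thesis using \<open>norm l \<le> r\<close> by auto
qed

section \<open>A minimax theorem\<close>

text \<open>If no point of \<open>K\<close> keeps both functions above \<open>c\<close>, a
  hyperplane in the plane separates the attainable pairs of values from a quadrant whose corner lies
  strictly below \<open>(c, c)\<close>. Its normalised coefficients are weights, \<open>conv\<close>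
  turns the weighted pair into a single \<open>v0\<close>, and this \<open>v0\<close> stays strictly
  below \<open>c\<close> on all of \<open>K\<close>, against \<open>val\<close>.\<close>

lemma minimax_two:
  fixes f :: "'v \<Rightarrow> 'k::metric_space \<Rightarrow> real"
  assumes K: "compact K"
    and usc: "\<And>v c. closed {u\<in>K. c \<le> f v u}"
    and conc: "\<And>u1 u2 \<theta>. u1 \<in> K \<Longrightarrow> u2 \<in> K \<Longrightarrow> 0 < \<theta> \<Longrightarrow> \<theta> < 1 \<Longrightarrow>
        \<exists>u0\<in>K. \<forall>v. \<theta> * f v u1 + (1 - \<theta>) * f v u2 \<le> f v u0"
    and conv: "\<And>v1 v2 \<theta>. 0 < \<theta> \<Longrightarrow> \<theta> < 1 \<Longrightarrow>
        \<exists>v0. \<forall>u\<in>K. f v0 u \<le> \<theta> * f v1 u + (1 - \<theta>) * f v2 u"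
    and val: "\<And>v. \<exists>u\<in>K. c \<le> f v u"
  shows "\<exists>u\<in>K. c \<le> f v1 u \<and> c \<le> f v2 u"
proof (rule ccontr)
  assume neg: "\<not> (\<exists>u\<in>K. c \<le> f v1 u \<and> c \<le> f v2 u)"
  \<comment> \<open>The failure must already occur at a level strictly below \<open>c\<close>:
    points that succeed at the levels \<open>c - 1 / real (Suc n)\<close> would accumulate, by
    compactness and upper semicontinuity, at a point that succeeds at \<open>c\<close>.\<close>
  have "\<exists>n. \<not> (\<exists>u\<in>K. c - 1 / real (Suc n) \<le> f v1 u \<and> c - 1 / real (Suc n) \<le> f v2 u)"
  proof (rule ccontr)
    assume "\<nexists>n. \<not> (\<exists>u\<in>K. c - 1 / real (Suc n) \<le> f v1 u \<and> c - 1 / real (Suc n) \<le> f v2 u)"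
    then obtain w where w: "\<And>n. w n \<in> K" "\<And>n. c - 1 / real (Suc n) \<le> f v1 (w n)"
      "\<And>n. c - 1 / real (Suc n) \<le> f v2 (w n)"
      by metis
    obtain u r where r: "u \<in> K" "strict_mono r" "(w \<circ> r) \<longlonglongrightarrow> u"
      using K w(1) unfolding compact_def by metis
    have u: "c - 1 / real (Suc n) \<le> f v u" if v: "\<And>n. c - 1 / real (Suc n) \<le> f v (w n)" for v n
    proof -
      have "u \<in> {u\<in>K. c - 1 / real (Suc n) \<le> f v u}"
      proof (rule closed_sequentially[OF usc])
        show "(\<lambda>k. (w \<circ> r) (k + n)) \<longlonglongrightarrow> u" by (rule LIMSEQ_ignore_initial_segment[OF r(3)])
        show "(w \<circ> r) (k + n) \<in> {u\<in>K. c - 1 / real (Suc n) \<le> f v u}" for k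
        proof -
          have "n \<le> r (k + n)" using seq_suble[OF r(2), of "k + n"] by linarith
          then have "1 / real (Suc (r (k + n))) \<le> 1 / real (Suc n)" by (simp add: frac_le)
          then show ?thesis using w(1) v[of "r (k + n)"] by auto
        qed
      qed
      then show ?thesis by simp
    qed
    have "(\<lambda>n. c - 1 / real (Suc n)) \<longlonglongrightarrow> c - 0"
      by (intro tendsto_intros LIMSEQ_Suc[OF lim_1_over_n])
    then have "c \<le> f v1 u" "c \<le> f v2 u"
      using LIMSEQ_le_const2[of _ "c - 0"] u[OF w(2)] u[OF w(3)] by auto
    then show False using neg r(1) by blast
  qed
  then obtain c' where c': "c' < c" "\<not> (\<exists>u\<in>K. c' \<le> f v1 u \<and> c' \<le> f v2 u)"
    by (metis diff_less_eq less_add_same_cancel1 of_nat_0_less_iff zero_less_Suc zero_less_divide_1_iff)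
  \<comment> \<open>All pairs dominated by a pair of values, not just the values:
    \<open>conc\<close> yields an inequality only, so convexity holds after closing
    downwards.\<close>
  define S where "S = {(y1, y2) |y1 y2. \<exists>u\<in>K. y1 \<le> f v1 u \<and> y2 \<le> f v2 u}"
  define T where "T = {c'..} \<times> {c'..}"
  have "convex S"
  proof (rule convexI)
    fix x y :: "real \<times> real" and a b :: real
    assume x: "x \<in> S" and y: "y \<in> S" and ab: "0 \<le> a" "0 \<le> b" "a + b = 1"
    obtain u1 where u1: "u1 \<in> K" "fst x \<le> f v1 u1" "snd x \<le> f v2 u1" using x unfolding S_def by auto
    obtain u2 where u2: "u2 \<in> K" "fst y \<le> f v1 u2" "snd y \<le> f v2 u2" using y unfolding S_def by auto
    consider "a = 0" | "a = 1" | "0 < a" "a < 1" using ab by linarith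
    then show "a *\<^sub>R x + b *\<^sub>R y \<in> S"
    proof cases
      case 1 then show ?thesis using ab y by simp
    next
      case 2 then show ?thesis using ab x by simp
    next
      case 3
      obtain u0 where u0: "u0 \<in> K" "\<And>v. a * f v u1 + (1 - a) * f v u2 \<le> f v u0"
        using conc[OF u1(1) u2(1) 3] by blast
      have b: "b = 1 - a" using ab by simp
      have "a * fst x + b * fst y \<le> a * f v1 u1 + b * f v1 u2"
        "a * snd x + b * snd y \<le> a * f v2 u1 + b * f v2 u2"
        using ab u1 u2 by (auto intro!: add_mono mult_left_mono)
      then show ?thesis unfolding S_def b
        using u0(1) u0(2)[of v1] u0(2)[of v2] by (cases x, cases y) (force intro!: bexI[of _ u0])
    qed
  qed
  moreover have "convex T" unfolding T_def by (intro convex_Times) auto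
  moreover have "S \<noteq> {}" using val[of v1] unfolding S_def by blast
  moreover have "T \<noteq> {}" unfolding T_def by auto
  moreover have "S \<inter> T = {}" using c'(2) unfolding S_def T_def by fastforce
  ultimately obtain p b where p: "p \<noteq> 0" "\<And>x. x \<in> S \<Longrightarrow> inner p x \<le> b" "\<And>x. x \<in> T \<Longrightarrow> inner p x \<ge> b"
    using separating_hyperplane_sets[of S T] by metis
  obtain p1 p2 where pp: "p = (p1, p2)" by (cases p)
  have T': "b \<le> p1 * x + p2 * y" if "c' \<le> x" "c' \<le> y" for x y
    using p(3)[of "(x, y)"] that by (auto simp: pp T_def)
  \<comment> \<open>The quadrant is unbounded upwards, so the separating functional cannot have a
    negative coefficient; \<open>?t\<close> is the time at which \<open>q * t + r\<close> has
    dropped to \<open>b - 1\<close>.\<close>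
  have nn: "q \<ge> 0" if "\<And>t. t \<ge> 0 \<Longrightarrow> b \<le> q * t + r" for q r :: real
  proof (rule ccontr)
    assume q: "\<not> q \<ge> 0"
    let ?t = "max 0 ((b - r - 1) / q)"
    have "q * ?t \<le> q * ((b - r - 1) / q)" using q by (intro mult_left_mono_neg) auto
    also have "\<dots> = b - r - 1" using q by simp
    finally show False using that[of ?t] by simp
  qed
  have p1: "p1 \<ge> 0"
    by (rule nn[of _ "p1 * c' + p2 * c'"]) (use T'[of "c' + _" c'] in \<open>simp add: algebra_simps\<close>)
  have p2: "p2 \<ge> 0"
    by (rule nn[of _ "p1 * c' + p2 * c'"]) (use T'[of c' "c' + _"] in \<open>simp add: algebra_simps\<close>)
  have s: "p1 + p2 > 0" using p1 p2 p(1) by (auto simp: pp zero_prod_def)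
  define \<theta> where "\<theta> = p1 / (p1 + p2)"
  have th: "0 \<le> \<theta>" "\<theta> \<le> 1" "1 - \<theta> = p2 / (p1 + p2)"
    unfolding \<theta>_def using p1 p2 s by (auto simp: field_simps)
  have le: "\<theta> * f v1 u + (1 - \<theta>) * f v2 u \<le> c'" if "u \<in> K" for u
  proof -
    have "(f v1 u, f v2 u) \<in> S" unfolding S_def using that by blast
    then have "p1 * f v1 u + p2 * f v2 u \<le> b" using p(2) by (force simp: pp)
    also have "b \<le> p1 * c' + p2 * c'" using T' by auto
    finally have "p1 * f v1 u + p2 * f v2 u \<le> c' * (p1 + p2)" by (simp add: algebra_simps)
    then have "(p1 * f v1 u + p2 * f v2 u) / (p1 + p2) \<le> c'" using s by (simp add: divide_le_eq)
    then show ?thesis unfolding th(3) unfolding \<theta>_def by (simp add: add_divide_distrib)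
  qed
  have "\<exists>v0. \<forall>u\<in>K. f v0 u \<le> c'"
  proof -
    consider "\<theta> = 0" | "\<theta> = 1" | "0 < \<theta>" "\<theta> < 1" using th by linarith
    then show ?thesis
    proof cases
      case 1 then show ?thesis using le by auto
    next
      case 2 then show ?thesis using le by auto
    next
      case 3
      then show ?thesis using conv[OF 3, of v1 v2] le by (meson order_trans)
    qed
  qed
  then show False using val c'(1) by (meson leD le_less_trans order_trans)
qed

text \<open>Each new \<open>w\<close> is absorbed by shrinking \<open>K\<close> to its upper level
  set. The hypotheses survive: \<open>conc\<close> returns a point good for all \<open>v\<close> at
  once, in particular for \<open>w\<close>, so it stays in the smaller set, and \<open>val\<close>
  on the smaller set is precisely the case of two functions.\<close>

lemma minimax_finite:
  fixes f :: "'v \<Rightarrow> 'k::metric_space \<Rightarrow> real"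
  assumes "finite V" "compact K"
    and "\<And>v c. closed {u\<in>K. c \<le> f v u}"
    and "\<And>u1 u2 \<theta>. u1 \<in> K \<Longrightarrow> u2 \<in> K \<Longrightarrow> 0 < \<theta> \<Longrightarrow> \<theta> < 1 \<Longrightarrow>
        \<exists>u0\<in>K. \<forall>v. \<theta> * f v u1 + (1 - \<theta>) * f v u2 \<le> f v u0"
    and "\<And>v1 v2 \<theta>. 0 < \<theta> \<Longrightarrow> \<theta> < 1 \<Longrightarrow>
        \<exists>v0. \<forall>u\<in>K. f v0 u \<le> \<theta> * f v1 u + (1 - \<theta>) * f v2 u"
    and "\<And>v. \<exists>u\<in>K. c \<le> f v u"
  shows "\<exists>u\<in>K. \<forall>v\<in>V. c \<le> f v u"
  using assms
proof (induction V arbitrary: K rule: finite_induct)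
  case empty
  then show ?case by (metis empty_iff)
next
  case (insert w V)
  note K = insert.prems
  define K' where "K' = {u\<in>K. c \<le> f w u}"
  have "\<exists>u\<in>K'. \<forall>v\<in>V. c \<le> f v u"
  proof (rule insert.IH)
    have "K' = K \<inter> K'" by (auto simp: K'_def)
    then show "compact K'" using compact_Int_closed[OF K(1), of K'] K(2) by (simp add: K'_def)
    show "closed {u \<in> K'. d \<le> f v u}" for v d
    proof -
      have "{u \<in> K'. d \<le> f v u} = K' \<inter> {u\<in>K. d \<le> f v u}" by (auto simp: K'_def)
      then show ?thesis using K(2) by (simp add: K'_def closed_Int)
    qed
    show "\<exists>u0\<in>K'. \<forall>v. \<theta> * f v u1 + (1 - \<theta>) * f v u2 \<le> f v u0"
      if u: "u1 \<in> K'" "u2 \<in> K'" and th: "0 < \<theta>" "\<theta> < 1" for u1 u2 \<theta>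
    proof -
      obtain u0 where u0: "u0 \<in> K" "\<forall>v. \<theta> * f v u1 + (1 - \<theta>) * f v u2 \<le> f v u0"
        using K(3)[of u1 u2 \<theta>] u th unfolding K'_def by blast
      have "c = \<theta> * c + (1 - \<theta>) * c" by (simp add: algebra_simps)
      also have "\<dots> \<le> \<theta> * f w u1 + (1 - \<theta>) * f w u2"
        using u th by (intro add_mono mult_left_mono) (auto simp: K'_def)
      finally have "u0 \<in> K'" using u0 by (auto simp: K'_def intro: order_trans)
      then show ?thesis using u0(2) by blast
    qed
    show "\<exists>v0. \<forall>u\<in>K'. f v0 u \<le> \<theta> * f v1 u + (1 - \<theta>) * f v2 u"
      if "0 < \<theta>" "\<theta> < 1" for v1 v2 \<theta>
      using K(4)[OF that, of v1 v2] by (auto simp: K'_def)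
    show "\<exists>u\<in>K'. c \<le> f v u" for v
      using minimax_two[of K f c v w, OF K] by (auto simp: K'_def)
  qed
  then show ?case by (auto simp: K'_def)
qed

text \<open>The finite case says that the closed upper level sets have the finite intersection
  property.\<close>

lemma minimax_compact:
  fixes f :: "'v \<Rightarrow> 'k::metric_space \<Rightarrow> real"
  assumes K: "compact K"
    and usc: "\<And>v c. closed {u\<in>K. c \<le> f v u}"
    and conc: "\<And>u1 u2 \<theta>. u1 \<in> K \<Longrightarrow> u2 \<in> K \<Longrightarrow> 0 < \<theta> \<Longrightarrow> \<theta> < 1 \<Longrightarrow>
        \<exists>u0\<in>K. \<forall>v. \<theta> * f v u1 + (1 - \<theta>) * f v u2 \<le> f v u0"
    and conv: "\<And>v1 v2 \<theta>. 0 < \<theta> \<Longrightarrow> \<theta> < 1 \<Longrightarrow>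
        \<exists>v0. \<forall>u\<in>K. f v0 u \<le> \<theta> * f v1 u + (1 - \<theta>) * f v2 u"
    and val: "\<And>v. \<exists>u\<in>K. c \<le> f v u"
  shows "\<exists>u\<in>K. \<forall>v. c \<le> f v u"
proof -
  have "K \<inter> \<Inter>(range (\<lambda>v. {u\<in>K. c \<le> f v u})) \<noteq> {}"
  proof (rule compact_imp_fip[OF K])
    fix F assume F: "finite F" "F \<subseteq> range (\<lambda>v. {u\<in>K. c \<le> f v u})"
    then obtain V where V: "finite V" "F = (\<lambda>v. {u\<in>K. c \<le> f v u}) ` V"
      by (meson finite_subset_image)
    obtain u where "u \<in> K" "\<forall>v\<in>V. c \<le> f v u"
      using minimax_finite[of V K f c, OF V(1) assms] by blast
    then show "K \<inter> \<Inter>F \<noteq> {}" using V(2) by blast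
  qed (use usc in auto)
  then show ?thesis by blast
qed

section \<open>Paths and Bernstein polynomials\<close>

definition path_of :: "(real \<Rightarrow> real ^ 'd) \<Rightarrow> 'd::finite path" where
  "path_of f = Bcontfun (\<lambda>t. f (max 0 (min 1 t)))"

lemma apply_path_of:
  assumes "continuous_on {0..1} f"
  shows "apply_bcontfun (path_of f) t = f (max 0 (min 1 t))"
proof -
  have "continuous_on UNIV (\<lambda>t. f (max 0 (min 1 t)))"
    by (rule continuous_on_compose2[OF assms]) (auto intro!: continuous_intros)
  moreover have "range (\<lambda>t. f (max 0 (min 1 t))) \<subseteq> f ` {0..1}" by auto
  then have "bounded (range (\<lambda>t. f (max 0 (min 1 t))))"
    by (rule bounded_subset[rotated]) (intro compact_imp_bounded compact_continuous_image assms, simp)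
  ultimately show ?thesis by (simp add: path_of_def Bcontfun_inverse bcontfun_def)
qed

lemma path_of_in_C01: "continuous_on {0..1} f \<Longrightarrow> path_of f \<in> C01"
  by (simp add: C01_def apply_path_of)

lemma C01_apply: "f \<in> C01 \<Longrightarrow> apply_bcontfun f t = apply_bcontfun f (max 0 (min 1 t))"
  by (auto simp only: C01_def mem_Collect_eq)

lemma C01_eqI:
  assumes "f \<in> C01" "g \<in> C01" "\<And>t. t \<in> {0..1} \<Longrightarrow> apply_bcontfun f t = apply_bcontfun g t"
  shows "f = g"
proof (rule bcontfun_eqI)
  fix t :: real
  have "max 0 (min 1 t) \<in> {0..1}" by auto
  then show "apply_bcontfun f t = apply_bcontfun g t"
    using assms(3) C01_apply[OF assms(1), of t] C01_apply[OF assms(2), of t] by simp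
qed

lemma C01_dist_le:
  assumes "f \<in> C01" "g \<in> C01" "\<And>t. t \<in> {0..1} \<Longrightarrow> dist (apply_bcontfun f t) (apply_bcontfun g t) \<le> b"
  shows "dist f g \<le> b"
proof (rule dist_bound)
  fix t :: real
  have "max 0 (min 1 t) \<in> {0..1}" by auto
  then show "dist (apply_bcontfun f t) (apply_bcontfun g t) \<le> b"
    using assms(3) C01_apply[OF assms(1), of t] C01_apply[OF assms(2), of t] by simp
qed

lemma C01_norm_le:
  assumes "f \<in> C01" "\<And>t. t \<in> {0..1} \<Longrightarrow> norm (apply_bcontfun f t) \<le> b"
  shows "norm f \<le> b"
proof -
  have "dist f 0 \<le> b" by (rule C01_dist_le) (use assms in \<open>auto simp: C01_def\<close>)
  then show ?thesis by simp
qed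

lemma subspace_C01: "subspace C01"
  by (simp add: subspace_def C01_def plus_bcontfun.rep_eq scaleR_bcontfun.rep_eq)

lemma subspace_C01_0: "subspace C01_0"
  using subspace_C01 by (auto simp: subspace_def C01_0_def plus_bcontfun.rep_eq scaleR_bcontfun.rep_eq)

lemma C01_0_subset: "C01_0 \<subseteq> C01"
  by (auto simp: C01_0_def)

lemma tendsto_apply_bcontfun:
  "(X \<longlongrightarrow> x) F \<Longrightarrow> ((\<lambda>n. apply_bcontfun (X n) t) \<longlongrightarrow> apply_bcontfun x t) F"
  by (erule metric_tendsto_imp_tendsto) (intro always_eventually allI dist_bounded)

lemma continuous_on_eval: "continuous_on A (\<lambda>x. apply_bcontfun x t)"
  by (auto simp: continuous_on_def intro!: tendsto_apply_bcontfun)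

lemma borel_measurable_eval [measurable]: "(\<lambda>x. apply_bcontfun x t) \<in> borel_measurable borel"
  by (intro borel_measurable_continuous_onI continuous_on_eval)

lemma closed_C01: "closed (C01 :: 'd::finite path set)"
proof -
  have "(C01 :: 'd path set) = (\<Inter>t. {f. apply_bcontfun f t = apply_bcontfun f (max 0 (min 1 t))})"
    by (auto simp: C01_def)
  moreover have "closed \<dots>" by (intro closed_INT ballI closed_Collect_eq continuous_on_eval)
  ultimately show ?thesis by simp
qed

definition bernstein_path :: "nat \<Rightarrow> (nat \<Rightarrow> real ^ 'd) \<Rightarrow> 'd::finite path" where
  "bernstein_path n c = path_of (\<lambda>t. \<Sum>k\<le>n. Bernstein n k t *\<^sub>R c k)"

lemma continuous_on_bernstein_sum:
  fixes c :: "nat \<Rightarrow> 'a::real_normed_vector"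
  shows "continuous_on A (\<lambda>t. \<Sum>k\<le>n. Bernstein n k t *\<^sub>R c k)"
  unfolding Bernstein_def by (intro continuous_intros)

lemma apply_bernstein_path:
  "apply_bcontfun (bernstein_path n c) t = (\<Sum>k\<le>n. Bernstein n k (max 0 (min 1 t)) *\<^sub>R c k)"
  unfolding bernstein_path_def by (rule apply_path_of[OF continuous_on_bernstein_sum])

lemma bernstein_path_in_C01: "bernstein_path n c \<in> C01"
  unfolding bernstein_path_def by (rule path_of_in_C01[OF continuous_on_bernstein_sum])

text \<open>On \<open>{0..1}\<close> the Bernstein weights are nonnegative and sum to one, so every
  value is a convex combination of the coefficients.\<close>

lemma bernstein_path_norm_le:
  assumes "\<And>k. k \<le> n \<Longrightarrow> norm (c k) \<le> b"
  shows "norm (bernstein_path n c) \<le> b"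
proof (rule C01_norm_le[OF bernstein_path_in_C01])
  fix t :: real assume t: "t \<in> {0..1}"
  have "norm (\<Sum>k\<le>n. Bernstein n k t *\<^sub>R c k) \<le> (\<Sum>k\<le>n. norm (Bernstein n k t *\<^sub>R c k))"
    by (rule norm_sum)
  also have "\<dots> \<le> (\<Sum>k\<le>n. Bernstein n k t * b)"
    using t by (intro sum_mono) (auto simp: Bernstein_nonneg intro!: mult_left_mono assms)
  also have "\<dots> = b" by (simp flip: sum_distrib_right)
  finally show "norm (apply_bcontfun (bernstein_path n c) t) \<le> b"
    using t by (simp add: apply_bernstein_path)
qed

lemma bernstein_path_add:
  "bernstein_path n (\<lambda>k. c k + c' k) = bernstein_path n c + bernstein_path n c'"
  by (rule bcontfun_eqI) (simp add: apply_bernstein_path plus_bcontfun.rep_eq scaleR_right_distrib sum.distrib)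

lemma bernstein_path_diff:
  "bernstein_path n (\<lambda>k. c k - c' k) = bernstein_path n c - bernstein_path n c'"
  by (rule bcontfun_eqI)
     (simp add: apply_bernstein_path minus_bcontfun.rep_eq scaleR_right_diff_distrib sum_subtractf)

lemma bernstein_path_scaleR:
  "bernstein_path n (\<lambda>k. r *\<^sub>R c k) = r *\<^sub>R bernstein_path n c"
  by (rule bcontfun_eqI) (simp add: apply_bernstein_path scaleR_bcontfun.rep_eq scaleR_right.sum mult.commute)

text \<open>Sees a path only through finitely many grid values, is linear, and does not increase the
  norm. These features reduce Gaussian estimates on paths to finite dimensions at no cost in the
  constants.\<close>

definition bernstein_op :: "nat \<Rightarrow> 'd::finite path \<Rightarrow> 'd path" where
  "bernstein_op n f = bernstein_path n (\<lambda>k. apply_bcontfun f (real k / real n))"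

lemma bernstein_op_tendsto:
  assumes f: "f \<in> C01"
  shows "(\<lambda>n. bernstein_op n f) \<longlonglongrightarrow> f"
proof (rule metric_LIMSEQ_I)
  fix r :: real assume r: "r > 0"
  define e where "e = r / (2 * real CARD('a))"
  have e: "e > 0" using r by (simp add: e_def)
  have "\<exists>N. \<forall>i n x. N i \<le> n \<and> x \<in> {0..1} \<longrightarrow>
      \<bar>apply_bcontfun f x $ i - (\<Sum>k\<le>n. apply_bcontfun f (k/n) $ i * Bernstein n k x)\<bar> < e"
    by (rule choice, rule allI, rule Bernstein_Weierstrass[OF _ e])
       (intro continuous_intros continuous_on_apply_bcontfun)
  then obtain N where N: "\<And>i n x. N i \<le> n \<Longrightarrow> x \<in> {0..1} \<Longrightarrow>
      \<bar>apply_bcontfun f x $ i - (\<Sum>k\<le>n. apply_bcontfun f (k/n) $ i * Bernstein n k x)\<bar> < e"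
    by blast
  have *: "dist (bernstein_op n f) f \<le> r / 2" if n: "n \<ge> Max (range N)" for n
  proof (rule C01_dist_le)
    show "bernstein_op n f \<in> C01" by (simp add: bernstein_op_def bernstein_path_in_C01)
    fix t :: real assume t: "t \<in> {0..1}"
    let ?d = "apply_bcontfun f t - apply_bcontfun (bernstein_op n f) t"
    have "norm ?d \<le> (\<Sum>i\<in>UNIV. \<bar>?d $ i\<bar>)" by (rule norm_le_l1_cart)
    also have "\<dots> \<le> (\<Sum>i\<in>(UNIV::'a set). e)"
    proof (rule sum_mono)
      fix i
      have "N i \<le> n" using n by (meson Max_ge finite_imageI finite rangeI order_trans)
      from N[OF this t] show "\<bar>?d $ i\<bar> \<le> e"
        using t by (simp add: bernstein_op_def apply_bernstein_path mult.commute)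
    qed
    also have "\<dots> = r / 2" by (simp add: e_def)
    finally show "dist (apply_bcontfun (bernstein_op n f) t) (apply_bcontfun f t) \<le> r / 2"
      by (simp add: dist_norm norm_minus_commute)
  qed (rule f)
  show "\<exists>no. \<forall>n\<ge>no. dist (bernstein_op n f) f < r"
  proof (intro exI allI impI)
    fix n assume "n \<ge> Max (range N)"
    then have "dist (bernstein_op n f) f \<le> r / 2" by (rule *)
    then show "dist (bernstein_op n f) f < r" using r by linarith
  qed
qed

lemma bernstein_op_norm_le: "norm (bernstein_op n f) \<le> norm f"
  unfolding bernstein_op_def by (rule bernstein_path_norm_le) (rule norm_bounded)

lemma bernstein_op_add: "bernstein_op n (f + g) = bernstein_op n f + bernstein_op n g"
  by (simp add: bernstein_op_def plus_bcontfun.rep_eq bernstein_path_add)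

lemma bernstein_op_diff: "bernstein_op n (f - g) = bernstein_op n f - bernstein_op n g"
  by (simp add: bernstein_op_def minus_bcontfun.rep_eq bernstein_path_diff)

lemma bernstein_op_scaleR: "bernstein_op n (r *\<^sub>R f) = r *\<^sub>R bernstein_op n f"
  by (simp add: bernstein_op_def scaleR_bcontfun.rep_eq bernstein_path_scaleR)

lemma bernstein_op_in_C01_0:
  assumes "f \<in> C01_0" shows "bernstein_op n f \<in> C01_0"
proof -
  have "(\<Sum>k\<le>n. Bernstein n k 0 *\<^sub>R apply_bcontfun f (real k / real n)) = 0"
  proof (rule sum.neutral, rule ballI)
    fix k show "Bernstein n k 0 *\<^sub>R apply_bcontfun f (real k / real n) = 0"
      using assms by (cases "k = 0") (auto simp: Bernstein_def C01_0_def)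
  qed
  then show ?thesis
    by (simp add: C01_0_def bernstein_op_def bernstein_path_in_C01 apply_bernstein_path)
qed

section \<open>Separability of the path space and measurability of path-valued maps\<close>

lemma separable_C01:
  obtains e :: "nat \<Rightarrow> 'd::finite path"
  where "range e \<subseteq> C01" "\<And>f r. f \<in> C01 \<Longrightarrow> r > 0 \<Longrightarrow> \<exists>k. dist (e k) f \<le> r"
proof -
  obtain Q :: "(real ^ 'd) set" where Q: "countable Q" "\<And>X. open X \<Longrightarrow> X \<noteq> {} \<Longrightarrow> \<exists>d\<in>Q. d \<in> X"
    using countable_dense_setE by blast
  \<comment> \<open>Polynomials with coefficients in a countable dense set, coded by coefficient
    lists. A list of \<open>Suc n\<close> entries carries a polynomial of degree \<open>n\<close>,
    hence the length minus one.\<close>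
  define D where "D = (\<lambda>xs. bernstein_path (length xs - 1) (\<lambda>k. xs ! k)) ` lists Q"
  have "countable D" unfolding D_def using Q(1) by auto
  moreover have "D \<noteq> {}" unfolding D_def by auto
  moreover have "\<exists>d\<in>D. dist d f \<le> r" if f: "f \<in> C01" and r: "r > 0" for f :: "'d path" and r :: real
  proof -
    obtain n where n: "dist (bernstein_op n f) f < r / 2"
      using metric_LIMSEQ_D[OF bernstein_op_tendsto[OF f], of "r/2"] r by auto
    have "\<exists>q\<in>Q. dist (apply_bcontfun f (real k / real n)) q < r / 2" for k
      using Q(2)[of "ball (apply_bcontfun f (real k / real n)) (r/2)"] r by auto
    then obtain q where q: "\<And>k. q k \<in> Q" "\<And>k. dist (apply_bcontfun f (real k / real n)) (q k) < r / 2"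
      by metis
    let ?xs = "map q [0..<Suc n]"
    have "bernstein_path (length ?xs - 1) (\<lambda>k. ?xs ! k) = bernstein_path n q"
      by (rule bcontfun_eqI) (auto simp: apply_bernstein_path simp del: upt_Suc intro!: sum.cong)
    moreover have "?xs \<in> lists Q" using q(1) by auto
    ultimately have "bernstein_path n q \<in> D" unfolding D_def by (metis (lifting) image_eqI)
    moreover have "norm (bernstein_path n (\<lambda>k. q k - apply_bcontfun f (real k / real n))) \<le> r / 2"
      by (rule bernstein_path_norm_le) (metis dist_commute dist_norm less_imp_le q(2))
    then have "dist (bernstein_path n q) (bernstein_op n f) \<le> r / 2"
      by (simp add: bernstein_path_diff bernstein_op_def dist_norm)
    then have "dist (bernstein_path n q) f \<le> r"
      using n dist_triangle[of "bernstein_path n q" f "bernstein_op n f"] by linarith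
    ultimately show ?thesis by blast
  qed
  moreover have "D \<subseteq> C01" unfolding D_def by (auto simp: bernstein_path_in_C01)
  ultimately show thesis
    using that[of "from_nat_into D"] by (metis range_from_nat_into rangeE)
qed

text \<open>\<open>k n x\<close> is the first member of a dense sequence within
  \<open>1 / real (Suc n)\<close> of \<open>g x\<close>. By continuity such a bound can be tested at
  the countably many rational times, so the choice is measurable as soon as the evaluations of
  \<open>g\<close> are.\<close>

lemma C01_countable_approx:
  fixes g :: "'a \<Rightarrow> 'd::finite path"
  assumes C: "\<And>x. x \<in> space M \<Longrightarrow> g x \<in> C01"
    and meas: "\<And>t. t \<in> {0..1} \<Longrightarrow> (\<lambda>x. apply_bcontfun (g x) t) \<in> borel_measurable M"
  obtains e :: "nat \<Rightarrow> 'd path" and k :: "nat \<Rightarrow> 'a \<Rightarrow> nat"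
  where "\<And>n. k n \<in> measurable M (count_space UNIV)"
    "\<And>x. x \<in> space M \<Longrightarrow> (\<lambda>n. e (k n x)) \<longlonglongrightarrow> g x"
proof -
  obtain e :: "nat \<Rightarrow> 'd path" where e: "range e \<subseteq> C01" "\<And>f r. f \<in> C01 \<Longrightarrow> r > 0 \<Longrightarrow> \<exists>k. dist (e k) f \<le> r"
    by (rule separable_C01) blast
  define Q where "Q = (\<rat> \<inter> {0..1} :: real set)"
  have Q: "countable Q" unfolding Q_def by (intro countable_Int1 countable_rat)
  have clo: "{0..1} \<subseteq> closure Q"
  proof
    fix t :: real assume t: "t \<in> {0..1}"
    show "t \<in> closure Q"
    proof (cases "t = 0 \<or> t = 1")
      case True then show ?thesis unfolding Q_def using closure_subset by fastforce
    next
      case False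
      have "\<exists>q\<in>Q. dist q t < r" if r: "r > 0" for r
      proof -
        obtain q where "q \<in> \<rat>" "t < q" "q < min 1 (t + r)"
          using Rats_dense_in_real[of t "min 1 (t + r)"] False t r by auto
        then show ?thesis using t unfolding Q_def by (intro bexI[of _ q]) (auto simp: dist_real_def)
      qed
      then show ?thesis by (simp add: closure_approachable)
    qed
  qed
  define k where "k n x = (LEAST k. \<forall>q\<in>Q. dist (apply_bcontfun (e k) q) (apply_bcontfun (g x) q) \<le> 1 / real (Suc n))" for n x
  have iff: "(\<forall>q\<in>Q. dist (apply_bcontfun (e k) q) (apply_bcontfun (g x) q) \<le> r) \<longleftrightarrow> dist (e k) (g x) \<le> r"
    if x: "x \<in> space M" for x r k
  proof
    assume *: "\<forall>q\<in>Q. dist (apply_bcontfun (e k) q) (apply_bcontfun (g x) q) \<le> r"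
    have "dist (apply_bcontfun (e k) t) (apply_bcontfun (g x) t) \<le> r" if t: "t \<in> {0..1}" for t
    proof -
      have "closed {t. dist (apply_bcontfun (e k) t) (apply_bcontfun (g x) t) \<le> r}"
        by (intro closed_Collect_le continuous_intros continuous_on_apply_bcontfun)
      then have "closure Q \<subseteq> {t. dist (apply_bcontfun (e k) t) (apply_bcontfun (g x) t) \<le> r}"
        using * by (intro closure_minimal) auto
      then show ?thesis using t clo by blast
    qed
    then show "dist (e k) (g x) \<le> r" by (intro C01_dist_le) (use e C x in auto)
  next
    assume "dist (e k) (g x) \<le> r"
    then show "\<forall>q\<in>Q. dist (apply_bcontfun (e k) q) (apply_bcontfun (g x) q) \<le> r"
      using dist_bounded order_trans by blast
  qed
  show thesis
  proof (rule that[of k e])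
    fix n
    have Qm: "(\<lambda>x. apply_bcontfun (g x) q) \<in> borel_measurable M" if "q \<in> Q" for q
      using meas that by (auto simp: Q_def)
    have "Measurable.pred M (\<lambda>x. dist (apply_bcontfun (e k) q) (apply_bcontfun (g x) q) \<le> 1 / real (Suc n))"
      if "q \<in> Q" for k q
      using Qm[OF that] by measurable
    then have "Measurable.pred M (\<lambda>x. \<forall>q\<in>Q. dist (apply_bcontfun (e k) q) (apply_bcontfun (g x) q) \<le> 1 / real (Suc n))" for k
      unfolding pred_def by (rule sets.sets_Collect_countable_All'[OF _ Q])
    then show "k n \<in> measurable M (count_space UNIV)"
      unfolding k_def[abs_def] by (rule measurable_Least)
  next
    fix x assume x: "x \<in> space M"
    have "dist (e (k n x)) (g x) \<le> 1 / real (Suc n)" for n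
    proof -
      have "\<exists>k. dist (e k) (g x) \<le> 1 / real (Suc n)" by (rule e(2)) (use C x in auto)
      then have "\<exists>k. \<forall>q\<in>Q. dist (apply_bcontfun (e k) q) (apply_bcontfun (g x) q) \<le> 1 / real (Suc n)"
        unfolding iff[OF x] .
      then have "\<forall>q\<in>Q. dist (apply_bcontfun (e (k n x)) q) (apply_bcontfun (g x) q) \<le> 1 / real (Suc n)"
        unfolding k_def by (rule LeastI_ex)
      then show ?thesis unfolding iff[OF x] .
    qed
    then have "(\<lambda>n. dist (e (k n x)) (g x)) \<longlonglongrightarrow> 0"
      by (intro tendsto_sandwich[OF _ _ tendsto_const LIMSEQ_Suc[OF lim_1_over_n]]) auto
    then show "(\<lambda>n. e (k n x)) \<longlonglongrightarrow> g x" by (rule tendsto_dist_iff[THEN iffD2])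
  qed
qed

text \<open>Reduces Borel measurability in the uniform topology to the evaluations, as a pointwise
  limit of countably-valued maps.\<close>

lemma borel_measurable_pathI:
  fixes g :: "'a \<Rightarrow> 'd::finite path"
  assumes "\<And>x. x \<in> space M \<Longrightarrow> g x \<in> C01"
    and "\<And>t. t \<in> {0..1} \<Longrightarrow> (\<lambda>x. apply_bcontfun (g x) t) \<in> borel_measurable M"
  shows "g \<in> borel_measurable M"
proof -
  obtain e :: "nat \<Rightarrow> 'd path" and k where k: "\<And>n. k n \<in> measurable M (count_space UNIV)"
    and lim: "\<And>x. x \<in> space M \<Longrightarrow> (\<lambda>n. e (k n x)) \<longlonglongrightarrow> g x"
    by (rule C01_countable_approx[OF assms]) blast+
  show ?thesis
    by (rule borel_measurable_LIMSEQ_metric[OF _ lim]) (rule measurable_compose[OF k], simp)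
qed

text \<open>The product of the Borel fields is too small here because \<open>'d path\<close> is not separable,
  so measurability of the triple is obtained by replacing \<open>g\<close> with countably-valued functions.\<close>

lemma borel_measurable_triple:
  fixes g :: "'a \<Rightarrow> 'd::finite path" and h :: "'a \<Rightarrow> 'l::polish_space" and f :: "'a \<Rightarrow> real"
  assumes f: "f \<in> borel_measurable M" and g: "g \<in> borel_measurable M" and h: "h \<in> borel_measurable M"
    and C: "\<And>x. x \<in> space M \<Longrightarrow> g x \<in> C01"
  shows "(\<lambda>x. (f x, g x, h x)) \<in> borel_measurable M"
proof -
  have ev: "(\<lambda>x. apply_bcontfun (g x) t) \<in> borel_measurable M" for t
    using g by measurable
  obtain e :: "nat \<Rightarrow> 'd path" and k where k: "\<And>n. k n \<in> measurable M (count_space UNIV)"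
    and lim: "\<And>x. x \<in> space M \<Longrightarrow> (\<lambda>n. e (k n x)) \<longlonglongrightarrow> g x"
    by (rule C01_countable_approx[OF C ev]) blast+
  show ?thesis
  proof (rule borel_measurable_LIMSEQ_metric)
    fix n
    have "(\<lambda>x. (f x, e i, h x)) \<in> borel_measurable M" for i
    proof -
      have "(\<lambda>p::real \<times> 'l. (fst p, e i, snd p)) \<in> borel_measurable borel"
        by (intro borel_measurable_continuous_onI continuous_intros)
      from measurable_compose[OF borel_measurable_Pair[OF f h] this] show ?thesis by simp
    qed
    then show "(\<lambda>x. (f x, e (k n x), h x)) \<in> borel_measurable M"
      by (rule measurable_compose_countable[OF _ k])
  next
    fix x assume "x \<in> space M"
    then show "(\<lambda>n. (f x, e (k n x), h x)) \<longlonglongrightarrow> (f x, g x, h x)"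
      by (intro tendsto_intros lim)
  qed
qed

context coefficient
begin

lemma borel_measurable_mu:
  assumes "f \<in> borel_measurable M" "g \<in> borel_measurable M" "h \<in> borel_measurable M"
    and "\<And>x. x \<in> space M \<Longrightarrow> f x \<in> {0..1}" "\<And>x. x \<in> space M \<Longrightarrow> g x \<in> C01"
  shows "(\<lambda>x. \<mu> (f x) (g x) (h x)) \<in> borel_measurable M"
proof -
  have "(\<lambda>x. (f x, g x, h x)) \<in> measurable M (restrict_space borel ({0..1} \<times> C01 \<times> UNIV))"
    by (rule measurable_restrict_space2) (use assms in \<open>auto intro!: borel_measurable_triple\<close>)
  from measurable_compose[OF this borel_mu] show ?thesis by simp
qed

end

section \<open>The controlled equation\<close>

lemma norm_upto_le:
  assumes "0 \<le> t" "\<And>s. s \<in> {0..t} \<Longrightarrow> norm (apply_bcontfun f s) \<le> b"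
  shows "norm_upto t f \<le> b"
  unfolding norm_upto_def by (rule cSUP_least) (use assms in auto)

text \<open>Bielecki's exponential weight. Measured after this weighting, the Picard map contracts
  on the whole interval at once instead of on short pieces. It is encoded as a map on paths, so that
  the supremum norm and completeness of \<open>C01\<close> remain usable.\<close>

definition weighted :: "real \<Rightarrow> 'd::finite path \<Rightarrow> 'd path" where
  "weighted c x = path_of (\<lambda>t. exp (- c * t) *\<^sub>R apply_bcontfun x t)"

lemma continuous_on_weighted:
  fixes x :: "'d::finite path"
  shows "continuous_on A (\<lambda>t. exp (- c * t) *\<^sub>R apply_bcontfun x t)"
  by (intro continuous_intros continuous_on_apply_bcontfun)

lemma apply_weighted:
  "t \<in> {0..1} \<Longrightarrow> apply_bcontfun (weighted c x) t = exp (- c * t) *\<^sub>R apply_bcontfun x t"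
  unfolding weighted_def by (subst apply_path_of[OF continuous_on_weighted]) auto

lemma weighted_in_C01: "weighted c x \<in> C01"
  unfolding weighted_def by (rule path_of_in_C01[OF continuous_on_weighted])

lemma weighted_inverse: "x \<in> C01 \<Longrightarrow> weighted (- c) (weighted c x) = x"
  by (rule C01_eqI[OF weighted_in_C01]) (simp_all add: apply_weighted flip: exp_add)

lemma weighted_diff: "weighted c (x - y) = weighted c x - weighted c y"
proof (rule C01_eqI[OF weighted_in_C01])
  show "weighted c x - weighted c y \<in> C01"
    by (intro subspace_diff[OF subspace_C01] weighted_in_C01)
qed (simp add: apply_weighted minus_bcontfun.rep_eq scaleR_right_diff_distrib)

lemma norm_apply_le_weighted:
  assumes "t \<in> {0..1}"
  shows "norm (apply_bcontfun x t) \<le> exp (c * t) * norm (weighted c x)"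
proof -
  have "apply_bcontfun x t = exp (c * t) *\<^sub>R apply_bcontfun (weighted c x) t"
    using assms by (simp add: apply_weighted flip: exp_add)
  then show ?thesis by (simp add: norm_bounded)
qed

lemma norm_le_weighted:
  assumes "x \<in> C01" "0 \<le> c"
  shows "norm x \<le> exp c * norm (weighted c x)"
proof (rule C01_norm_le[OF assms(1)])
  fix t :: real assume t: "t \<in> {0..1}"
  have "c * t \<le> c * 1" using t assms(2) by (intro mult_left_mono) auto
  then have "exp (c * t) * norm (weighted c x) \<le> exp c * norm (weighted c x)"
    by (intro mult_right_mono) auto
  then show "norm (apply_bcontfun x t) \<le> exp c * norm (weighted c x)"
    using norm_apply_le_weighted[OF t, of x c] by linarith
qed

context coefficient
begin

definition lipschitz_const :: real where
  "lipschitz_const = (SOME L. L > 0 \<and> (\<forall>t\<in>{0..1}. \<forall>\<alpha>\<in>C01. \<forall>\<alpha>'\<in>C01. \<forall>l.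
         norm (\<mu> t \<alpha> l - \<mu> t \<alpha>' l) \<le> L * norm_upto t (\<alpha> - \<alpha>') \<and>
         norm (\<mu> t \<alpha> l) \<le> L * (1 + norm_upto t \<alpha>)))"

lemma lipschitz_const_props:
  "lipschitz_const > 0 \<and> (\<forall>t\<in>{0..1}. \<forall>\<alpha>\<in>C01. \<forall>\<alpha>'\<in>C01. \<forall>l.
         norm (\<mu> t \<alpha> l - \<mu> t \<alpha>' l) \<le> lipschitz_const * norm_upto t (\<alpha> - \<alpha>') \<and>
         norm (\<mu> t \<alpha> l) \<le> lipschitz_const * (1 + norm_upto t \<alpha>))"
  unfolding lipschitz_const_def by (rule someI_ex) (use lipschitz_growth_mu in auto)

lemma lipschitz_const_pos: "lipschitz_const > 0" using lipschitz_const_props by blast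

lemma mu_growth:
  assumes "t \<in> {0..1}" "x \<in> C01"
  shows "norm (\<mu> t x l) \<le> lipschitz_const * (1 + norm x)"
proof -
  have "norm (\<mu> t x l) \<le> lipschitz_const * (1 + norm_upto t x)" using lipschitz_const_props assms by blast
  also have "\<dots> \<le> lipschitz_const * (1 + norm x)"
    using assms lipschitz_const_pos by (intro mult_left_mono add_left_mono norm_upto_le norm_bounded) auto
  finally show ?thesis .
qed

lemma mu_lipschitz:
  assumes "t \<in> {0..1}" "x \<in> C01" "y \<in> C01"
  shows "norm (\<mu> t x l - \<mu> t y l) \<le> lipschitz_const * (exp (2 * lipschitz_const * t) * norm (weighted (2 * lipschitz_const) (x - y)))"
proof -
  have "norm (\<mu> t x l - \<mu> t y l) \<le> lipschitz_const * norm_upto t (x - y)" using lipschitz_const_props assms by blast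
  also have "norm_upto t (x - y) \<le> exp (2 * lipschitz_const * t) * norm (weighted (2 * lipschitz_const) (x - y))"
  proof (rule norm_upto_le)
    fix s assume s: "s \<in> {0..t}"
    have "norm (apply_bcontfun (x - y) s) \<le> exp (2 * lipschitz_const * s) * norm (weighted (2 * lipschitz_const) (x - y))"
      using s assms by (intro norm_apply_le_weighted) auto
    also have "\<dots> \<le> exp (2 * lipschitz_const * t) * norm (weighted (2 * lipschitz_const) (x - y))"
      using s lipschitz_const_pos by (intro mult_right_mono) auto
    finally show "norm (apply_bcontfun (x - y) s) \<le> \<dots>" .
  qed (use assms in auto)
  finally show ?thesis using lipschitz_const_pos by simp
qed

definition drift :: "(real \<Rightarrow> 'l) \<Rightarrow> 'd path \<Rightarrow> real \<Rightarrow> real ^ 'd" where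
  "drift f x t = (LINT s:{0..t}|lborel. \<mu> s x (f s))"

abbreviation control_fun :: "(real \<Rightarrow> 'l) \<Rightarrow> bool" where
  "control_fun f \<equiv> f \<in> borel_measurable (restrict_space borel {0..1})"

lemma set_integrable_mu:
  assumes f: "control_fun f" and x: "x \<in> C01" and t: "t \<le> 1"
  shows "set_integrable lborel {0..t} (\<lambda>s. \<mu> s x (f s))"
proof -
  have "(\<lambda>s. \<mu> s x (f s)) \<in> borel_measurable (restrict_space borel {0..t})"
  proof (rule borel_measurable_mu)
    show "f \<in> borel_measurable (restrict_space borel {0..t})"
      by (rule measurable_restrict_mono[OF f]) (use t in auto)
    show "(\<lambda>s. s) \<in> borel_measurable (restrict_space borel {0..t})"
      by (rule measurable_restrict_space1) simp
  qed (use x t in \<open>auto simp: space_restrict_space\<close>)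
  then have meas: "(\<lambda>s. indicator {0..t} s *\<^sub>R \<mu> s x (f s)) \<in> borel_measurable borel"
    by (subst (asm) borel_measurable_restrict_space_iff) (auto simp: scaleR_conv_of_real)
  show ?thesis
    unfolding set_integrable_def
  proof (rule Bochner_Integration.integrable_bound)
    show "integrable lborel (\<lambda>s. (lipschitz_const * (1 + norm x)) * indicator {0..t} s)"
      by (intro integrable_mult_right integrable_real_indicator) (auto simp: emeasure_lborel_Icc_eq)
    show "AE s in lborel. norm (indicator {0..t} s *\<^sub>R \<mu> s x (f s)) \<le> norm (lipschitz_const * (1 + norm x) * indicator {0..t} s)"
    proof (rule AE_I2)
      fix s
      have "norm (\<mu> s x (f s)) \<le> lipschitz_const * (1 + norm x)" if "s \<in> {0..t}"
        by (rule mu_growth) (use that t x in auto)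
      then show "norm (indicator {0..t} s *\<^sub>R \<mu> s x (f s)) \<le> norm (lipschitz_const * (1 + norm x) * indicator {0..t} s)"
        by (cases "s \<in> {0..t}") auto
    qed
  qed (use meas in simp)
qed

lemma continuous_on_drift:
  assumes f: "control_fun f" and x: "x \<in> C01"
  shows "continuous_on {0..1} (drift f x)"
proof -
  have "drift f x t = integral {0..t} (\<lambda>s. \<mu> s x (f s))" if "t \<in> {0..1}" for t
    unfolding drift_def using that
    by (intro set_borel_integral_eq_integral set_integrable_mu f x) auto
  moreover have "(\<lambda>s. \<mu> s x (f s)) integrable_on {0..1}"
    by (intro set_borel_integral_eq_integral set_integrable_mu f x) auto
  ultimately show ?thesis
    using indefinite_integral_continuous_1[of "\<lambda>s. \<mu> s x (f s)" 0 1]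
    by (subst continuous_on_cong[OF refl]) auto
qed

lemma drift_cong_AE:
  assumes f: "control_fun f" and g: "control_fun g" and x: "x \<in> C01" and t: "t \<in> {0..1}"
    and ae: "AE s\<in>{0..1} in lborel. f s = g s"
  shows "drift f x t = drift g x t"
  unfolding drift_def set_lebesgue_integral_def
proof (rule integral_cong_AE)
  show "(\<lambda>s. indicator {0..t} s *\<^sub>R \<mu> s x (f s)) \<in> borel_measurable lborel"
    using set_integrable_mu[OF f x, of t] t unfolding set_integrable_def by auto
  show "(\<lambda>s. indicator {0..t} s *\<^sub>R \<mu> s x (g s)) \<in> borel_measurable lborel"
    using set_integrable_mu[OF g x, of t] t unfolding set_integrable_def by auto
  show "AE s in lborel. indicator {0..t} s *\<^sub>R \<mu> s x (f s) = indicator {0..t} s *\<^sub>R \<mu> s x (g s)"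
    using ae by eventually_elim (use t in \<open>auto simp: indicator_def\<close>)
qed

text \<open>The weight rate is twice the Lipschitz constant \<open>L\<close> because
  \<open>L * exp (2 * L * s)\<close> integrates over \<open>{0..t}\<close> to
  \<open>(exp (2 * L * t) - 1) / 2\<close>; this is the source of the contraction factor one
  half.\<close>

lemma drift_lipschitz:
  assumes f: "control_fun f" and x: "x \<in> C01" and y: "y \<in> C01" and t: "t \<in> {0..1}"
  shows "norm (drift f x t - drift f y t) \<le> exp (2 * lipschitz_const * t) * (norm (weighted (2 * lipschitz_const) (x - y)) / 2)"
proof -
  define D where "D = norm (weighted (2 * lipschitz_const) (x - y))"
  have D: "D \<ge> 0" by (simp add: D_def)
  have ix: "set_integrable lborel {0..t} (\<lambda>s. \<mu> s x (f s))" "set_integrable lborel {0..t} (\<lambda>s. \<mu> s y (f s))"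
    using set_integrable_mu[OF f] x y t by auto
  have id: "set_integrable lborel {0..t} (\<lambda>s. \<mu> s x (f s) - \<mu> s y (f s))"
    using ix by (rule set_integral_diff)
  have "(LINT s|lborel. (lipschitz_const * (exp (2 * lipschitz_const * s) * D)) * indicator {0..t} s) =
      exp (2 * lipschitz_const * t) * D / 2 - exp (2 * lipschitz_const * 0) * D / 2"
    by (rule integral_FTC_Icc_real) (use t lipschitz_const_pos in \<open>auto intro!: derivative_eq_intros continuous_intros\<close>)
  then have FTC: "(LINT s:{0..t}|lborel. lipschitz_const * (exp (2 * lipschitz_const * s) * D)) =
      exp (2 * lipschitz_const * t) * D / 2 - exp (2 * lipschitz_const * 0) * D / 2"
    unfolding set_lebesgue_integral_def real_scaleR_def by (simp only: mult.commute)
  have intg: "set_integrable lborel {0..t} (\<lambda>s. lipschitz_const * (exp (2 * lipschitz_const * s) * D))"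
    unfolding set_integrable_def
    by (rule borel_integrable_compact) (auto intro!: continuous_intros)
  have "drift f x t - drift f y t = (LINT s:{0..t}|lborel. \<mu> s x (f s) - \<mu> s y (f s))"
    unfolding drift_def using ix by (rule set_integral_diff(2)[symmetric])
  also have "norm \<dots> \<le> (LINT s:{0..t}|lborel. norm (\<mu> s x (f s) - \<mu> s y (f s)))"
    using id by (rule set_integral_norm_bound)
  also have "\<dots> \<le> (LINT s:{0..t}|lborel. lipschitz_const * (exp (2 * lipschitz_const * s) * D))"
    unfolding D_def
    by (intro set_integral_mono set_integrable_norm id intg[unfolded D_def] mu_lipschitz x y) (use t in auto)
  also have "\<dots> = exp (2 * lipschitz_const * t) * D / 2 - D / 2"
    using FTC by simp
  also have "\<dots> \<le> exp (2 * lipschitz_const * t) * (D / 2)" using D by simp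
  finally show ?thesis unfolding D_def .
qed

definition picard :: "real ^ 'd \<Rightarrow> (real \<Rightarrow> 'l) \<Rightarrow> 'd path \<Rightarrow> 'd path \<Rightarrow> 'd path" where
  "picard x0 f w x = path_of (\<lambda>t. x0 + drift f x t + apply_bcontfun w t)"

lemma continuous_on_picard:
  "control_fun f \<Longrightarrow> x \<in> C01 \<Longrightarrow> continuous_on {0..1} (\<lambda>t. x0 + drift f x t + apply_bcontfun w t)"
  by (intro continuous_intros continuous_on_drift continuous_on_apply_bcontfun)

lemma picard_in_C01: "control_fun f \<Longrightarrow> x \<in> C01 \<Longrightarrow> picard x0 f w x \<in> C01"
  unfolding picard_def by (intro path_of_in_C01 continuous_on_picard)

lemma apply_picard:
  "control_fun f \<Longrightarrow> x \<in> C01 \<Longrightarrow> t \<in> {0..1} \<Longrightarrow>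
    apply_bcontfun (picard x0 f w x) t = x0 + drift f x t + apply_bcontfun w t"
  unfolding picard_def by (subst apply_path_of[OF continuous_on_picard]) auto

text \<open>The two sides may carry different noises: with \<open>w = w'\<close> this is the
  contraction, and at fixed points it becomes Lipschitz dependence on the noise.\<close>

lemma picard_contraction:
  assumes f: "control_fun f" and x: "x \<in> C01" and y: "y \<in> C01"
  shows "norm (weighted (2 * lipschitz_const) (picard x0 f w x - picard x0 f w' y)) \<le>
    norm (weighted (2 * lipschitz_const) (x - y)) / 2 + norm (w - w')"
proof (rule C01_norm_le[OF weighted_in_C01])
  fix t :: real assume t: "t \<in> {0..1}"
  let ?D = "norm (weighted (2 * lipschitz_const) (x - y))"
  have "apply_bcontfun (picard x0 f w x - picard x0 f w' y) t =
      (drift f x t - drift f y t) + apply_bcontfun (w - w') t"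
    using f x y t by (simp add: minus_bcontfun.rep_eq apply_picard)
  also have "norm \<dots> \<le> exp (2 * lipschitz_const * t) * (?D / 2) + norm (w - w')"
    by (intro norm_triangle_mono drift_lipschitz f x y t norm_bounded)
  finally have "exp (- 2 * lipschitz_const * t) * norm (apply_bcontfun (picard x0 f w x - picard x0 f w' y) t) \<le>
      exp (- 2 * lipschitz_const * t) * (exp (2 * lipschitz_const * t) * (?D / 2) + norm (w - w'))"
    by (intro mult_left_mono) auto
  also have "\<dots> = ?D / 2 + exp (- 2 * lipschitz_const * t) * norm (w - w')"
    by (simp add: distrib_left mult.assoc[symmetric] flip: exp_add)
  also have "exp (- 2 * lipschitz_const * t) * norm (w - w') \<le> 1 * norm (w - w')"
    using t lipschitz_const_pos by (intro mult_right_mono) auto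
  finally show "norm (apply_bcontfun (weighted (2 * lipschitz_const) (picard x0 f w x - picard x0 f w' y)) t) \<le>
      ?D / 2 + norm (w - w')"
    using t by (simp add: apply_weighted)
qed

text \<open>The term with factor one half is absorbed on the left, then the weight is removed. The
  resulting constant does not involve the control \<open>f\<close>; both asymptotic bounds rest on
  this uniformity.\<close>

lemma picard_fixpoint_stable:
  assumes f: "control_fun f" and x: "x \<in> C01" "picard x0 f w x = x" and y: "y \<in> C01" "picard x0 f w' y = y"
  shows "norm (x - y) \<le> 2 * exp (2 * lipschitz_const) * norm (w - w')"
proof -
  have "norm (weighted (2 * lipschitz_const) (x - y)) \<le> norm (weighted (2 * lipschitz_const) (x - y)) / 2 + norm (w - w')"
    using picard_contraction[OF f x(1) y(1), of x0 w w'] x y by simp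
  then have "norm (weighted (2 * lipschitz_const) (x - y)) \<le> 2 * norm (w - w')" by simp
  moreover have "norm (x - y) \<le> exp (2 * lipschitz_const) * norm (weighted (2 * lipschitz_const) (x - y))"
    using lipschitz_const_pos x y by (intro norm_le_weighted subspace_diff[OF subspace_C01]) auto
  ultimately have "norm (x - y) \<le> exp (2 * lipschitz_const) * (2 * norm (w - w'))"
    by (meson exp_ge_zero mult_left_mono order_trans)
  then show ?thesis by (simp only: mult_ac)
qed

lemma picard_fixpoint_exists:
  assumes f: "control_fun f"
  obtains x where "x \<in> C01" "picard x0 f w x = x"
proof -
  \<comment> \<open>The Picard map conjugated by the weight, so that Banach's theorem applies in the
    plain supremum norm.\<close>
  define T where "T y = weighted (2 * lipschitz_const) (picard x0 f w (weighted (- (2 * lipschitz_const)) y))" for y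
  have "\<exists>!y\<in>C01. T y = y"
  proof (rule Banach_fix[OF complete_eq_closed[THEN iffD2, OF closed_C01]])
    show "(C01 :: 'd path set) \<noteq> {}" using subspace_0[OF subspace_C01] by blast
    show "T ` C01 \<subseteq> C01" by (auto simp: T_def weighted_in_C01)
    fix y z :: "'d path" assume yz: "y \<in> C01" "z \<in> C01"
    have "dist (T y) (T z) = norm (weighted (2 * lipschitz_const) (picard x0 f w (weighted (- (2 * lipschitz_const)) y) -
        picard x0 f w (weighted (- (2 * lipschitz_const)) z)))"
      by (simp only: T_def dist_norm weighted_diff)
    also have "\<dots> \<le> norm (weighted (2 * lipschitz_const) (weighted (- (2 * lipschitz_const)) y - weighted (- (2 * lipschitz_const)) z)) / 2"
      using picard_contraction[OF f weighted_in_C01 weighted_in_C01, of x0 w "- (2 * lipschitz_const)" y w "- (2 * lipschitz_const)" z]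
      by simp
    also have "\<dots> = norm (y - z) / 2"
      unfolding weighted_diff using weighted_inverse[OF yz(1), of "- (2 * lipschitz_const)"] weighted_inverse[OF yz(2), of "- (2 * lipschitz_const)"]
      by simp
    finally show "dist (T y) (T z) \<le> (1/2) * dist y z" by (simp add: dist_norm)
  qed auto
  then obtain y where y: "y \<in> C01" "T y = y" by blast
  show thesis
  proof (rule that)
    show "weighted (- (2 * lipschitz_const)) y \<in> C01" by (rule weighted_in_C01)
    have "weighted (- (2 * lipschitz_const)) (T y) = picard x0 f w (weighted (- (2 * lipschitz_const)) y)"
      unfolding T_def by (intro weighted_inverse picard_in_C01 f weighted_in_C01)
    then show "picard x0 f w (weighted (- (2 * lipschitz_const)) y) = weighted (- (2 * lipschitz_const)) y" using y by simp
  qed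
qed

lemma picard_iterates_tendsto:
  assumes f: "control_fun f" and x: "x \<in> C01" "picard x0 f w x = x"
  shows "(\<lambda>n. (picard x0 f w ^^ n) 0) \<longlonglongrightarrow> x"
proof -
  let ?y = "\<lambda>n. (picard x0 f w ^^ n) 0"
  have C: "?y n \<in> C01" for n
    by (induction n) (auto intro: picard_in_C01[OF f] subspace_0[OF subspace_C01])
  have W: "norm (weighted (2 * lipschitz_const) (?y n - x)) \<le> norm (weighted (2 * lipschitz_const) (0 - x)) / 2 ^ n" for n
  proof (induction n)
    case (Suc n)
    have "norm (weighted (2 * lipschitz_const) (?y (Suc n) - x)) \<le> norm (weighted (2 * lipschitz_const) (?y n - x)) / 2"
      using picard_contraction[OF f C[of n] x(1), of x0 w w] x(2) by simp
    then show ?case using Suc by simp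
  qed simp
  have bound: "dist (?y n) x \<le> exp (2 * lipschitz_const) * norm (weighted (2 * lipschitz_const) (0 - x)) * (1 / 2) ^ n" for n
  proof -
    have "norm (?y n - x) \<le> exp (2 * lipschitz_const) * norm (weighted (2 * lipschitz_const) (?y n - x))"
      using lipschitz_const_pos C x by (intro norm_le_weighted subspace_diff[OF subspace_C01]) auto
    also have "\<dots> \<le> exp (2 * lipschitz_const) * (norm (weighted (2 * lipschitz_const) (0 - x)) / 2 ^ n)"
      by (intro mult_left_mono W) auto
    finally show ?thesis by (simp add: dist_norm power_divide)
  qed
  have lim: "(\<lambda>n. exp (2 * lipschitz_const) * norm (weighted (2 * lipschitz_const) (0 - x)) * (1 / 2) ^ n) \<longlonglongrightarrow> 0"
    by (intro tendsto_mult_right_zero LIMSEQ_power_zero) simp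
  have "(\<lambda>n. dist (?y n) x) \<longlonglongrightarrow> 0"
    by (rule tendsto_sandwich[OF _ _ tendsto_const lim]) (use bound in auto)
  then show ?thesis by (rule tendsto_dist_iff[THEN iffD2])
qed

definition solves :: "real ^ 'd \<Rightarrow> (real \<Rightarrow> 'l) \<Rightarrow> 'd path \<Rightarrow> 'd path \<Rightarrow> bool" where
  "solves x0 f w x \<longleftrightarrow> x \<in> C01 \<and> (\<forall>t\<in>{0..1}. apply_bcontfun x t = x0 + drift f x t + apply_bcontfun w t)"

lemma solves_iff_picard:
  assumes f: "control_fun f"
  shows "solves x0 f w x \<longleftrightarrow> x \<in> C01 \<and> picard x0 f w x = x"
proof
  assume "solves x0 f w x"
  then show "x \<in> C01 \<and> picard x0 f w x = x"
    unfolding solves_def using f by (auto intro!: C01_eqI picard_in_C01 simp: apply_picard)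
next
  assume "x \<in> C01 \<and> picard x0 f w x = x"
  then show "solves x0 f w x" unfolding solves_def using apply_picard[OF f, of x _ x0 w] by auto
qed

lemma solves_solution_map: "solves x0 (rep_control v) w (solution_map \<mu> x0 v w)"
proof -
  have f: "control_fun (rep_control v)" by (rule borel_rep_control)
  have eq: "solution_map \<mu> x0 v w = (THE x. solves x0 (rep_control v) w x)"
    unfolding solution_map_def solves_def drift_def ..
  obtain x where x: "x \<in> C01" "picard x0 (rep_control v) w x = x"
    by (rule picard_fixpoint_exists[OF f])
  show ?thesis
    unfolding eq
  proof (rule theI)
    show "solves x0 (rep_control v) w x" using x by (simp add: solves_iff_picard[OF f])
    fix y assume "solves x0 (rep_control v) w y"
    then have "y \<in> C01" "picard x0 (rep_control v) w y = y" by (simp_all add: solves_iff_picard[OF f])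
    from picard_fixpoint_stable[OF f this x] show "y = x" by simp
  qed
qed

lemma solution_map_in_C01: "solution_map \<mu> x0 v w \<in> C01"
  using solves_solution_map unfolding solves_def by blast

lemma solution_map_lipschitz:
  "norm (solution_map \<mu> x0 v w - solution_map \<mu> x0 v w') \<le> 2 * exp (2 * lipschitz_const) * norm (w - w')"
  using solves_solution_map[of x0 v w] solves_solution_map[of x0 v w']
  unfolding solves_iff_picard[OF borel_rep_control]
  by (intro picard_fixpoint_stable[OF borel_rep_control]) auto

lemma rep_abs_control:
  assumes "control_fun f"
  shows "AE s\<in>{0..1} in lborel. rep_control (abs_control f) s = f s"
proof -
  have "control_eq f f" using assms by (simp add: control_eq_def)
  then have "control_eq (rep_control (abs_control f)) f"
    by (rule Quotient3_rep_abs[OF Quotient3_control])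
  then show ?thesis by (simp add: control_eq_def)
qed

text \<open>The drift ignores null sets, so the iteration may run with \<open>f\<close> itself,
  although the solution map uses whatever representative \<open>rep_control\<close> picks. A jointly
  measurable process can thus be inserted directly.\<close>

lemma picard_iterates_tendsto_solution_map:
  assumes f: "control_fun f"
  shows "(\<lambda>n. (picard x0 f w ^^ n) 0) \<longlonglongrightarrow> solution_map \<mu> x0 (abs_control f) w"
proof -
  let ?x = "solution_map \<mu> x0 (abs_control f) w"
  have "solves x0 (rep_control (abs_control f)) w ?x" by (rule solves_solution_map)
  then have "solves x0 f w ?x"
    unfolding solves_def
    using drift_cong_AE[OF borel_rep_control f _ _ rep_abs_control[OF f]] by auto
  then show ?thesis
    unfolding solves_iff_picard[OF f] by (intro picard_iterates_tendsto f) auto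
qed

section \<open>Measurability of the solution driven by a random control\<close>

lemma borel_measurable_drift:
  fixes a :: "real \<Rightarrow> 'a \<Rightarrow> 'l" and X :: "'a \<Rightarrow> 'd path"
  assumes a: "(\<lambda>(s, \<omega>). a s \<omega>) \<in> borel_measurable (restrict_space borel {0..1} \<Otimes>\<^sub>M M)"
    and X: "X \<in> borel_measurable M" "\<And>\<omega>. \<omega> \<in> space M \<Longrightarrow> X \<omega> \<in> C01"
    and t: "t \<in> {0..1}"
  shows "(\<lambda>\<omega>. drift (\<lambda>s. a s \<omega>) (X \<omega>) t) \<in> borel_measurable M"
proof -
  let ?N = "restrict_space (M \<Otimes>\<^sub>M lborel) (space M \<times> {0..t})"
  have 1: "fst \<in> measurable ?N M" by (rule measurable_restrict_space1) simp
  have 2: "snd \<in> measurable ?N borel" by (rule measurable_restrict_space1) simp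
  have sp: "space ?N = space M \<times> {0..t}" by (auto simp: space_restrict_space space_pair_measure)
  have 3: "snd \<in> measurable ?N (restrict_space borel {0..1})"
    by (rule measurable_restrict_space2[OF _ 2]) (use t in \<open>auto simp: sp\<close>)
  have "(\<lambda>p. \<mu> (snd p) (X (fst p)) (a (snd p) (fst p))) \<in> borel_measurable ?N"
  proof (rule borel_measurable_mu)
    show "snd \<in> borel_measurable ?N" by (rule 2)
    show "(\<lambda>p. X (fst p)) \<in> borel_measurable ?N" by (rule measurable_compose[OF 1 X(1)])
    show "(\<lambda>p. a (snd p) (fst p)) \<in> borel_measurable ?N"
      using measurable_compose[OF measurable_Pair[OF 3 1] a] by (simp add: case_prod_beta)
  qed (use t X(2) in \<open>auto simp: sp\<close>)
  then have "(\<lambda>p. indicator (space M \<times> {0..t}) p *\<^sub>R \<mu> (snd p) (X (fst p)) (a (snd p) (fst p)))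
      \<in> borel_measurable (M \<Otimes>\<^sub>M lborel)"
    by (subst (asm) borel_measurable_restrict_space_iff) auto
  then have "(\<lambda>(\<omega>, s). indicator {0..t} s *\<^sub>R \<mu> s (X \<omega>) (a s \<omega>)) \<in> borel_measurable (M \<Otimes>\<^sub>M lborel)"
    by (rule measurable_cong[THEN iffD1, rotated]) (auto simp: space_pair_measure indicator_def)
  then show ?thesis
    unfolding drift_def set_lebesgue_integral_def by (rule sigma_finite_measure.borel_measurable_lebesgue_integral[OF sigma_finite_lborel])
qed

text \<open>A solution given by a definite description offers no handle on measurability in
  \<open>\<omega>\<close>; the Picard iterates are measurable one by one, their drifts being
  parameter integrals, and converge to it pointwise.\<close>

lemma borel_measurable_solution_map:
  fixes a :: "real \<Rightarrow> 'a \<Rightarrow> 'l" and W :: "'a \<Rightarrow> 'd path"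
  assumes a: "(\<lambda>(s, \<omega>). a s \<omega>) \<in> borel_measurable (restrict_space borel {0..1} \<Otimes>\<^sub>M M)"
    and W: "W \<in> borel_measurable M"
  shows "(\<lambda>\<omega>. solution_map \<mu> x0 (abs_control (\<lambda>s. a s \<omega>)) (W \<omega>)) \<in> borel_measurable M"
proof (rule borel_measurable_LIMSEQ_metric)
  have f: "control_fun (\<lambda>s. a s \<omega>)" if "\<omega> \<in> space M" for \<omega>
    using measurable_Pair1[OF a that] by simp
  show "(\<lambda>n. (picard x0 (\<lambda>s. a s \<omega>) (W \<omega>) ^^ n) 0) \<longlonglongrightarrow>
      solution_map \<mu> x0 (abs_control (\<lambda>s. a s \<omega>)) (W \<omega>)" if "\<omega> \<in> space M" for \<omega>
    by (rule picard_iterates_tendsto_solution_map[OF f[OF that]])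
  have C: "(picard x0 (\<lambda>s. a s \<omega>) (W \<omega>) ^^ n) 0 \<in> C01" if "\<omega> \<in> space M" for n \<omega>
    by (induction n) (auto intro: picard_in_C01[OF f[OF that]] subspace_0[OF subspace_C01])
  show "(\<lambda>\<omega>. (picard x0 (\<lambda>s. a s \<omega>) (W \<omega>) ^^ n) 0) \<in> borel_measurable M" for n
  proof (induction n)
    case (Suc n)
    show ?case
    proof (rule borel_measurable_pathI[OF C])
      fix t :: real assume t: "t \<in> {0..1}"
      have "(\<lambda>\<omega>. apply_bcontfun ((picard x0 (\<lambda>s. a s \<omega>) (W \<omega>) ^^ Suc n) 0) t) \<in> borel_measurable M \<longleftrightarrow>
        (\<lambda>\<omega>. x0 + drift (\<lambda>s. a s \<omega>) ((picard x0 (\<lambda>s. a s \<omega>) (W \<omega>) ^^ n) 0) t + apply_bcontfun (W \<omega>) t) \<in> borel_measurable M"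
        by (rule measurable_cong) (simp only: funpow.simps o_apply, rule apply_picard[OF f C t])
      also have \<dots>
        by (intro borel_measurable_add borel_measurable_const borel_measurable_drift[OF a Suc C t]
            measurable_compose[OF W borel_measurable_eval])
      finally show "(\<lambda>\<omega>. apply_bcontfun ((picard x0 (\<lambda>s. a s \<omega>) (W \<omega>) ^^ Suc n) 0) t) \<in> borel_measurable M" .
    qed
  qed simp
qed

end

section \<open>Characteristic functions\<close>

text \<open>Normalises both measures; the hypothesis at \<open>s = 0\<close> says that the total
  masses agree. Masses other than one arise from the weights used for vector-valued
  uniqueness.\<close>

lemma Levy_uniqueness_finite_measure:
  fixes X :: "'a \<Rightarrow> real" and Y :: "'b \<Rightarrow> real"
  assumes fin: "finite_measure M" "finite_measure N"
    and X[measurable]: "X \<in> borel_measurable M" and Y[measurable]: "Y \<in> borel_measurable N"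
    and eq: "\<And>s. (CLINT \<omega>|M. iexp (s * X \<omega>)) = (CLINT \<omega>|N. iexp (s * Y \<omega>))"
    and B: "B \<in> sets borel"
  shows "measure M (X -` B \<inter> space M) = measure N (Y -` B \<inter> space N)"
proof -
  interpret M: finite_measure M by fact
  interpret N: finite_measure N by fact
  have m: "measure M (space M) = measure N (space N)" using eq[of 0] by simp
  define m where "m = measure M (space M)"
  show ?thesis
  proof (cases "m = 0")
    case True
    have "measure M (X -` B \<inter> space M) \<le> measure M (space M)" by (rule M.bounded_measure)
    moreover have "measure N (Y -` B \<inter> space N) \<le> measure N (space N)" by (rule N.bounded_measure)
    ultimately show ?thesis using True m m_def
      by (metis measure_nonneg order_antisym)
  next
    case False
    then have mpos: "m > 0" unfolding m_def using measure_nonneg[of M "space M"] by linarith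
    define M' where "M' = density M (\<lambda>_. ennreal (1 / m))"
    define N' where "N' = density N (\<lambda>_. ennreal (1 / m))"
    have "emeasure M' (space M') = 1"
      unfolding M'_def using mpos
      by (simp add: emeasure_density_const M.emeasure_eq_measure flip: m_def ennreal_mult)
    then have pM: "prob_space M'" by (rule prob_spaceI)
    have "emeasure N' (space N') = 1"
      unfolding N'_def using mpos
      by (simp add: emeasure_density_const N.emeasure_eq_measure flip: m m_def ennreal_mult)
    then have pN: "prob_space N'" by (rule prob_spaceI)
    have XM: "X \<in> borel_measurable M'" and YN: "Y \<in> borel_measurable N'" by (simp_all add: M'_def N'_def)
    have "char (distr M' borel X) s = (1 / m) *\<^sub>R (CLINT \<omega>|M. iexp (s * X \<omega>))" for s
    proof -
      have "char (distr M' borel X) s = (CLINT \<omega>|M'. iexp (s * X \<omega>))"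
        unfolding char_def by (rule integral_distr[OF XM]) simp
      also have "\<dots> = (CLINT \<omega>|M. (1 / m) *\<^sub>R iexp (s * X \<omega>))"
        unfolding M'_def by (rule integral_density) (use mpos in auto)
      finally show ?thesis by simp
    qed
    moreover have "char (distr N' borel Y) s = (1 / m) *\<^sub>R (CLINT \<omega>|N. iexp (s * Y \<omega>))" for s
    proof -
      have "char (distr N' borel Y) s = (CLINT \<omega>|N'. iexp (s * Y \<omega>))"
        unfolding char_def by (rule integral_distr[OF YN]) simp
      also have "\<dots> = (CLINT \<omega>|N. (1 / m) *\<^sub>R iexp (s * Y \<omega>))"
        unfolding N'_def by (rule integral_density) (use mpos in auto)
      finally show ?thesis by simp
    qed
    ultimately have "char (distr M' borel X) = char (distr N' borel Y)" using eq by auto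
    then have "distr M' borel X = distr N' borel Y"
      by (intro Levy_uniqueness prob_space.real_distribution_distr pM pN XM YN)
    then have "measure (distr M' borel X) B = measure (distr N' borel Y) B" by simp
    then have *: "measure M' (X -` B \<inter> space M) = measure N' (Y -` B \<inter> space N)"
      using B by (simp add: measure_distr[OF XM] measure_distr[OF YN]) (simp add: M'_def N'_def)
    have "measure M' A = measure M A / m" if "A \<in> sets M" for A
      unfolding measure_def M'_def using that mpos
      by (simp add: emeasure_density_const M.emeasure_eq_measure enn2real_mult)
    moreover have "measure N' A = measure N A / m" if "A \<in> sets N" for A
      unfolding measure_def N'_def using that mpos
      by (simp add: emeasure_density_const N.emeasure_eq_measure enn2real_mult)
    ultimately show ?thesis using * mpos B by simp
  qed
qed

text \<open>Absorbs a weight into the measure. A weight has to be nonnegative for this, which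
  dictates the form \<open>1 + cos\<close> of the weights to which it is applied.\<close>

lemma Levy_uniqueness_density:
  fixes X :: "'a \<Rightarrow> real" and Y :: "'b \<Rightarrow> real"
  assumes fin: "finite_measure M" "finite_measure N"
    and X[measurable]: "X \<in> borel_measurable M" and Y[measurable]: "Y \<in> borel_measurable N"
    and f[measurable]: "f \<in> borel_measurable M" and f2: "\<And>\<omega>. 0 \<le> f \<omega>" "integrable M f"
    and g[measurable]: "g \<in> borel_measurable N" and g2: "\<And>\<omega>. 0 \<le> g \<omega>" "integrable N g"
    and eq: "\<And>s. (CLINT \<omega>|M. complex_of_real (f \<omega>) * iexp (s * X \<omega>)) = (CLINT \<omega>|N. complex_of_real (g \<omega>) * iexp (s * Y \<omega>))"
    and B[measurable]: "B \<in> sets borel"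
  shows "(LINT \<omega>|M. f \<omega> * indicator B (X \<omega>)) = (LINT \<omega>|N. g \<omega> * indicator B (Y \<omega>))"
proof -
  let ?M = "density M (\<lambda>x. ennreal (f x))" and ?N = "density N (\<lambda>x. ennreal (g x))"
  have *: "finite_measure (density K (\<lambda>x. ennreal (h x)))"
    if "integrable K h" "\<And>x. 0 \<le> h x" for K :: "'c measure" and h :: "'c \<Rightarrow> real"
    by (rule finite_measureI)
       (use that in \<open>auto simp: emeasure_density nn_integral_eq_integral cong: nn_integral_cong_simp\<close>)
  have meas: "measure (density K (\<lambda>x. ennreal (h x))) (Z -` B \<inter> space K) = (LINT \<omega>|K. h \<omega> * indicator B (Z \<omega>))"
    if hI: "integrable K h" and h0: "\<And>x. 0 \<le> h x" and Z: "Z \<in> borel_measurable K"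
    for K :: "'c measure" and h Z :: "'c \<Rightarrow> real"
  proof -
    have [measurable]: "h \<in> borel_measurable K" using hI by auto
    have A: "Z -` B \<inter> space K \<in> sets K" using Z by measurable
    have "measure (density K (\<lambda>x. ennreal (h x))) (Z -` B \<inter> space K) =
        (LINT \<omega>|density K (\<lambda>x. ennreal (h x)). indicator (Z -` B \<inter> space K) \<omega>)"
      using A by simp
    also have "\<dots> = (LINT \<omega>|K. h \<omega> *\<^sub>R indicator (Z -` B \<inter> space K) \<omega>)"
      by (rule integral_density) (use h0 A in auto)
    also have "\<dots> = (LINT \<omega>|K. h \<omega> * indicator B (Z \<omega>))"
      by (rule Bochner_Integration.integral_cong) (auto simp: indicator_def)
    finally show ?thesis .
  qed
  have "measure ?M (X -` B \<inter> space ?M) = measure ?N (Y -` B \<inter> space ?N)"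
  proof (rule Levy_uniqueness_finite_measure)
    show "(CLINT \<omega>|?M. iexp (s * X \<omega>)) = (CLINT \<omega>|?N. iexp (s * Y \<omega>))" for s
      using eq[of s] f2 g2 by (subst (1 2) integral_density) (auto simp: scaleR_conv_of_real)
  qed (use f2 g2 in \<open>auto intro: *\<close>)
  then show ?thesis
    using meas[OF f2(2,1) X] meas[OF g2(2,1) Y] by simp
qed

lemma integrable_iexp_bounded:
  assumes "finite_measure M" "(\<theta> :: 'a \<Rightarrow> real) \<in> borel_measurable M"
  shows "integrable M (\<lambda>\<omega>. iexp (\<theta> \<omega>))"
  by (rule finite_measure.integrable_const_bound[OF assms(1), of _ 1]) (use assms(2) in auto)

text \<open>Coordinates are peeled off one at a time: the law of coordinate \<open>j\<close> is
  identified while the remaining coordinates sit in a phase. The factor \<open>iexp\<close> of that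
  phase is complex and no density, so the weights \<open>1 + cos (\<theta> + c)\<close> replace it;
  varying \<open>c\<close> recovers its real and imaginary parts afterwards.\<close>

lemma char_uniqueness_finite:
  fixes X :: "'i \<Rightarrow> 'a \<Rightarrow> real" and Y :: "'i \<Rightarrow> 'b \<Rightarrow> real"
  assumes "finite I"
    and "finite_measure M" "finite_measure N"
    and "\<And>i. i \<in> I \<Longrightarrow> X i \<in> borel_measurable M" "\<And>i. i \<in> I \<Longrightarrow> Y i \<in> borel_measurable N"
    and "\<And>\<xi>. (CLINT \<omega>|M. iexp (\<Sum>i\<in>I. \<xi> i * X i \<omega>)) = (CLINT \<omega>|N. iexp (\<Sum>i\<in>I. \<xi> i * Y i \<omega>))"
    and "\<And>i. i \<in> I \<Longrightarrow> B i \<in> sets borel"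
  shows "measure M {\<omega>\<in>space M. \<forall>i\<in>I. X i \<omega> \<in> B i} = measure N {\<omega>\<in>space N. \<forall>i\<in>I. Y i \<omega> \<in> B i}"
  using assms
proof (induction I arbitrary: M N rule: finite_induct)
  case empty
  then show ?case by simp
next
  case (insert j I)
  interpret M: finite_measure M by fact
  interpret N: finite_measure N by fact
  have X: "X i \<in> borel_measurable M" if "i \<in> insert j I" for i using insert.prems(3) that by blast
  have Y: "Y i \<in> borel_measurable N" if "i \<in> insert j I" for i using insert.prems(4) that by blast
  have Bj[measurable]: "B j \<in> sets borel" and BI: "\<And>i. i \<in> I \<Longrightarrow> B i \<in> sets borel" using insert.prems(6) by auto
  have Xj[measurable]: "X j \<in> borel_measurable M" and Yj[measurable]: "Y j \<in> borel_measurable N"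
    using X Y by auto
  define \<theta> where "\<theta> \<xi> \<omega> = (\<Sum>i\<in>I. \<xi> i * X i \<omega>)" for \<xi> \<omega>
  define \<theta>' where "\<theta>' \<xi> \<omega> = (\<Sum>i\<in>I. \<xi> i * Y i \<omega>)" for \<xi> \<omega>
  have th[measurable]: "\<theta> \<xi> \<in> borel_measurable M" for \<xi>
    unfolding \<theta>_def[abs_def] by (intro borel_measurable_sum borel_measurable_times borel_measurable_const X) auto
  have th'[measurable]: "\<theta>' \<xi> \<in> borel_measurable N" for \<xi>
    unfolding \<theta>'_def[abs_def] by (intro borel_measurable_sum borel_measurable_times borel_measurable_const Y) auto
  have hyp: "(CLINT \<omega>|M. iexp (s * X j \<omega> + \<theta> \<xi> \<omega>)) = (CLINT \<omega>|N. iexp (s * Y j \<omega> + \<theta>' \<xi> \<omega>))" for s \<xi>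
  proof -
    have "(\<Sum>i\<in>insert j I. (\<xi>(j := s)) i * X i \<omega>) = s * X j \<omega> + \<theta> \<xi> \<omega>" for \<omega>
      using insert.hyps unfolding \<theta>_def by (simp add: sum.insert) (rule sum.cong, auto)
    moreover have "(\<Sum>i\<in>insert j I. (\<xi>(j := s)) i * Y i \<omega>) = s * Y j \<omega> + \<theta>' \<xi> \<omega>" for \<omega>
      using insert.hyps unfolding \<theta>'_def by (simp add: sum.insert) (rule sum.cong, auto)
    ultimately show ?thesis using insert.prems(5)[of "\<xi>(j := s)"] by simp
  qed
  have neg: "\<theta> (\<lambda>i. - \<xi> i) \<omega> = - \<theta> \<xi> \<omega>" "\<theta>' (\<lambda>i. - \<xi> i) \<omega>' = - \<theta>' \<xi> \<omega>'"
    "\<theta> (\<lambda>i. 0) \<omega> = 0" "\<theta>' (\<lambda>i. 0) \<omega>' = 0" for \<xi> \<omega> \<omega>'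
    by (simp_all add: \<theta>_def \<theta>'_def sum_negf)
  \<comment> \<open>Turns the weighted character into plain ones with phases \<open>r\<close>,
    \<open>r + t\<close> and \<open>r - t\<close>, all of which the hypothesis on joint
    characteristic functions covers.\<close>
  have exp_id: "complex_of_real (1 + cos (t + c)) * iexp r =
      iexp r + (iexp c / 2) * iexp (r + t) + (iexp (- c) / 2) * iexp (r - t)" for t c r :: real
  proof -
    have c1: "complex_of_real (cos x) = (iexp x + iexp (- x)) / 2" for x :: real
      by (simp add: cos_of_real[symmetric] cos_exp_eq)
    have c2: "iexp (t + c) * iexp r = iexp c * iexp (r + t)" "iexp (- (t + c)) * iexp r = iexp (- c) * iexp (r - t)"
      by (simp_all add: algebra_simps flip: exp_add)
    have "complex_of_real (1 + cos (t + c)) * iexp r = iexp r + (iexp (t + c) * iexp r) / 2 + (iexp (- (t + c)) * iexp r) / 2"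
      unfolding of_real_add c1 by (simp only: of_real_1 distrib_right mult_1_left add_divide_distrib times_divide_eq_left add.assoc)
    then show ?thesis unfolding c2 by (simp only: times_divide_eq_left)
  qed
  have w: "(LINT \<omega>|M. (1 + cos (\<theta> \<xi> \<omega> + c)) * indicator (B j) (X j \<omega>)) =
      (LINT \<omega>|N. (1 + cos (\<theta>' \<xi> \<omega> + c)) * indicator (B j) (Y j \<omega>))" for \<xi> c
  proof (rule Levy_uniqueness_density)
    have ic: "(CLINT \<omega>|K. complex_of_real (1 + cos (T \<omega> + c)) * iexp (s * Z \<omega>)) =
      (CLINT \<omega>|K. iexp (s * Z \<omega>)) + (iexp c / 2) * (CLINT \<omega>|K. iexp (s * Z \<omega> + T \<omega>)) +
      (iexp (- c) / 2) * (CLINT \<omega>|K. iexp (s * Z \<omega> - T \<omega>))"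
      if K: "finite_measure K" and [measurable]: "Z \<in> borel_measurable K" "T \<in> borel_measurable K"
      for K :: "'c measure" and Z T :: "'c \<Rightarrow> real" and s
    proof -
      have i1: "integrable K (\<lambda>\<omega>. iexp (s * Z \<omega>))" by (intro integrable_iexp_bounded K) measurable
      have i2: "integrable K (\<lambda>\<omega>. iexp (s * Z \<omega> + T \<omega>))" by (intro integrable_iexp_bounded K) measurable
      have i3: "integrable K (\<lambda>\<omega>. iexp (s * Z \<omega> - T \<omega>))" by (intro integrable_iexp_bounded K) measurable
      show ?thesis
        unfolding exp_id
        by (subst Bochner_Integration.integral_add integral_mult_right;
            (intro Bochner_Integration.integrable_add integrable_mult_right i1 i2 i3)?)+ simp
    qed
    show "(CLINT \<omega>|M. complex_of_real (1 + cos (\<theta> \<xi> \<omega> + c)) * iexp (s * X j \<omega>)) =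
        (CLINT \<omega>|N. complex_of_real (1 + cos (\<theta>' \<xi> \<omega> + c)) * iexp (s * Y j \<omega>))" for s
      unfolding ic[OF insert.prems(1) Xj th] ic[OF insert.prems(2) Yj th']
      using hyp[of s \<xi>] hyp[of s "\<lambda>i. - \<xi> i"] hyp[of s "\<lambda>i. 0"] by (simp add: neg)
    show "0 \<le> 1 + cos (\<theta> \<xi> \<omega> + c)" "0 \<le> 1 + cos (\<theta>' \<xi> \<omega>' + c)" for \<omega> \<omega>'
      using cos_ge_minus_one[of "\<theta> \<xi> \<omega> + c"] cos_ge_minus_one[of "\<theta>' \<xi> \<omega>' + c"] by linarith+
    have "\<bar>1 + cos x\<bar> \<le> 2" for x :: real using cos_ge_minus_one[of x] cos_le_one[of x] by linarith
    then show "integrable M (\<lambda>\<omega>. 1 + cos (\<theta> \<xi> \<omega> + c))" "integrable N (\<lambda>\<omega>. 1 + cos (\<theta>' \<xi> \<omega> + c))"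
      by (auto intro!: M.integrable_const_bound[of _ 2] N.integrable_const_bound[of _ 2])
  qed (use insert.prems in auto)
  have iM: "integrable M (\<lambda>\<omega>. indicator (B j) (X j \<omega>) * cos (\<theta> \<xi> \<omega> + c))" for \<xi> c
    by (rule M.integrable_const_bound[of _ 1]) (auto simp: indicator_def)
  have iN: "integrable N (\<lambda>\<omega>. indicator (B j) (Y j \<omega>) * cos (\<theta>' \<xi> \<omega> + c))" for \<xi> c
    by (rule N.integrable_const_bound[of _ 1]) (auto simp: indicator_def)
  have i1: "integrable M (\<lambda>\<omega>. indicator (B j) (X j \<omega>) :: real)" "integrable N (\<lambda>\<omega>. indicator (B j) (Y j \<omega>) :: real)"
    by (rule M.integrable_const_bound[of _ 1], auto simp: indicator_def)
       (rule N.integrable_const_bound[of _ 1], auto simp: indicator_def)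
  have w1: "(LINT \<omega>|M. indicator (B j) (X j \<omega>)) + (LINT \<omega>|M. indicator (B j) (X j \<omega>) * cos (\<theta> \<xi> \<omega> + c)) =
      (LINT \<omega>|N. indicator (B j) (Y j \<omega>)) + (LINT \<omega>|N. indicator (B j) (Y j \<omega>) * cos (\<theta>' \<xi> \<omega> + c))" for \<xi> c
    using w[of \<xi> c] iM[of \<xi> c] iN[of \<xi> c] i1 by (simp add: algebra_simps)
  \<comment> \<open>Replacing \<open>c\<close> by \<open>c + pi\<close> flips the sign of the
    cosine; subtracting the two instances of \<open>w1\<close> eliminates the constant part of the
    weight.\<close>
  have w2: "(LINT \<omega>|M. indicator (B j) (X j \<omega>) * cos (\<theta> \<xi> \<omega> + c)) =
      (LINT \<omega>|N. indicator (B j) (Y j \<omega>) * cos (\<theta>' \<xi> \<omega> + c))" for \<xi> c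
  proof -
    have "cos (x + (c + pi)) = - cos (x + c)" for x using cos_periodic_pi[of "x + c"] by (simp add: add.assoc)
    then show ?thesis using w1[of \<xi> c] w1[of \<xi> "c + pi"] by simp
  qed
  let ?M = "density M (\<lambda>\<omega>. ennreal (indicator (B j) (X j \<omega>)))"
  let ?N = "density N (\<lambda>\<omega>. ennreal (indicator (B j) (Y j \<omega>)))"
  have cis: "iexp x = complex_of_real (cos x) + \<i> * complex_of_real (sin x)" for x :: real
    by (simp add: exp_Euler cos_of_real sin_of_real)
  have sc: "cos (x + - pi / 2) = sin x" for x :: real by (simp add: cos_sin_eq cos_add)
  have ptw: "complex_of_real r * iexp x = complex_of_real (r * cos (x + 0)) + \<i> * complex_of_real (r * cos (x + - pi / 2))"
    for r x :: real by (simp only: cis sc add_0_right of_real_mult) (simp add: algebra_simps)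
  have dec: "(CLINT \<omega>|K. complex_of_real (f \<omega>) + \<i> * complex_of_real (g \<omega>)) =
      complex_of_real (LINT \<omega>|K. f \<omega>) + \<i> * complex_of_real (LINT \<omega>|K. g \<omega>)"
    if "integrable K f" "integrable K g" for K :: "'c measure" and f g
    using that by simp
  \<comment> \<open>The remaining coordinates are treated under the measures restricted by the event
    for coordinate \<open>j\<close>. Their characteristic functions agree by \<open>w2\<close> at
    \<open>c = 0\<close> for the real part and at \<open>c = - pi / 2\<close> for the imaginary
    part.\<close>
  have IH: "measure ?M {\<omega>\<in>space ?M. \<forall>i\<in>I. X i \<omega> \<in> B i} = measure ?N {\<omega>\<in>space ?N. \<forall>i\<in>I. Y i \<omega> \<in> B i}"
  proof (rule insert.IH)
    show "finite_measure ?M"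
      by (rule finite_measureI) (use i1 in \<open>auto simp: emeasure_density nn_integral_eq_integral cong: nn_integral_cong_simp\<close>)
    show "finite_measure ?N"
      by (rule finite_measureI) (use i1 in \<open>auto simp: emeasure_density nn_integral_eq_integral cong: nn_integral_cong_simp\<close>)
    show "X i \<in> borel_measurable ?M" "Y i \<in> borel_measurable ?N" if "i \<in> I" for i using X Y that by auto
    fix \<xi> :: "'i \<Rightarrow> real"
    have decM: "(CLINT \<omega>|M. complex_of_real (indicator (B j) (X j \<omega>)) * iexp (\<theta> \<xi> \<omega>)) =
      complex_of_real (LINT \<omega>|M. indicator (B j) (X j \<omega>) * cos (\<theta> \<xi> \<omega> + 0)) +
      \<i> * complex_of_real (LINT \<omega>|M. indicator (B j) (X j \<omega>) * cos (\<theta> \<xi> \<omega> + - pi / 2))"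
      unfolding ptw by (rule dec[OF iM iM])
    have decN: "(CLINT \<omega>|N. complex_of_real (indicator (B j) (Y j \<omega>)) * iexp (\<theta>' \<xi> \<omega>)) =
      complex_of_real (LINT \<omega>|N. indicator (B j) (Y j \<omega>) * cos (\<theta>' \<xi> \<omega> + 0)) +
      \<i> * complex_of_real (LINT \<omega>|N. indicator (B j) (Y j \<omega>) * cos (\<theta>' \<xi> \<omega> + - pi / 2))"
      unfolding ptw by (rule dec[OF iN iN])
    have "(CLINT \<omega>|M. complex_of_real (indicator (B j) (X j \<omega>)) * iexp (\<theta> \<xi> \<omega>)) =
        (CLINT \<omega>|N. complex_of_real (indicator (B j) (Y j \<omega>)) * iexp (\<theta>' \<xi> \<omega>))"
      unfolding decM decN w2 ..
    then show "(CLINT \<omega>|?M. iexp (\<Sum>i\<in>I. \<xi> i * X i \<omega>)) = (CLINT \<omega>|?N. iexp (\<Sum>i\<in>I. \<xi> i * Y i \<omega>))"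
      unfolding \<theta>_def[symmetric] \<theta>'_def[symmetric]
      by (subst (1 2) integral_density) (auto simp: scaleR_conv_of_real)
  qed (use BI in auto)
  have "measure (density K (\<lambda>\<omega>. ennreal (indicator (B j) (Z j \<omega>)))) {\<omega>\<in>space (density K (\<lambda>\<omega>. ennreal (indicator (B j) (Z j \<omega>)))). \<forall>i\<in>I. Z i \<omega> \<in> B i} =
      measure K {\<omega>\<in>space K. \<forall>i\<in>insert j I. Z i \<omega> \<in> B i}"
    if Z: "\<And>i. i \<in> insert j I \<Longrightarrow> Z i \<in> borel_measurable K" for K :: "'c measure" and Z :: "'i \<Rightarrow> 'c \<Rightarrow> real"
  proof -
    have [measurable]: "Z j \<in> borel_measurable K" using Z by simp
    have "{\<omega>\<in>space K. \<forall>i\<in>I. Z i \<omega> \<in> B i} \<in> sets K"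
      by (rule sets.sets_Collect_finite_All[OF _ insert.hyps(1)])
         (use Z BI measurable_sets in \<open>auto simp: vimage_def Int_def conj_commute\<close>)
    then have "emeasure (density K (\<lambda>\<omega>. ennreal (indicator (B j) (Z j \<omega>)))) {\<omega>\<in>space K. \<forall>i\<in>I. Z i \<omega> \<in> B i} =
        (\<integral>\<^sup>+\<omega>. ennreal (indicator (B j) (Z j \<omega>)) * indicator {\<omega>\<in>space K. \<forall>i\<in>I. Z i \<omega> \<in> B i} \<omega> \<partial>K)"
      by (intro emeasure_density) auto
    also have "\<dots> = (\<integral>\<^sup>+\<omega>. indicator {\<omega>\<in>space K. \<forall>i\<in>insert j I. Z i \<omega> \<in> B i} \<omega> \<partial>K)"
      by (rule nn_integral_cong) (auto simp: indicator_def)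
    also have "\<dots> = emeasure K {\<omega>\<in>space K. \<forall>i\<in>insert j I. Z i \<omega> \<in> B i}"
      by (rule nn_integral_indicator, rule sets.sets_Collect_finite_All)
         (use Z BI Bj insert.hyps(1) measurable_sets in \<open>auto simp: vimage_def Int_def conj_commute\<close>)
    finally show ?thesis by (simp add: measure_def)
  qed
  note red = this
  show ?case using IH by (simp only: red[of X M, OF X] red[of Y N, OF Y])
qed

text \<open>Completing the square: the real part of the exponent translates the Gaussian by
  \<open>a\<close>, leaving a characteristic function at \<open>b\<close>.\<close>

lemma std_normal_exp:
  "integrable std_normal_distribution (\<lambda>z. exp ((complex_of_real a + \<i> * b) * z))" (is ?A)
  "(CLINT z|std_normal_distribution. exp ((complex_of_real a + \<i> * complex_of_real b) * z)) =
    exp ((complex_of_real a + \<i> * b)\<^sup>2 / 2)" (is ?B)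
proof -
  define G where "G z = std_normal_density (z - a) *\<^sub>R iexp (b * z)" for z
  interpret real_distribution std_normal_distribution by (rule real_dist_normal_dist)
  have e1: "std_normal_density z *\<^sub>R exp ((complex_of_real a + \<i> * b) * z) = exp (complex_of_real (a\<^sup>2 / 2)) * G z" for z
  proof -
    have "std_normal_density z * exp (a * z) = exp (a\<^sup>2 / 2) * std_normal_density (z - a)"
      by (simp add: normal_density_def exp_add[symmetric] power2_eq_square field_simps)
    moreover have "exp ((complex_of_real a + \<i> * b) * z) = of_real (exp (a * z)) * iexp (b * z)"
      by (simp add: exp_of_real[symmetric] algebra_simps flip: exp_add)
    ultimately show ?thesis
      unfolding G_def scaleR_conv_of_real
      by (simp only: mult.assoc[symmetric] of_real_mult[symmetric] exp_of_real[symmetric])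
         (simp only: exp_of_real of_real_mult[symmetric])
  qed
  have e2: "G (a + 1 * y) = iexp (b * a) * (std_normal_density y *\<^sub>R iexp (b * y))" for y
    unfolding G_def by (simp add: algebra_simps exp_add scaleR_conv_of_real)
  have i0: "integrable std_normal_distribution (\<lambda>y. iexp (b * y))"
    by (rule integrable_iexp) auto
  then have i1: "integrable lborel (\<lambda>y. std_normal_density y *\<^sub>R iexp (b * y))"
    by (subst (asm) integrable_density) auto
  have iG: "integrable lborel G"
  proof (rule lborel_integrable_real_affine_iff[of 1 _ a, THEN iffD1])
    show "integrable lborel (\<lambda>y. G (a + 1 * y))" unfolding e2 by (intro integrable_mult_right i1)
  qed simp
  have "integral\<^sup>L lborel G = \<bar>1\<bar> *\<^sub>R (\<integral>y. G (a + 1 * y) \<partial>lborel)"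
    by (rule lborel_integral_real_affine) simp
  also have "\<dots> = iexp (b * a) * (\<integral>y. std_normal_density y *\<^sub>R iexp (b * y) \<partial>lborel)"
    by (simp only: e2 abs_one scaleR_one integral_mult_right_zero)
  also have "(\<integral>y. std_normal_density y *\<^sub>R iexp (b * y) \<partial>lborel) = char std_normal_distribution b"
    unfolding char_def by (subst integral_density) auto
  finally have G: "integral\<^sup>L lborel G = iexp (b * a) * exp (complex_of_real (- (b\<^sup>2) / 2))"
    by (simp only: char_std_normal_distribution exp_of_real)
  show ?A
    by (subst integrable_density) (use iG in \<open>auto simp: e1\<close>)
  have "(CLINT z|std_normal_distribution. exp ((complex_of_real a + \<i> * b) * z)) =
      (\<integral>z. exp (complex_of_real (a\<^sup>2 / 2)) * G z \<partial>lborel)"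
    by (subst integral_density) (auto simp: e1)
  also have "\<dots> = exp (complex_of_real (a\<^sup>2 / 2)) * integral\<^sup>L lborel G" using iG by simp
  also have "\<dots> = exp (complex_of_real (a\<^sup>2 / 2) + \<i> * (b * a) + complex_of_real (- (b\<^sup>2) / 2))"
    unfolding G by (simp only: exp_add mult.assoc of_real_mult)
  also have "complex_of_real (a\<^sup>2 / 2) + \<i> * (b * a) + complex_of_real (- (b\<^sup>2) / 2) = (complex_of_real a + \<i> * b)\<^sup>2 / 2"
    by (simp add: power2_eq_square field_simps)
  finally show ?B .
qed

section \<open>The Cameron--Martin embedding\<close>

definition orthonormal :: "'a::real_inner set \<Rightarrow> bool" where
  "orthonormal C \<longleftrightarrow> (\<forall>c\<in>C. \<forall>d\<in>C. inner c d = (if c = d then 1 else 0))"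

lemma orthonormal_span:
  fixes B :: "'a::real_inner set"
  assumes "finite B"
  obtains C where "finite C" "span C = span B" "orthonormal C"
proof -
  obtain C where C: "finite C" "span C = span B" "pairwise orthogonal C"
    using basis_orthogonal[OF assms] by blast
  define D where "D = (\<lambda>c. c /\<^sub>R norm c) ` (C - {0})"
  show thesis
  proof (rule that)
    show "finite D" using C by (simp add: D_def)
    have "D \<subseteq> span C" unfolding D_def by (auto intro: span_scale span_base)
    moreover have "C \<subseteq> span D"
    proof
      fix c assume c: "c \<in> C"
      show "c \<in> span D"
      proof (cases "c = 0")
        case True then show ?thesis by (simp add: span_zero)
      next
        case False
        then have "norm c *\<^sub>R (c /\<^sub>R norm c) \<in> span D"
          using c by (intro span_scale span_base) (auto simp: D_def)
        then show ?thesis using False by simp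
      qed
    qed
    ultimately have "span D = span C" by (simp add: span_eq)
    then show "span D = span B" using C by simp
    show "orthonormal D"
      unfolding orthonormal_def
    proof (intro ballI)
      fix c d assume "c \<in> D" "d \<in> D"
      then obtain c' d' where cd: "c = c' /\<^sub>R norm c'" "d = d' /\<^sub>R norm d'" "c' \<in> C" "d' \<in> C" "c' \<noteq> 0" "d' \<noteq> 0"
        unfolding D_def by blast
      show "inner c d = (if c = d then 1 else 0)"
      proof (cases "c' = d'")
        case True
        then show ?thesis using cd by (simp add: dot_square_norm power2_eq_square)
      next
        case False
        then have "inner c' d' = 0" using C(3) cd unfolding pairwise_def orthogonal_def by blast
        then have "inner c d = 0" by (simp add: cd)
        moreover have "inner d d = 1" using cd by (simp add: dot_square_norm power2_eq_square)
        ultimately show ?thesis by auto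
      qed
    qed
  qed
qed

lemma orthonormal_expand:
  fixes C :: "'a::real_inner set"
  assumes C: "finite C" "orthonormal C" and x: "x \<in> span C"
  shows "x = (\<Sum>c\<in>C. inner x c *\<^sub>R c)"
proof -
  obtain u where u: "x = (\<Sum>c\<in>C. u c *\<^sub>R c)" using x span_finite[OF C(1)] by auto
  have "inner x d = u d" if "d \<in> C" for d
  proof -
    have "inner x d = (\<Sum>c\<in>C. u c * (if c = d then 1 else 0))"
      unfolding u inner_sum_left using C(2) that by (intro sum.cong) (auto simp: orthonormal_def)
    also have "\<dots> = u d" using that C(1) by (simp add: if_distrib cong: if_cong)
    finally show ?thesis .
  qed
  then show ?thesis by (subst u) (auto intro!: sum.cong)
qed

lemma orthonormal_inner_sum:
  fixes C :: "'a::real_inner set"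
  assumes C: "finite C" "orthonormal C"
  shows "inner (\<Sum>c\<in>C. a c *\<^sub>R c) (\<Sum>c\<in>C. b c *\<^sub>R c) = (\<Sum>c\<in>C. a c * b c)"
proof -
  have "inner (\<Sum>c\<in>C. a c *\<^sub>R c) (\<Sum>c\<in>C. b c *\<^sub>R c) = (\<Sum>c\<in>C. \<Sum>d\<in>C. a c * (b d * (if c = d then 1 else 0)))"
    unfolding inner_sum_left inner_sum_right using C(2) by (auto simp: orthonormal_def intro!: sum.cong)
  also have "\<dots> = (\<Sum>c\<in>C. a c * b c)"
    using C(1) by (intro sum.cong) (simp_all add: if_distrib cong: if_cong)
  finally show ?thesis .
qed

text \<open>Makes measures on the path space comparable through finitely many coordinates. For the
  nontrivial inclusion, evaluations are measurable for the cylinder field, hence so is the identity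
  as a path-valued map into the Borel field.\<close>

lemma borel_C01_0_generator:
  fixes E :: "'d::finite path set set"
  defines "E \<equiv> {{\<omega>\<in>C01_0. \<forall>p\<in>I. apply_bcontfun \<omega> (fst p) $ snd p \<in> B p} | I B. finite I \<and> (\<forall>p. B p \<in> sets borel)}"
  shows "Int_stable E" "E \<subseteq> Pow C01_0" "sets (restrict_space borel C01_0) = sigma_sets C01_0 E" "C01_0 \<in> E"
proof -
  show EP: "E \<subseteq> Pow C01_0" unfolding E_def by auto
  have EI: "{\<omega>\<in>C01_0. \<forall>p\<in>I. apply_bcontfun \<omega> (fst p) $ snd p \<in> B p} \<in> E"
    if "finite I" "\<forall>p. B p \<in> sets borel" for I B
    unfolding E_def using that by blast
  show "C01_0 \<in> E" using EI[of "{}" "\<lambda>_. UNIV"] by simp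
  show "Int_stable E"
  proof (rule Int_stableI)
    fix A A' assume "A \<in> E" "A' \<in> E"
    then obtain I B I' B' where A: "A = {\<omega>\<in>C01_0. \<forall>p\<in>I. apply_bcontfun \<omega> (fst p) $ snd p \<in> B p}" "finite I" "\<forall>p. B p \<in> sets borel"
      and A': "A' = {\<omega>\<in>C01_0. \<forall>p\<in>I'. apply_bcontfun \<omega> (fst p) $ snd p \<in> B' p}" "finite I'" "\<forall>p. B' p \<in> sets borel"
      unfolding E_def by blast
    define B'' where "B'' p = (if p \<in> I then B p else UNIV) \<inter> (if p \<in> I' then B' p else UNIV)" for p
    have "A \<inter> A' = {\<omega>\<in>C01_0. \<forall>p\<in>I \<union> I'. apply_bcontfun \<omega> (fst p) $ snd p \<in> B'' p}"
      unfolding A A' B''_def by auto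
    moreover have "\<forall>p. B'' p \<in> sets borel" unfolding B''_def using A A' by auto
    ultimately show "A \<inter> A' \<in> E" using EI[of "I \<union> I'" B''] A(2) A'(2) by simp
  qed
  have sp: "space (restrict_space borel C01_0) = (C01_0 :: 'd path set)" by (simp add: space_restrict_space)
  have coord: "(\<lambda>\<omega>. apply_bcontfun \<omega> t $ i) \<in> borel_measurable (restrict_space borel C01_0)" for t and i :: 'd
    by (intro borel_measurable_continuous_on_restrict continuous_on_component continuous_on_eval)
  have "E \<subseteq> sets (restrict_space borel C01_0)"
  proof
    fix A assume "A \<in> E"
    then obtain I B where A: "A = {\<omega>\<in>C01_0. \<forall>p\<in>I. apply_bcontfun \<omega> (fst p) $ snd p \<in> B p}" "finite I" "\<forall>p. B p \<in> sets borel"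
      unfolding E_def by blast
    have "{\<omega>\<in>space (restrict_space borel C01_0). \<forall>p\<in>I. apply_bcontfun \<omega> (fst p) $ snd p \<in> B p} \<in> sets (restrict_space borel C01_0)"
    proof (rule sets.sets_Collect_finite_All[OF _ A(2)])
      fix p assume "p \<in> I"
      have "(\<lambda>\<omega>. apply_bcontfun \<omega> (fst p) $ snd p) -` B p \<inter> space (restrict_space borel C01_0) \<in> sets (restrict_space borel C01_0)"
        by (rule measurable_sets[OF coord]) (rule A(3)[rule_format])
      then show "{\<omega>\<in>space (restrict_space borel C01_0). apply_bcontfun \<omega> (fst p) $ snd p \<in> B p} \<in> sets (restrict_space borel C01_0)"
        by (simp add: vimage_def Int_def conj_commute)
    qed
    then show "A \<in> sets (restrict_space borel C01_0)" unfolding A sp .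
  qed
  then have "sigma_sets C01_0 E \<subseteq> sets (restrict_space borel C01_0)"
    using sets.sigma_sets_subset[of E "restrict_space borel C01_0"] sp by simp
  moreover have "sets (restrict_space borel C01_0) \<subseteq> sigma_sets C01_0 E"
  proof
    fix A assume "A \<in> sets (restrict_space borel (C01_0 :: 'd path set))"
    then obtain U where U: "U \<in> sets borel" "A = C01_0 \<inter> U" by (auto simp: sets_restrict_space)
    have "(\<lambda>\<omega>. \<omega>) \<in> borel_measurable (sigma C01_0 E)"
    proof (rule borel_measurable_pathI)
      fix \<omega> assume "\<omega> \<in> space (sigma C01_0 E)"
      then show "\<omega> \<in> C01" using EP C01_0_subset by (auto simp: space_measure_of)
    next
      fix t :: real
      have "(\<lambda>\<omega>. apply_bcontfun \<omega> t $ i) \<in> borel_measurable (sigma C01_0 E)" for i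
      proof (rule measurableI)
        fix B :: "real set" assume B: "B \<in> sets borel"
        have "(\<lambda>\<omega>. apply_bcontfun \<omega> t $ i) -` B \<inter> C01_0 = {\<omega>\<in>C01_0. \<forall>p\<in>{(t, i)}. apply_bcontfun \<omega> (fst p) $ snd p \<in> B}"
          by auto
        then have "(\<lambda>\<omega>. apply_bcontfun \<omega> t $ i) -` B \<inter> C01_0 \<in> E"
          using EI[of "{(t, i)}" "\<lambda>_. B"] B by simp
        then show "(\<lambda>\<omega>. apply_bcontfun \<omega> t $ i) -` B \<inter> space (sigma C01_0 E) \<in> sets (sigma C01_0 E)"
          using EP by (simp add: space_measure_of sets_measure_of)
      qed simp
      then show "(\<lambda>\<omega>. apply_bcontfun \<omega> t) \<in> borel_measurable (sigma C01_0 E)"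
        by (subst borel_measurable_euclidean_space) (auto simp: Basis_vec_def inner_axis)
    qed
    then have "(\<lambda>\<omega>. \<omega>) -` U \<inter> space (sigma C01_0 E) \<in> sets (sigma C01_0 E)" using U(1) by (rule measurable_sets)
    then show "A \<in> sigma_sets C01_0 E" using EP U by (simp add: space_measure_of sets_measure_of Int_commute)
  qed
  ultimately show "sets (restrict_space borel C01_0) = sigma_sets C01_0 E" by blast
qed

section \<open>Riesz representatives of the dual and compactness of the embedded balls\<close>

context abstract_wiener_space
begin

sublocale \<iota>: bounded_linear \<iota> by (rule bounded_linear_embedding)

lemma space_P: "space P = C01_0"
  using sets_eq_imp_space_eq[OF sets_P] by (simp add: space_restrict_space)

lemma iota_in_C01_0: "\<iota> k \<in> C01_0"
  using dense_embedding(1) by blast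

lemma borel_measurable_dual: "\<gamma> \<in> dual_C01_0 \<Longrightarrow> \<gamma> \<in> borel_measurable P"
  by (subst measurable_cong_sets[OF sets_P refl])
     (auto simp: dual_C01_0_def intro: borel_measurable_continuous_on_restrict)

lemma dual_add: "\<gamma> \<in> dual_C01_0 \<Longrightarrow> x \<in> C01_0 \<Longrightarrow> y \<in> C01_0 \<Longrightarrow> \<gamma> (x + y) = \<gamma> x + \<gamma> y"
  and dual_scaleR: "\<gamma> \<in> dual_C01_0 \<Longrightarrow> x \<in> C01_0 \<Longrightarrow> \<gamma> (c *\<^sub>R x) = c * \<gamma> x"
  by (auto simp: dual_C01_0_def)

lemma dual_sum:
  assumes "\<And>p. p \<in> I \<Longrightarrow> g p \<in> dual_C01_0"
  shows "(\<lambda>\<omega>. \<Sum>p\<in>I. a p * g p \<omega>) \<in> dual_C01_0"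
  using assms unfolding dual_C01_0_def
  by (auto simp: sum.distrib sum_distrib_left algebra_simps intro!: sum.cong continuous_intros)

lemma eval_dual: "(\<lambda>\<omega>. apply_bcontfun \<omega> t $ i) \<in> dual_C01_0"
  unfolding dual_C01_0_def
  by (auto simp: plus_bcontfun.rep_eq scaleR_bcontfun.rep_eq intro!: continuous_on_component continuous_on_eval)

lemma bounded_linear_dual:
  assumes g: "\<gamma> \<in> dual_C01_0"
  shows "bounded_linear (\<lambda>k. \<gamma> (\<iota> k))"
proof -
  have lin: "linear (\<lambda>k. \<gamma> (\<iota> k))"
    by (rule linearI) (simp_all add: \<iota>.add \<iota>.scaleR dual_add[OF g] dual_scaleR[OF g] iota_in_C01_0)
  interpret linear "\<lambda>k. \<gamma> (\<iota> k)" by (rule lin)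
  have "continuous_on UNIV (\<lambda>k. \<gamma> (\<iota> k))"
    by (rule continuous_on_compose2[of C01_0 \<gamma>])
       (use g iota_in_C01_0 in \<open>auto simp: dual_C01_0_def intro: \<iota>.continuous_on\<close>)
  then have "\<exists>d>0. \<forall>k. dist k 0 < d \<longrightarrow> dist (\<gamma> (\<iota> k)) (\<gamma> (\<iota> 0)) < 1"
    unfolding continuous_on_iff by (metis UNIV_I zero_less_one)
  then obtain d where d: "d > 0" "\<And>k. norm k < d \<Longrightarrow> \<bar>\<gamma> (\<iota> k)\<bar> < 1"
    using zero by (auto simp: dist_norm)
  show ?thesis
  proof (rule bounded_linear_intro)
    fix k
    show "norm (\<gamma> (\<iota> k)) \<le> norm k * (2 / d)"
    proof (cases "k = 0")
      case True then show ?thesis using zero by simp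
    next
      case False
      have "\<bar>\<gamma> (\<iota> ((d / (2 * norm k)) *\<^sub>R k))\<bar> < 1" by (rule d(2)) (use d(1) False in simp)
      then have "d / (2 * norm k) * \<bar>\<gamma> (\<iota> k)\<bar> < 1"
        using d(1) False by (simp add: scale abs_mult)
      then show ?thesis using d(1) False by (simp add: field_simps)
    qed
  qed (use add scale in auto)
qed

lemma riesz_eqI:
  assumes "\<And>k. inner k h = \<gamma> (\<iota> k)"
  shows "riesz \<iota> \<gamma> = h"
  unfolding riesz_def
proof (rule the_equality)
  fix h' assume "\<forall>k. inner k h' = \<gamma> (\<iota> k)"
  then have "inner (h' - h) (h' - h) = 0" using assms by (simp add: inner_diff_right)
  then show "h' = h" by simp
qed (use assms in blast)

lemma inner_riesz:
  assumes "\<gamma> \<in> dual_C01_0"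
  shows "inner k (riesz \<iota> \<gamma>) = \<gamma> (\<iota> k)"
proof -
  obtain h where "\<And>k. inner k h = \<gamma> (\<iota> k)"
    using riesz_representation[OF bounded_linear_dual[OF assms]] by blast
  then show ?thesis using riesz_eqI[of h \<gamma>] by simp
qed

lemma riesz_sum:
  assumes "\<And>p. p \<in> I \<Longrightarrow> g p \<in> dual_C01_0"
  shows "riesz \<iota> (\<lambda>\<omega>. \<Sum>p\<in>I. a p * g p \<omega>) = (\<Sum>p\<in>I. a p *\<^sub>R riesz \<iota> (g p))"
  by (rule riesz_eqI) (use assms in \<open>auto simp: inner_sum_right inner_riesz intro!: sum.cong\<close>)

text \<open>The elements \<open>h\<close> whose Paley-Wiener integral is given by a continuous
  functional and is therefore defined at every path, not just almost surely. The Cameron--Martin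
  shifts are carried out along these.\<close>

definition riesz_range :: "'h set" where "riesz_range = riesz \<iota> ` dual_C01_0"

text \<open>A pointwise version of the Paley-Wiener integral of \<open>h\<close>. For
  \<open>h\<close> in \<open>riesz_range\<close> its values on \<open>C01_0\<close> do not depend on
  the choice, because continuous functionals that agree on the dense range of \<open>\<iota>\<close>
  agree there.\<close>

definition functional :: "'h \<Rightarrow> 'd path \<Rightarrow> real" where
  "functional h = (SOME \<gamma>. \<gamma> \<in> dual_C01_0 \<and> riesz \<iota> \<gamma> = h)"

lemma functional:
  assumes "h \<in> riesz_range"
  shows functional_dual: "functional h \<in> dual_C01_0" and riesz_functional: "riesz \<iota> (functional h) = h"
proof -
  have "\<exists>\<gamma>. \<gamma> \<in> dual_C01_0 \<and> riesz \<iota> \<gamma> = h" using assms by (auto simp: riesz_range_def)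
  from someI_ex[OF this] show "functional h \<in> dual_C01_0" "riesz \<iota> (functional h) = h"
    unfolding functional_def by auto
qed

lemma functional_iota: "h \<in> riesz_range \<Longrightarrow> functional h (\<iota> k) = inner k h"
  using inner_riesz[OF functional_dual, of h k] riesz_functional[of h] by simp

lemma subspace_riesz_range: "subspace riesz_range"
proof -
  have lc: "a *\<^sub>R x + b *\<^sub>R y \<in> riesz_range" if "x \<in> riesz_range" "y \<in> riesz_range" for a b x y
  proof -
    let ?g = "\<lambda>p::bool. functional (if p then x else y)"
    have D: "?g p \<in> dual_C01_0" for p using that by (auto intro: functional_dual)
    have "riesz \<iota> (\<lambda>\<omega>. \<Sum>p\<in>UNIV. (if p then a else b) * ?g p \<omega>) = (\<Sum>p\<in>UNIV. (if p then a else b) *\<^sub>R riesz \<iota> (?g p))"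
      by (rule riesz_sum[OF D])
    also have "\<dots> = a *\<^sub>R x + b *\<^sub>R y" using that by (simp add: UNIV_bool riesz_functional)
    finally have eq: "riesz \<iota> (\<lambda>\<omega>. \<Sum>p\<in>UNIV. (if p then a else b) * ?g p \<omega>) = a *\<^sub>R x + b *\<^sub>R y" .
    show ?thesis unfolding riesz_range_def eq[symmetric] by (rule imageI, rule dual_sum[OF D])
  qed
  have "(\<lambda>\<omega>. \<Sum>p\<in>({}::nat set). 0 * (\<lambda>p \<omega>. 0) p \<omega>) \<in> dual_C01_0" by (rule dual_sum) auto
  then have "riesz_range \<noteq> {}" unfolding riesz_range_def by blast
  then obtain x where "x \<in> riesz_range" by blast
  then have "0 \<in> riesz_range" using lc[of x x 0 0] by simp
  moreover have "x + y \<in> riesz_range" if "x \<in> riesz_range" "y \<in> riesz_range" for x y using lc[OF that, of 1 1] by simp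
  moreover have "a *\<^sub>R x \<in> riesz_range" if "x \<in> riesz_range" for a x using lc[OF that that, of a 0] by simp
  ultimately show ?thesis unfolding subspace_def by blast
qed

lemma dual_eqI:
  assumes "\<gamma> \<in> dual_C01_0" "\<gamma>' \<in> dual_C01_0" "\<And>k. \<gamma> (\<iota> k) = \<gamma>' (\<iota> k)" "\<omega> \<in> C01_0"
  shows "\<gamma> \<omega> = \<gamma>' \<omega>"
proof -
  obtain u where u: "\<And>n::nat. \<iota> (u n) \<in> C01_0" "(\<lambda>n. \<iota> (u n)) \<longlonglongrightarrow> \<omega>"
  proof -
    have "\<omega> \<in> closure (range \<iota>)" using assms dense_embedding by blast
    then obtain y where y: "\<And>n. y n \<in> range \<iota>" "y \<longlonglongrightarrow> \<omega>" unfolding closure_sequential by blast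
    then have "\<exists>u. \<forall>n. y n = \<iota> (u n)" by (intro choice) blast
    then obtain u where "\<And>n. y n = \<iota> (u n)" by blast
    then have "y = (\<lambda>n. \<iota> (u n))" by auto
    then show thesis using that[of u] y(2) iota_in_C01_0 by simp
  qed
  have *: "(\<lambda>n. g (\<iota> (u n))) \<longlonglongrightarrow> g \<omega>" if "g \<in> dual_C01_0" for g
  proof -
    have "continuous_on C01_0 g" using that by (simp add: dual_C01_0_def)
    then show ?thesis using u assms(4) unfolding continuous_on_sequentially by (auto simp: o_def)
  qed
  show ?thesis
    using *[OF assms(1)] *[OF assms(2)] assms(3) LIMSEQ_unique by simp
qed

lemma dual_expand:
  assumes C: "C \<subseteq> riesz_range" and g: "\<gamma> \<in> dual_C01_0" and r: "riesz \<iota> \<gamma> = (\<Sum>c\<in>C. a c *\<^sub>R c)" and w: "\<omega> \<in> C01_0"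
  shows "\<gamma> \<omega> = (\<Sum>c\<in>C. a c * functional c \<omega>)"
proof (rule dual_eqI[OF g _ _ w])
  have D: "functional c \<in> dual_C01_0" if "c \<in> C" for c using C that functional_dual by blast
  show "(\<lambda>\<omega>. \<Sum>c\<in>C. a c * functional c \<omega>) \<in> dual_C01_0" by (rule dual_sum[OF D])
  fix k
  have "\<gamma> (\<iota> k) = inner k (\<Sum>c\<in>C. a c *\<^sub>R c)" using inner_riesz[OF g] r by simp
  also have "\<dots> = (\<Sum>c\<in>C. a c * functional c (\<iota> k))"
    unfolding inner_sum_right using C functional_iota by (intro sum.cong) auto
  finally show "\<gamma> (\<iota> k) = (\<Sum>c\<in>C. a c * functional c (\<iota> k))" .
qed

text \<open>A vector orthogonal to all representatives is annihilated by every evaluation of a path,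
  so its image under the injective embedding vanishes.\<close>

lemma closure_riesz_range: "closure riesz_range = UNIV"
proof (rule closure_subspace_eq_UNIV[OF subspace_riesz_range])
  fix h assume h: "\<And>d. d \<in> riesz_range \<Longrightarrow> inner h d = 0"
  have "\<gamma> (\<iota> h) = 0" if "\<gamma> \<in> dual_C01_0" for \<gamma>
    using h[of "riesz \<iota> \<gamma>"] that inner_riesz[OF that, of h] by (auto simp: riesz_range_def)
  then have "apply_bcontfun (\<iota> h) t $ i = 0" for t i using eval_dual by blast
  then have "\<iota> h = \<iota> 0" unfolding \<iota>.zero by (intro bcontfun_eqI) (simp add: vec_eq_iff)
  then show "h = 0" using inj_embedding by (meson injD)
qed

text \<open>The distance between two evaluation kernels can be read off the characteristic function
  of the increment of the noise, and that tends to one by path continuity and dominated convergence.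
  This extracts a modulus of continuity for Cameron--Martin paths from the measure itself.\<close>

lemma isCont_riesz_eval: "isCont (\<lambda>t. riesz \<iota> (\<lambda>\<omega>. apply_bcontfun \<omega> t $ i)) t"
proof -
  let ?k = "\<lambda>t. riesz \<iota> (\<lambda>\<omega>. apply_bcontfun \<omega> t $ i)"
  have id: "complex_of_real (exp (- (1/2) * (norm (?k s - ?k t))\<^sup>2)) =
      (CLINT \<omega>|P. iexp (apply_bcontfun \<omega> s $ i - apply_bcontfun \<omega> t $ i))" for s
  proof -
    have D: "(\<lambda>\<omega>. apply_bcontfun \<omega> s $ i - apply_bcontfun \<omega> t $ i) \<in> dual_C01_0"
      using dual_sum[of "UNIV::bool set" "\<lambda>p \<omega>. apply_bcontfun \<omega> (if p then s else t) $ i" "\<lambda>p. if p then 1 else -1", OF eval_dual]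
        by (simp add: UNIV_bool eval_dual)
    have "riesz \<iota> (\<lambda>\<omega>. apply_bcontfun \<omega> s $ i - apply_bcontfun \<omega> t $ i) = ?k s - ?k t"
      by (rule riesz_eqI) (simp add: inner_diff_right inner_riesz[OF eval_dual])
    then show ?thesis using cameron_martin D by auto
  qed
  show ?thesis
    unfolding continuous_at_sequentially
  proof (intro allI impI)
    fix x assume x: "x \<longlonglongrightarrow> t"
    have "(\<lambda>n. CLINT \<omega>|P. iexp (apply_bcontfun \<omega> (x n) $ i - apply_bcontfun \<omega> t $ i)) \<longlonglongrightarrow> (CLINT \<omega>|P. iexp 0)"
    proof (rule integral_dominated_convergence[where w = "\<lambda>_. 1"])
      show "(\<lambda>\<omega>. iexp (apply_bcontfun \<omega> (x n) $ i - apply_bcontfun \<omega> t $ i)) \<in> borel_measurable P" for n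
        using borel_measurable_dual[OF eval_dual] by measurable
      show "AE \<omega> in P. (\<lambda>n. iexp (apply_bcontfun \<omega> (x n) $ i - apply_bcontfun \<omega> t $ i)) \<longlonglongrightarrow> iexp 0"
      proof (rule AE_I2)
        fix \<omega> :: "'d path"
        have "isCont (apply_bcontfun \<omega>) t"
          by (metis UNIV_I continuous_on_apply_bcontfun continuous_on_eq_continuous_at open_UNIV)
        then have "(\<lambda>n. apply_bcontfun \<omega> (x n)) \<longlonglongrightarrow> apply_bcontfun \<omega> t"
          using x by (rule isCont_tendsto_compose)
        then have "(\<lambda>n. apply_bcontfun \<omega> (x n) $ i - apply_bcontfun \<omega> t $ i) \<longlonglongrightarrow> apply_bcontfun \<omega> t $ i - apply_bcontfun \<omega> t $ i"
          by (intro tendsto_intros)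
        then show "(\<lambda>n. iexp (apply_bcontfun \<omega> (x n) $ i - apply_bcontfun \<omega> t $ i)) \<longlonglongrightarrow> iexp 0"
          by (intro tendsto_intros) simp
      qed
    qed auto
    then have "(\<lambda>n. complex_of_real (exp (- (1/2) * (norm (?k (x n) - ?k t))\<^sup>2))) \<longlonglongrightarrow> complex_of_real 1"
      unfolding id by (simp add: prob_space)
    then have "(\<lambda>n. exp (- (1/2) * (norm (?k (x n) - ?k t))\<^sup>2)) \<longlonglongrightarrow> 1"
      unfolding tendsto_of_real_iff .
    then have "(\<lambda>n. ln (exp (- (1/2) * (norm (?k (x n) - ?k t))\<^sup>2))) \<longlonglongrightarrow> ln 1"
      by (rule tendsto_ln) simp
    then have "(\<lambda>n. - 2 * (- (1/2) * (norm (?k (x n) - ?k t))\<^sup>2)) \<longlonglongrightarrow> - 2 * 0"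
      by (intro tendsto_mult tendsto_const) simp
    then have "(\<lambda>n. sqrt ((norm (?k (x n) - ?k t))\<^sup>2)) \<longlonglongrightarrow> sqrt 0"
      by (intro tendsto_real_sqrt) simp
    then have "(\<lambda>n. norm (?k (x n) - ?k t)) \<longlonglongrightarrow> 0" by simp
    then show "(?k \<circ> x) \<longlonglongrightarrow> ?k t"
      unfolding o_def using LIM_zero_iff tendsto_norm_zero_iff by blast
  qed
qed

text \<open>Coordinates of \<open>\<iota> u\<close> at time \<open>t\<close> are inner products of
  \<open>u\<close> with an evaluation kernel, so continuity of the kernels makes the image of a ball
  equicontinuous. Arzela-Ascoli provides a uniform limit, and \<open>image_cball_limit\<close> puts
  it back into the image of the same ball.\<close>

lemma compact_iota_cball: "compact (\<iota> ` cball 0 r)"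
  unfolding compact_def
proof (intro allI impI)
  fix f :: "nat \<Rightarrow> 'd path" assume f: "\<forall>n. f n \<in> \<iota> ` cball 0 r"
  then have "\<forall>n. \<exists>u. f n = \<iota> u \<and> norm u \<le> r" by (metis imageE mem_cball_0)
  then have "\<exists>u. \<forall>n. f n = \<iota> (u n) \<and> norm (u n) \<le> r" by (rule choice)
  then obtain u where u: "\<And>n. f n = \<iota> (u n)" "\<And>n. norm (u n) \<le> r" by blast
  obtain K where K: "\<And>h. norm (\<iota> h) \<le> norm h * K" "K > 0" using \<iota>.pos_bounded by blast
  have r: "r \<ge> 0" using u(2)[of 0] norm_ge_zero order_trans by blast
  let ?k = "\<lambda>t i. riesz \<iota> (\<lambda>\<omega>. apply_bcontfun \<omega> t $ i)"
  obtain g k where g: "continuous_on {0..1} g" "strict_mono (k :: nat \<Rightarrow> nat)"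
    "\<And>e. 0 < e \<Longrightarrow> \<exists>N. \<forall>n x. n \<ge> N \<and> x \<in> {0..1} \<longrightarrow> norm (apply_bcontfun (f (k n)) x - g x) < e"
  proof (rule Arzela_Ascoli[of "{0..1::real}" "\<lambda>n. apply_bcontfun (f n)" "r * K"])
    fix n x
    have "norm (apply_bcontfun (f n) x) \<le> norm (u n) * K"
      unfolding u using norm_bounded[of "\<iota> (u n)" x] K(1)[of "u n"] by linarith
    also have "\<dots> \<le> r * K" using u(2) K(2) by (intro mult_right_mono) auto
    finally show "norm (apply_bcontfun (f n) x) \<le> r * K" .
  next
    fix x e :: real assume e: "0 < e"
    let ?G = "\<lambda>y. \<Sum>i\<in>UNIV. r * norm (?k x i - ?k y i)"
    have "isCont ?G x" by (intro continuous_intros isCont_riesz_eval)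
    then obtain d where d: "d > 0" "\<And>y. dist y x < d \<Longrightarrow> dist (?G y) (?G x) < e"
      unfolding continuous_at_eps_delta using e by blast
    show "\<exists>d>0. \<forall>n y. y \<in> {0..1} \<and> norm (x - y) < d \<longrightarrow> norm (apply_bcontfun (f n) x - apply_bcontfun (f n) y) < e"
    proof (intro exI[of _ d] conjI d(1) allI impI)
      fix n y assume y: "y \<in> {0..1} \<and> norm (x - y) < d"
      have c: "apply_bcontfun (f n) s $ i = inner (u n) (?k s i)" for s i
        unfolding u(1) inner_riesz[OF eval_dual] ..
      have "norm (apply_bcontfun (f n) x - apply_bcontfun (f n) y) \<le> (\<Sum>i\<in>UNIV. \<bar>(apply_bcontfun (f n) x - apply_bcontfun (f n) y) $ i\<bar>)"
        by (rule norm_le_l1_cart)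
      also have "\<dots> \<le> ?G y"
      proof (rule sum_mono)
        fix i
        have "\<bar>(apply_bcontfun (f n) x - apply_bcontfun (f n) y) $ i\<bar> = \<bar>inner (u n) (?k x i - ?k y i)\<bar>"
          by (simp add: c inner_diff_right)
        also have "\<dots> \<le> norm (u n) * norm (?k x i - ?k y i)" by (rule Cauchy_Schwarz_ineq2)
        also have "\<dots> \<le> r * norm (?k x i - ?k y i)" using u(2) by (intro mult_right_mono) auto
        finally show "\<bar>(apply_bcontfun (f n) x - apply_bcontfun (f n) y) $ i\<bar> \<le> r * norm (?k x i - ?k y i)" .
      qed
      also have "?G y < e"
      proof -
        have "dist y x < d" using y by (simp add: dist_real_def abs_minus_commute)
        then have "dist (?G y) (?G x) < e" by (rule d(2))
        then have "\<bar>?G y\<bar> < e" by (simp only: dist_real_def) simp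
        then show ?thesis by linarith
      qed
      finally show "norm (apply_bcontfun (f n) x - apply_bcontfun (f n) y) < e" .
    qed
  qed auto
  have lim: "(\<lambda>n. f (k n)) \<longlonglongrightarrow> path_of g"
  proof (rule metric_LIMSEQ_I)
    fix e :: real assume e: "e > 0"
    obtain N where N: "\<And>n x. n \<ge> N \<Longrightarrow> x \<in> {0..1} \<Longrightarrow> norm (apply_bcontfun (f (k n)) x - g x) < e / 2"
      using g(3)[of "e/2"] e by auto
    have half: "dist (f (k n)) (path_of g) \<le> e / 2" if "n \<ge> N" for n
    proof (rule C01_dist_le)
      show "f (k n) \<in> C01" unfolding u using iota_in_C01_0 C01_0_subset by blast
      show "path_of g \<in> C01" by (rule path_of_in_C01[OF g(1)])
      show "dist (apply_bcontfun (f (k n)) t) (apply_bcontfun (path_of g) t) \<le> e / 2" if t: "t \<in> {0..1}" for t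
        using N[OF \<open>n \<ge> N\<close> t] t by (simp add: apply_path_of[OF g(1)] dist_norm less_imp_le)
    qed
    then have "dist (f (k n)) (path_of g) < e" if "n \<ge> N" for n
      using half[OF that] e by linarith
    then show "\<exists>no. \<forall>n\<ge>no. dist (f (k n)) (path_of g) < e" by blast
  qed
  have "path_of g \<in> \<iota> ` cball 0 r"
    by (rule image_cball_limit[OF bounded_linear_embedding, of "\<lambda>n. u (k n)"]) (use u lim in auto)
  then show "\<exists>l\<in>\<iota> ` cball 0 r. \<exists>r. strict_mono r \<and> (f \<circ> r) \<longlonglongrightarrow> l"
    by (rule bexI[rotated], intro exI[of _ k] conjI g(2)) (use lim in \<open>simp add: o_def\<close>)
qed

end

section \<open>The Cameron--Martin shift\<close>

interpretation std_normal: real_distribution std_normal_distribution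
  by (rule real_dist_normal_dist)

interpretation std_normal_prod: product_sigma_finite "\<lambda>_. std_normal_distribution"
  by (rule product_sigma_finite.intro) unfold_locales

lemma sets_PiM_std_normal: "sets (PiM C (\<lambda>_. std_normal_distribution)) = sets (PiM C (\<lambda>_. borel))"
  by (rule sets_PiM_cong) auto

context abstract_wiener_space
begin

lemma functional_measurable: "h \<in> riesz_range \<Longrightarrow> functional h \<in> borel_measurable P"
  by (intro borel_measurable_dual functional_dual)

lemma char_dual:
  "\<gamma> \<in> dual_C01_0 \<Longrightarrow> (CLINT \<omega>|P. iexp (\<gamma> \<omega>)) = complex_of_real (exp (- (1/2) * (norm (riesz \<iota> \<gamma>))\<^sup>2))"
  using cameron_martin by blast

text \<open>By orthonormality the squared norm in the characteristic function is a sum of squares,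
  so the function factors into standard normal ones.\<close>

lemma distr_functional:
  assumes C: "finite C" "C \<subseteq> riesz_range" "orthonormal C"
  shows "distr P (PiM C (\<lambda>_. borel)) (\<lambda>\<omega>. \<lambda>c\<in>C. functional c \<omega>) = PiM C (\<lambda>_. std_normal_distribution)"
proof (rule std_normal_prod.PiM_eqI[OF C(1)])
  show "sets (distr P (PiM C (\<lambda>_. borel)) (\<lambda>\<omega>. \<lambda>c\<in>C. functional c \<omega>)) = sets (PiM C (\<lambda>_. std_normal_distribution))"
    by (simp add: sets_PiM_std_normal)
  fix A assume A: "\<And>i. i \<in> C \<Longrightarrow> A i \<in> sets std_normal_distribution"
  let ?N = "PiM C (\<lambda>_. std_normal_distribution)"
  interpret N: prob_space ?N by (rule prob_space_PiM) (rule std_normal.prob_space_axioms)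
  have Cm: "c \<in> C \<Longrightarrow> c \<in> riesz_range" for c using C(2) by blast
  have meas: "(\<lambda>\<omega>. \<lambda>c\<in>C. functional c \<omega>) \<in> measurable P (PiM C (\<lambda>_. borel))"
    by (intro measurable_restrict functional_measurable Cm)
  have pm: "PiE C A \<in> sets (PiM C (\<lambda>_. borel))"
    using C(1) A by (intro sets_PiM_I_finite) auto
  have "measure P {\<omega>\<in>space P. \<forall>c\<in>C. functional c \<omega> \<in> A c} = measure ?N {z\<in>space ?N. \<forall>c\<in>C. z c \<in> A c}"
  proof (rule char_uniqueness_finite[OF C(1)])
    show "finite_measure P" "finite_measure ?N" by unfold_locales
    show "functional c \<in> borel_measurable P" if "c \<in> C" for c by (intro functional_measurable Cm that)
    show "(\<lambda>z. z c) \<in> borel_measurable ?N" if "c \<in> C" for c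
      by (subst measurable_cong_sets[OF sets_PiM_std_normal refl]) (rule measurable_component_singleton[OF that])
    show "A c \<in> sets borel" if "c \<in> C" for c using A[OF that] by simp
    fix \<xi> :: "'h \<Rightarrow> real"
    have "(CLINT \<omega>|P. iexp (\<Sum>c\<in>C. \<xi> c * functional c \<omega>)) =
        complex_of_real (exp (- (1/2) * (norm (\<Sum>c\<in>C. \<xi> c *\<^sub>R c))\<^sup>2))"
      using char_dual[OF dual_sum[of C functional \<xi>]] riesz_sum[of C functional \<xi>] functional_dual Cm riesz_functional
      by simp
    also have "(norm (\<Sum>c\<in>C. \<xi> c *\<^sub>R c))\<^sup>2 = (\<Sum>c\<in>C. (\<xi> c)\<^sup>2)"
      unfolding power2_norm_eq_inner orthonormal_inner_sum[OF C(1,3)] by (simp add: power2_eq_square)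
    also have "exp (- (1/2) * (\<Sum>c\<in>C. (\<xi> c)\<^sup>2)) = (\<Prod>c\<in>C. exp (- (\<xi> c)\<^sup>2 / 2))"
      using C(1) by (simp add: exp_sum[symmetric] sum_distrib_left sum_negf sum_divide_distrib)
    also have "complex_of_real \<dots> = (\<Prod>c\<in>C. char std_normal_distribution (\<xi> c))"
      by (simp add: char_std_normal_distribution)
    also have "\<dots> = (CLINT z|?N. (\<Prod>c\<in>C. iexp (\<xi> c * z c)))"
      unfolding char_def
      by (rule std_normal_prod.product_integral_prod[symmetric, OF C(1)]) (intro std_normal.integrable_iexp, auto)
    also have "\<dots> = (CLINT z|?N. iexp (\<Sum>c\<in>C. \<xi> c * z c))"
      using C(1) by (simp add: exp_sum[symmetric] sum_distrib_left)
    finally show "(CLINT \<omega>|P. iexp (\<Sum>c\<in>C. \<xi> c * functional c \<omega>)) = (CLINT z|?N. iexp (\<Sum>c\<in>C. \<xi> c * z c))" .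
  qed
  also have "{z\<in>space ?N. \<forall>c\<in>C. z c \<in> A c} = PiE C A"
    using A sets.sets_into_space[of _ borel] by (auto simp: space_PiM PiE_iff extensional_def)
  also have "{\<omega>\<in>space P. \<forall>c\<in>C. functional c \<omega> \<in> A c} = (\<lambda>\<omega>. \<lambda>c\<in>C. functional c \<omega>) -` PiE C A \<inter> space P"
    by (auto simp: PiE_iff)
  finally have "emeasure P ((\<lambda>\<omega>. \<lambda>c\<in>C. functional c \<omega>) -` PiE C A \<inter> space P) = emeasure ?N (PiE C A)"
    by (simp add: emeasure_eq_measure N.emeasure_eq_measure)
  also have "\<dots> = (\<Prod>i\<in>C. emeasure std_normal_distribution (A i))"
    by (rule std_normal_prod.emeasure_PiM[OF C(1) A])
  finally show "emeasure (distr P (PiM C (\<lambda>_. borel)) (\<lambda>\<omega>. \<lambda>c\<in>C. functional c \<omega>)) (PiE C A) =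
      (\<Prod>i\<in>C. emeasure std_normal_distribution (A i))"
    using emeasure_distr[OF meas pm] by simp
qed

lemma measurable_restrict_functional:
  assumes "C \<subseteq> riesz_range"
  shows "(\<lambda>\<omega>. \<lambda>c\<in>C. functional c \<omega>) \<in> measurable P (PiM C (\<lambda>_. borel))"
  by (intro measurable_restrict functional_measurable) (use assms in blast)

lemma functional_expand:
  assumes C: "finite C" "C \<subseteq> riesz_range" "orthonormal C"
    and h: "h \<in> riesz_range" "h \<in> span C" and w: "\<omega> \<in> C01_0"
  shows "functional h \<omega> = (\<Sum>c\<in>C. inner h c * functional c \<omega>)"
  by (rule dual_expand[OF C(2) functional_dual[OF h(1)] _ w])
     (simp only: riesz_functional[OF h(1)], rule orthonormal_expand[OF C(1,3) h(2)])

text \<open>The mixed Laplace-Fourier transform lets the density \<open>exp (functional h)\<close>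
  be tested against the characters of \<open>functional g\<close>. An orthonormal basis of the span
  of \<open>h\<close> and \<open>g\<close> makes the integrand a product over independent standard
  normals.\<close>

lemma exp_functional:
  assumes h: "h \<in> riesz_range" and g: "g \<in> riesz_range"
  shows "integrable P (\<lambda>\<omega>. exp (complex_of_real (functional h \<omega>) + \<i> * functional g \<omega>))" (is ?A)
    and "(CLINT \<omega>|P. exp (complex_of_real (functional h \<omega>) + \<i> * functional g \<omega>)) =
      exp (complex_of_real (((norm h)\<^sup>2 - (norm g)\<^sup>2) / 2) + \<i> * inner h g)" (is ?B)
proof -
  obtain C where C: "finite C" "span C = span {h, g}" "orthonormal C"
    using orthonormal_span[of "{h, g}"] by (metis finite.emptyI finite_insert)
  have "span {h, g} \<subseteq> riesz_range" by (rule span_minimal[OF _ subspace_riesz_range]) (use h g in auto)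
  then have CR: "C \<subseteq> riesz_range" using C(2) span_superset by blast
  have hs: "h \<in> span C" "g \<in> span C" unfolding C(2) by (auto intro: span_base)
  note eh = functional_expand[OF C(1) CR C(3) h hs(1)] and eg = functional_expand[OF C(1) CR C(3) g hs(2)]
  let ?N = "PiM C (\<lambda>_. std_normal_distribution)"
  define F where "F z = (\<Prod>c\<in>C. exp ((complex_of_real (inner h c) + \<i> * complex_of_real (inner g c)) * complex_of_real (z c)))" for z
  have Fm: "F \<in> borel_measurable (PiM C (\<lambda>_. borel))"
    unfolding F_def[abs_def]
  proof (intro borel_measurable_prod)
    fix c assume "c \<in> C"
    then have [measurable]: "(\<lambda>z. z c) \<in> borel_measurable (PiM C (\<lambda>_. borel :: real measure))"
      by (rule measurable_component_singleton)
    show "(\<lambda>z. exp ((complex_of_real (inner h c) + \<i> * complex_of_real (inner g c)) * complex_of_real (z c))) \<in> borel_measurable (PiM C (\<lambda>_. borel))"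
      by measurable
  qed
  have eq: "exp (complex_of_real (functional h \<omega>) + \<i> * functional g \<omega>) = F (\<lambda>c\<in>C. functional c \<omega>)" if "\<omega> \<in> space P" for \<omega>
  proof -
    have w: "\<omega> \<in> C01_0" using that by (simp add: space_P)
    have "complex_of_real (functional h \<omega>) + \<i> * functional g \<omega> =
       (\<Sum>c\<in>C. (complex_of_real (inner h c) + \<i> * complex_of_real (inner g c)) * complex_of_real (functional c \<omega>))"
      unfolding eh[OF w] eg[OF w] by (simp add: sum.distrib sum_distrib_left algebra_simps)
    then show ?thesis unfolding F_def using C(1) by (simp add: exp_sum)
  qed
  have iF: "integrable ?N F"
    unfolding F_def[abs_def] by (rule std_normal_prod.product_integrable_prod[OF C(1)]) (rule std_normal_exp)
  have "integrable (distr P (PiM C (\<lambda>_. borel)) (\<lambda>\<omega>. \<lambda>c\<in>C. functional c \<omega>)) F"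
    using iF by (simp only: distr_functional[OF C(1) CR C(3)])
  then have "integrable P (\<lambda>\<omega>. F (\<lambda>c\<in>C. functional c \<omega>))"
    by (subst (asm) integrable_distr_eq[OF measurable_restrict_functional[OF CR] Fm])
  then show ?A by (subst Bochner_Integration.integrable_cong[OF refl eq])
  have "(CLINT \<omega>|P. exp (complex_of_real (functional h \<omega>) + \<i> * functional g \<omega>)) = (CLINT \<omega>|P. F (\<lambda>c\<in>C. functional c \<omega>))"
    by (rule Bochner_Integration.integral_cong[OF refl eq])
  also have "\<dots> = integral\<^sup>L (distr P (PiM C (\<lambda>_. borel)) (\<lambda>\<omega>. \<lambda>c\<in>C. functional c \<omega>)) F"
    by (rule integral_distr[OF measurable_restrict_functional[OF CR] Fm, symmetric])
  also have "\<dots> = integral\<^sup>L ?N F" by (simp only: distr_functional[OF C(1) CR C(3)])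
  also have "\<dots> = (\<Prod>c\<in>C. exp ((complex_of_real (inner h c) + \<i> * complex_of_real (inner g c))\<^sup>2 / 2))"
    unfolding F_def[abs_def]
    by (subst std_normal_prod.product_integral_prod[OF C(1) std_normal_exp(1)]) (simp only: std_normal_exp(2))
  also have "\<dots> = exp (\<Sum>c\<in>C. (complex_of_real (inner h c) + \<i> * complex_of_real (inner g c))\<^sup>2 / 2)"
    by (rule exp_sum[OF C(1), symmetric])
  also have "(\<Sum>c\<in>C. (complex_of_real (inner h c) + \<i> * complex_of_real (inner g c))\<^sup>2 / 2) =
     complex_of_real (((\<Sum>c\<in>C. inner h c * inner h c) - (\<Sum>c\<in>C. inner g c * inner g c)) / 2) + \<i> * (\<Sum>c\<in>C. inner h c * inner g c)"
    by (simp add: power2_sum power_mult_distrib power2_eq_square sum.distrib sum_subtractf sum_divide_distrib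
        sum_distrib_left diff_divide_distrib add_divide_distrib algebra_simps)
  also have "(\<Sum>c\<in>C. inner h c * inner h c) = (norm h)\<^sup>2"
    using orthonormal_inner_sum[OF C(1,3), of "inner h" "inner h"] orthonormal_expand[OF C(1,3) hs(1)]
    by (simp add: power2_norm_eq_inner)
  also have "(\<Sum>c\<in>C. inner g c * inner g c) = (norm g)\<^sup>2"
    using orthonormal_inner_sum[OF C(1,3), of "inner g" "inner g"] orthonormal_expand[OF C(1,3) hs(2)]
    by (simp add: power2_norm_eq_inner)
  also have "(\<Sum>c\<in>C. inner h c * inner g c) = inner h g"
    using orthonormal_inner_sum[OF C(1,3), of "inner h" "inner g"] orthonormal_expand[OF C(1,3) hs(1)]
      orthonormal_expand[OF C(1,3) hs(2)]
    by simp
  finally show ?B .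
qed

lemma exp_functional_real:
  assumes h: "h \<in> riesz_range"
  shows "integrable P (\<lambda>\<omega>. exp (functional h \<omega>))"
    and "(LINT \<omega>|P. exp (functional h \<omega>)) = exp ((norm h)\<^sup>2 / 2)"
proof -
  have z: "0 \<in> riesz_range" by (rule subspace_0[OF subspace_riesz_range])
  have z0: "functional 0 \<omega> = 0" if "\<omega> \<in> space P" for \<omega>
    using dual_expand[of "{}" "functional 0" "\<lambda>_. 0" \<omega>] functional_dual[OF z] riesz_functional[OF z] that
    by (simp add: space_P)
  have e: "exp (complex_of_real (functional h \<omega>) + \<i> * functional 0 \<omega>) = complex_of_real (exp (functional h \<omega>))"
    if "\<omega> \<in> space P" for \<omega> using z0[OF that] by (simp add: exp_of_real)
  have "integrable P (\<lambda>\<omega>. complex_of_real (exp (functional h \<omega>)))"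
    using exp_functional(1)[OF h z] by (subst Bochner_Integration.integrable_cong[OF refl e[symmetric]])
  then show "integrable P (\<lambda>\<omega>. exp (functional h \<omega>))" unfolding complex_of_real_integrable_eq .
  have "complex_of_real (LINT \<omega>|P. exp (functional h \<omega>)) = (CLINT \<omega>|P. exp (complex_of_real (functional h \<omega>) + \<i> * functional 0 \<omega>))"
    unfolding integral_complex_of_real[symmetric] by (rule Bochner_Integration.integral_cong[OF refl e[symmetric]])
  also have "\<dots> = exp (complex_of_real ((norm h)\<^sup>2 / 2))"
    unfolding exp_functional(2)[OF h z] by simp
  also have "\<dots> = complex_of_real (exp ((norm h)\<^sup>2 / 2))" by (rule exp_of_real)
  finally show "(LINT \<omega>|P. exp (functional h \<omega>)) = exp ((norm h)\<^sup>2 / 2)" unfolding of_real_eq_iff .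
qed

lemma functional_expectation:
  assumes h: "h \<in> riesz_range"
  shows "integrable P (functional h)" "(LINT \<omega>|P. functional h \<omega>) = 0"
proof -
  have "integrable P (functional h) \<and> (LINT \<omega>|P. functional h \<omega>) = 0"
  \<comment> \<open>The normal law is assumed for functionals that do not vanish on
    \<open>C01_0\<close>; the zero functional is treated by hand.\<close>
  proof (cases "\<exists>\<omega>\<in>C01_0. functional h \<omega> \<noteq> 0")
    case True
    then obtain \<sigma> where s: "\<sigma> > 0" "distributed P lborel (functional h) (normal_density 0 \<sigma>)"
      using gaussian functional_dual[OF h] by blast
    have "integrable P (\<lambda>\<omega>. (\<lambda>x. x) (functional h \<omega>))"
      using distributed_integrable[OF s(2), of "\<lambda>x. x"] integrable_normal_moment_nz_1[OF s(1), of 0] by simp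
    then show ?thesis using normal_distributed_expectation[OF s] by simp
  next
    case False
    then have "functional h \<omega> = 0" if "\<omega> \<in> space P" for \<omega> using that by (auto simp: space_P)
    then show ?thesis
      using Bochner_Integration.integrable_cong[of P P "functional h" "\<lambda>_. 0 :: real"]
        Bochner_Integration.integral_cong[of P P "functional h" "\<lambda>_. 0 :: real"] by simp
  qed
  then show "integrable P (functional h)" "(LINT \<omega>|P. functional h \<omega>) = 0" by auto
qed

lemma measurable_P_iff: "measurable P N = measurable (restrict_space borel C01_0) N"
  by (rule measurable_cong_sets[OF sets_P refl])

lemma measurable_shift:
  assumes "x \<in> C01_0"
  shows "(\<lambda>\<omega>. \<omega> + x) \<in> measurable P P"
  unfolding measurable_P_iff measurable_cong_sets[OF refl sets_P]
proof (rule measurable_restrict_space2)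
  show "(\<lambda>\<omega>. \<omega> + x) \<in> space (restrict_space borel C01_0) \<rightarrow> C01_0"
    using assms subspace_add[OF subspace_C01_0] by (auto simp: space_restrict_space)
  show "(\<lambda>\<omega>. \<omega> + x) \<in> measurable (restrict_space borel C01_0) borel"
    by (intro borel_measurable_continuous_on_restrict continuous_intros)
qed

text \<open>Both sides have the same characteristic function along every functional
  \<open>\<eta>\<close>: \<open>inner h g\<close> appears once as the displacement
  \<open>\<eta> (\<iota> h)\<close> and once as the cross term when the exponents are squared.
  Agreement on cylinder sets then determines the measures.\<close>

theorem cameron_martin_shift:
  assumes h: "h \<in> riesz_range"
  shows "distr P P (\<lambda>\<omega>. \<omega> + \<iota> h) = density P (\<lambda>\<omega>. ennreal (exp (functional h \<omega> - (norm h)\<^sup>2 / 2)))" (is "?M = ?N")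
proof -
  define E where "E = {{\<omega>\<in>C01_0. \<forall>p\<in>I. apply_bcontfun \<omega> (fst p) $ snd p \<in> B p} | I B. finite I \<and> (\<forall>p::real \<times> 'd. B p \<in> sets borel)}"
  note gen = borel_C01_0_generator[where 'd='d, folded E_def]
  have shift: "(\<lambda>\<omega>. \<omega> + \<iota> h) \<in> measurable P P" by (rule measurable_shift[OF iota_in_C01_0])
  have [measurable]: "functional h \<in> borel_measurable P" by (rule functional_measurable[OF h])
  have fM: "finite_measure ?M"
    by (rule prob_space.finite_measure, rule prob_space_distr[OF shift])
  have "(\<integral>\<^sup>+\<omega>. ennreal (exp (functional h \<omega> - (norm h)\<^sup>2 / 2)) \<partial>P) < \<infinity>"
    using exp_functional_real(1)[OF h]
    by (subst nn_integral_eq_integral) (auto simp: exp_diff)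
  then have fN: "finite_measure ?N"
    by (intro finite_measureI) (simp add: emeasure_density cong: nn_integral_cong_simp)
  have coord: "(\<lambda>\<omega>. apply_bcontfun \<omega> t $ i) \<in> borel_measurable P" for t i
    by (rule borel_measurable_dual[OF eval_dual])
  show ?thesis
  proof (rule measure_eqI_generator_eq[OF gen(1) gen(2), of _ _ "\<lambda>_. C01_0"])
    show "sets ?M = sigma_sets C01_0 E" "sets ?N = sigma_sets C01_0 E" using sets_P gen(3) by simp_all
    show "range (\<lambda>_::nat. C01_0) \<subseteq> E" using gen(4) by simp
    show "emeasure ?M C01_0 \<noteq> \<infinity>" by (simp add: finite_measure.emeasure_finite[OF fM])
    fix A assume "A \<in> E"
    then obtain I B where A: "A = {\<omega>\<in>C01_0. \<forall>p\<in>I. apply_bcontfun \<omega> (fst p) $ snd p \<in> B p}" "finite I" "\<forall>p. B p \<in> sets borel"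
      unfolding E_def by blast
    have "measure ?M {\<omega>\<in>space ?M. \<forall>p\<in>I. apply_bcontfun \<omega> (fst p) $ snd p \<in> B p} =
        measure ?N {\<omega>\<in>space ?N. \<forall>p\<in>I. apply_bcontfun \<omega> (fst p) $ snd p \<in> B p}"
    proof (rule char_uniqueness_finite[OF A(2) fM fN])
      show "(\<lambda>\<omega>. apply_bcontfun \<omega> (fst p) $ snd p) \<in> borel_measurable ?M" for p using coord by simp
      show "(\<lambda>\<omega>. apply_bcontfun \<omega> (fst p) $ snd p) \<in> borel_measurable ?N" for p using coord by simp
      show "B p \<in> sets borel" for p using A(3) by (rule spec)
      fix \<xi> :: "real \<times> 'd \<Rightarrow> real"
      define \<eta> where "\<eta> \<omega> = (\<Sum>p\<in>I. \<xi> p * (apply_bcontfun \<omega> (fst p) $ snd p))" for \<omega>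
      have \<eta>: "\<eta> \<in> dual_C01_0" unfolding \<eta>_def[abs_def] by (rule dual_sum) (rule eval_dual)
      note [measurable] = borel_measurable_dual[OF \<eta>]
      define g where "g = riesz \<iota> \<eta>"
      have g: "g \<in> riesz_range" unfolding g_def riesz_range_def using \<eta> by blast
      have \<eta>g: "\<eta> \<omega> = functional g \<omega>" if "\<omega> \<in> space P" for \<omega>
      proof (rule dual_eqI[OF \<eta> functional_dual[OF g]])
        show "\<eta> (\<iota> k) = functional g (\<iota> k)" for k
          unfolding functional_iota[OF g] unfolding g_def inner_riesz[OF \<eta>] ..
      qed (use that in \<open>simp add: space_P\<close>)
      have "(CLINT \<omega>|?M. iexp (\<eta> \<omega>)) = (CLINT \<omega>|P. iexp (\<eta> (\<omega> + \<iota> h)))"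
        by (rule integral_distr[OF shift]) measurable
      also have "\<dots> = (CLINT \<omega>|P. iexp (inner h g) * iexp (\<eta> \<omega>))"
        by (rule Bochner_Integration.integral_cong)
           (simp_all add: dual_add[OF \<eta>] space_P iota_in_C01_0 g_def inner_riesz[OF \<eta>] algebra_simps exp_add)
      also have "\<dots> = iexp (inner h g) * complex_of_real (exp (- (1/2) * (norm g)\<^sup>2))"
        using char_dual[OF \<eta>] by (simp add: g_def)
      finally have L: "(CLINT \<omega>|?M. iexp (\<eta> \<omega>)) = iexp (inner h g) * complex_of_real (exp (- (1/2) * (norm g)\<^sup>2))" .
      have "(CLINT \<omega>|?N. iexp (\<eta> \<omega>)) = (CLINT \<omega>|P. exp (functional h \<omega> - (norm h)\<^sup>2 / 2) *\<^sub>R iexp (\<eta> \<omega>))"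
        by (rule integral_density) auto
      also have "\<dots> = (CLINT \<omega>|P. complex_of_real (exp (- (norm h)\<^sup>2 / 2)) * exp (complex_of_real (functional h \<omega>) + \<i> * functional g \<omega>))"
      proof (rule Bochner_Integration.integral_cong[OF refl])
        fix \<omega> assume w: "\<omega> \<in> space P"
        have "exp (functional h \<omega> - (norm h)\<^sup>2 / 2) = exp (- (norm h)\<^sup>2 / 2) * exp (functional h \<omega>)"
          by (simp flip: exp_add)
        then show "exp (functional h \<omega> - (norm h)\<^sup>2 / 2) *\<^sub>R iexp (\<eta> \<omega>) =
            complex_of_real (exp (- (norm h)\<^sup>2 / 2)) * exp (complex_of_real (functional h \<omega>) + \<i> * functional g \<omega>)"
          by (simp only: \<eta>g[OF w] scaleR_conv_of_real of_real_mult exp_add exp_of_real mult.assoc)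
      qed
      also have "\<dots> = complex_of_real (exp (- (norm h)\<^sup>2 / 2)) * exp (complex_of_real (((norm h)\<^sup>2 - (norm g)\<^sup>2) / 2) + \<i> * inner h g)"
        by (simp only: integral_mult_right_zero exp_functional(2)[OF h g])
      also have "\<dots> = (complex_of_real (exp (- (norm h)\<^sup>2 / 2)) * complex_of_real (exp (((norm h)\<^sup>2 - (norm g)\<^sup>2) / 2))) * iexp (inner h g)"
        by (simp only: exp_add exp_of_real mult.assoc)
      also have "complex_of_real (exp (- (norm h)\<^sup>2 / 2)) * complex_of_real (exp (((norm h)\<^sup>2 - (norm g)\<^sup>2) / 2)) =
          complex_of_real (exp (- (1/2) * (norm g)\<^sup>2))"
        unfolding of_real_mult[symmetric] exp_add[symmetric] by (simp add: field_simps)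
      finally have R: "(CLINT \<omega>|?N. iexp (\<eta> \<omega>)) = complex_of_real (exp (- (1/2) * (norm g)\<^sup>2)) * iexp (inner h g)" .
      show "(CLINT \<omega>|?M. iexp (\<Sum>p\<in>I. \<xi> p * (apply_bcontfun \<omega> (fst p) $ snd p))) =
          (CLINT \<omega>|?N. iexp (\<Sum>p\<in>I. \<xi> p * (apply_bcontfun \<omega> (fst p) $ snd p)))"
        using L R unfolding \<eta>_def by (simp only: mult.commute)
    qed
    then show "emeasure ?M A = emeasure ?N A"
      unfolding A(1) by (simp add: space_P finite_measure.emeasure_eq_measure[OF fM] finite_measure.emeasure_eq_measure[OF fN])
  qed auto
qed

text \<open>Writing the exponential moment under the shifted noise gives \<open>exp X\<close> with
  \<open>X = G (\<omega> + \<iota> h) - functional h \<omega> - (norm h)\<^sup>2 / 2\<close>. Jensen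
  applies, and the linear term has mean zero.\<close>

lemma log_exp_lower_bound:
  assumes h: "h \<in> riesz_range" and G: "G \<in> borel_measurable P" and K: "\<And>\<omega>. \<omega> \<in> space P \<Longrightarrow> \<bar>G \<omega>\<bar> \<le> K"
  shows "(LINT \<omega>|P. G (\<omega> + \<iota> h)) - (norm h)\<^sup>2 / 2 \<le> ln (LINT \<omega>|P. exp (G \<omega>))"
proof -
  note [measurable] = G functional_measurable[OF h]
  have shift[measurable]: "(\<lambda>\<omega>. \<omega> + \<iota> h) \<in> measurable P P" by (rule measurable_shift[OF iota_in_C01_0])
  \<comment> \<open>\<open>exp G\<close> divided by the density of the shifted law, so that
    evaluating \<open>H\<close> at the shifted path undoes the shift in the mean.\<close>
  define H where "H \<omega> = exp (G \<omega> - functional h \<omega> + (norm h)\<^sup>2 / 2)" for \<omega>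
  have Hm[measurable]: "H \<in> borel_measurable P" unfolding H_def[abs_def] by measurable
  define X where "X \<omega> = G (\<omega> + \<iota> h) - functional h \<omega> - (norm h)\<^sup>2 / 2" for \<omega>
  have K': "- K \<le> G \<omega>" "G \<omega> \<le> K" if "\<omega> \<in> space P" for \<omega> using K[OF that] by auto
  have GK: "integrable P G" by (rule integrable_const_bound[of _ K]) (use K in auto)
  have GS: "integrable P (\<lambda>\<omega>. G (\<omega> + \<iota> h))"
    by (rule integrable_const_bound[of _ K]) (use K measurable_space[OF shift] in auto)
  have eGi: "integrable P (\<lambda>\<omega>. exp (G \<omega>))"
    by (rule integrable_const_bound[of _ "exp K"]) (use K' in auto)
  have "(LINT \<omega>|P. exp (G \<omega>)) \<ge> (LINT \<omega>|P. exp (- K))"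
    by (rule integral_mono[OF _ eGi]) (use K' in auto)
  then have pos: "(LINT \<omega>|P. exp (G \<omega>)) > 0" by (simp add: prob_space) (meson exp_gt_zero less_le_trans)
  have "(LINT \<omega>|P. H (\<omega> + \<iota> h)) = integral\<^sup>L (distr P P (\<lambda>\<omega>. \<omega> + \<iota> h)) H"
    by (rule integral_distr[OF shift Hm, symmetric])
  also have "\<dots> = (LINT \<omega>|P. exp (functional h \<omega> - (norm h)\<^sup>2 / 2) *\<^sub>R H \<omega>)"
    unfolding cameron_martin_shift[OF h] by (rule integral_density) auto
  also have "\<dots> = (LINT \<omega>|P. exp (G \<omega>))"
    by (rule Bochner_Integration.integral_cong) (simp_all add: H_def flip: exp_add)
  finally have I1: "(LINT \<omega>|P. H (\<omega> + \<iota> h)) = (LINT \<omega>|P. exp (G \<omega>))" .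
  have HX: "H (\<omega> + \<iota> h) = exp (X \<omega>)" if "\<omega> \<in> space P" for \<omega>
    using that unfolding H_def X_def
    by (simp add: space_P dual_add[OF functional_dual[OF h]] iota_in_C01_0 functional_iota[OF h] power2_norm_eq_inner)
  have I2: "(LINT \<omega>|P. exp (X \<omega>)) = (LINT \<omega>|P. exp (G \<omega>))"
    unfolding I1[symmetric] by (rule Bochner_Integration.integral_cong[OF refl HX[symmetric]])
  have iX: "integrable P (\<lambda>\<omega>. exp (X \<omega>))"
    using I2 pos not_integrable_integral_eq by fastforce
  have X: "integrable P X" unfolding X_def[abs_def]
    using GS functional_expectation(1)[OF h] by (intro Bochner_Integration.integrable_diff) auto
  define m where "m = (LINT \<omega>|P. G (\<omega> + \<iota> h)) - (norm h)\<^sup>2 / 2"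
  have EX: "(LINT \<omega>|P. X \<omega>) = m"
    unfolding X_def m_def using GS functional_expectation[OF h] by (simp add: prob_space)
  \<comment> \<open>Jensen in tangent form: \<open>exp\<close> lies above its tangent line at the
    mean \<open>m\<close>, and the tangent integrates to \<open>exp m\<close>.\<close>
  have "exp m = (LINT \<omega>|P. exp m * (1 - m) + exp m * X \<omega>)"
    using X EX by (simp add: prob_space algebra_simps)
  also have "\<dots> \<le> (LINT \<omega>|P. exp (X \<omega>))"
  proof (rule integral_mono[OF _ iX])
    show "integrable P (\<lambda>\<omega>. exp m * (1 - m) + exp m * X \<omega>)" using X by simp
    fix \<omega>
    have "exp m * (1 + (X \<omega> - m)) \<le> exp m * exp (X \<omega> - m)" by (intro mult_left_mono exp_ge_add_one_self) auto
    then show "exp m * (1 - m) + exp m * X \<omega> \<le> exp (X \<omega>)" by (simp add: algebra_simps flip: exp_add)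
  qed
  finally have "exp m \<le> (LINT \<omega>|P. exp (G \<omega>))" unfolding I2 .
  then have "m \<le> ln (LINT \<omega>|P. exp (G \<omega>))" using pos by (simp add: ln_ge_iff)
  then show ?thesis by (simp add: m_def)
qed

end

section \<open>A Gaussian exponential inequality\<close>

text \<open>Applied to the standard normal density and to its tilt, this supplies the regularity of
  the transport map between them.\<close>

lemma density_cdf:
  fixes f :: "real \<Rightarrow> real"
  assumes cont: "continuous_on UNIV f" and pos: "\<And>x. f x > 0" and int: "integrable lborel f" and one: "(LINT x|lborel. f x) = 1"
  defines "D \<equiv> density lborel (\<lambda>x. ennreal (f x))"
  shows "real_distribution D"
    and "((cdf D) has_real_derivative f x) (at x)"
    and "strict_mono (cdf D)"
    and "\<And>p. 0 < p \<Longrightarrow> p < 1 \<Longrightarrow> \<exists>y. cdf D y = p"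
    and "0 < cdf D x" "cdf D x < 1"
proof -
  have fm[measurable]: "f \<in> borel_measurable borel" by (rule borel_measurable_continuous_onI[OF cont])
  have "emeasure D (space D) = 1"
    unfolding D_def using int one pos
    by (simp add: emeasure_density nn_integral_eq_integral less_imp_le)
  then have prob: "prob_space D" by (rule prob_spaceI)
  show rd: "real_distribution D"
    unfolding real_distribution_def real_distribution_axioms_def using prob by (simp add: D_def)
  interpret real_distribution D by (rule rd)
  have meas: "measure D A = (LINT t|lborel. f t * indicator A t)" if "A \<in> sets borel" for A
  proof -
    have "measure D A = (LINT t|D. indicator A t)" using that by (simp add: D_def)
    also have "\<dots> = (LINT t|lborel. f t *\<^sub>R indicator A t)"
      unfolding D_def by (rule integral_density) (use pos that in \<open>auto intro: less_imp_le\<close>)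
    finally show ?thesis by simp
  qed
  have incr: "cdf D b = cdf D a + integral {a..b} f" if "a \<le> b" for a b
  proof -
    have "cdf D b - cdf D a = measure D {a<..b}" using that by (cases "a = b") (simp_all add: cdf_diff_eq)
    also have "\<dots> = (LINT t|lborel. indicator {a..b} t *\<^sub>R f t)"
      unfolding meas[OF greaterThanAtMost_borel]
      by (rule integral_cong_AE) (use AE_lborel_singleton[of a] in \<open>auto simp: indicator_def elim!: eventually_mono\<close>)
    also have "\<dots> = integral {a..b} f"
      unfolding set_lebesgue_integral_def[symmetric]
      by (rule set_borel_integral_eq_integral)
         (unfold set_integrable_def, rule integrable_mult_indicator[OF _ int], simp)
    finally show ?thesis by simp
  qed
  show deriv: "((cdf D) has_real_derivative f x) (at x)" for x
  proof -
    have "((\<lambda>u. integral {x - 1..u} f) has_real_derivative f x) (at x within {x - 1..x + 1})"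
      by (rule integral_has_real_derivative[OF continuous_on_subset[OF cont]]) auto
    then have "((\<lambda>u. cdf D (x - 1) + integral {x - 1..u} f) has_real_derivative f x) (at x within {x - 1..x + 1})"
      by (auto intro!: derivative_eq_intros)
    then have "((\<lambda>u. cdf D (x - 1) + integral {x - 1..u} f) has_real_derivative f x) (at x)"
      by (simp add: at_within_Icc_at)
    then show ?thesis
    proof (rule has_field_derivative_transform_within_open[of _ _ _ "{x - 1<..}"])
      show "cdf D (x - 1) + integral {x - 1..u} f = cdf D u" if "u \<in> {x - 1<..}" for u
        using incr[of "x - 1" u] that by simp
    qed auto
  qed
  show sm: "strict_mono (cdf D)"
  proof (rule strict_monoI)
    fix a b :: real assume "a < b"
    then show "cdf D a < cdf D b"
      by (rule DERIV_pos_imp_increasing) (use deriv pos in blast)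
  qed
  have ct: "isCont (cdf D) x" for x using deriv by (rule DERIV_isCont)
  show ex: "\<exists>y. cdf D y = p" if p: "0 < p" "p < 1" for p
  proof -
    have "\<forall>\<^sub>F x in at_bot. cdf D x < p" by (rule order_tendstoD(2)[OF cdf_lim_at_bot p(1)])
    then obtain a where a: "cdf D a < p" by (auto simp: eventually_at_bot_linorder)
    have "\<forall>\<^sub>F x in at_top. p < cdf D x" by (rule order_tendstoD(1)[OF cdf_lim_at_top_prob p(2)])
    then obtain b where b: "p < cdf D b" by (auto simp: eventually_at_top_linorder)
    have "a < b" using a b sm by (meson less_trans strict_mono_less)
    then obtain y where "a \<le> y" "y \<le> b" "cdf D y = p"
      using IVT[of "cdf D" a p b] a b ct by auto
    then show ?thesis by blast
  qed
  have "cdf D (x - 1) < cdf D x" "cdf D x < cdf D (x + 1)" using sm by (auto simp: strict_mono_def)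
  then show "0 < cdf D x" "cdf D x < 1" using cdf_nonneg[of "x - 1"] cdf_bounded_prob[of "x + 1"] by linarith+
qed

text \<open>Moving a point of a half-line further away from the origin by \<open>c\<close> adds at
  least \<open>c\<^sup>2\<close> to its square, since the cross term is nonnegative.\<close>

lemma std_normal_tail_shift:
  assumes c: "c \<ge> 0"
  shows "x \<ge> 0 \<Longrightarrow> measure std_normal_distribution {x + c<..} \<le> exp (- c\<^sup>2 / 2) * measure std_normal_distribution {x<..}"
    and "x \<le> 0 \<Longrightarrow> measure std_normal_distribution {..x - c} \<le> exp (- c\<^sup>2 / 2) * measure std_normal_distribution {..x}"
proof -
  have meas: "measure std_normal_distribution A = (LINT t|lborel. std_normal_density t * indicator A t)" if "A \<in> sets borel" for A
  proof -
    have "measure std_normal_distribution A = (LINT t|std_normal_distribution. indicator A t)" using that by simp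
    also have "\<dots> = (LINT t|lborel. std_normal_density t *\<^sub>R indicator A t)"
      by (rule integral_density) (use that in auto)
    finally show ?thesis by simp
  qed
  have ii: "integrable lborel (\<lambda>t. std_normal_density (d + t) * indicator A t)" if [measurable]: "A \<in> sets borel" for A d
  proof (rule Bochner_Integration.integrable_bound)
    have "integrable lborel (\<lambda>t. std_normal_density (d + 1 * t))"
      by (subst lborel_integrable_real_affine_iff) auto
    then show "integrable lborel (\<lambda>t. std_normal_density (d + t))" by simp
  qed (auto simp: indicator_def)
  have gen: "measure std_normal_distribution B \<le> exp (- c\<^sup>2 / 2) * measure std_normal_distribution A"
    if AB[measurable]: "A \<in> sets borel" "B \<in> sets borel" and sh: "\<And>t. d + t \<in> B \<longleftrightarrow> t \<in> A"
      and d: "\<bar>d\<bar> = c" "\<And>t. t \<in> A \<Longrightarrow> d * t \<ge> 0" for A B d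
  proof -
    have "measure std_normal_distribution B = \<bar>1\<bar> *\<^sub>R (LINT t|lborel. std_normal_density (d + 1 * t) * indicator B (d + 1 * t))"
      unfolding meas[OF AB(2)] by (rule lborel_integral_real_affine) simp
    also have "\<dots> = (LINT t|lborel. std_normal_density (d + t) * indicator A t)"
      by (simp add: indicator_def sh)
    also have "\<dots> \<le> (LINT t|lborel. exp (- c\<^sup>2 / 2) * (std_normal_density (0 + t) * indicator A t))"
    proof (rule integral_mono[OF ii[OF AB(1)] integrable_mult_right[OF ii[OF AB(1)]]])
      fix t
      have "std_normal_density (d + t) \<le> exp (- c\<^sup>2 / 2) * std_normal_density t" if "t \<in> A"
      proof -
        have "d\<^sup>2 = c\<^sup>2" using d(1) by (metis power2_abs)
        then have "- (d + t)\<^sup>2 / 2 \<le> - c\<^sup>2 / 2 + - t\<^sup>2 / 2" using d(2)[OF that] by (simp add: power2_sum field_simps)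
        then have "exp (- (d + t)\<^sup>2 / 2) \<le> exp (- c\<^sup>2 / 2) * exp (- t\<^sup>2 / 2)" unfolding exp_add[symmetric] by simp
        then have "1 / sqrt (2 * pi) * exp (- (d + t)\<^sup>2 / 2) \<le> 1 / sqrt (2 * pi) * (exp (- c\<^sup>2 / 2) * exp (- t\<^sup>2 / 2))"
          by (rule mult_left_mono) simp
        then show ?thesis by (simp add: normal_density_def mult_ac)
      qed
      then show "std_normal_density (d + t) * indicator A t \<le> exp (- c\<^sup>2 / 2) * (std_normal_density (0 + t) * indicator A t)"
        by (simp add: indicator_def)
    qed
    also have "\<dots> = exp (- c\<^sup>2 / 2) * measure std_normal_distribution A" by (simp add: meas)
    finally show ?thesis .
  qed
  show "measure std_normal_distribution {x + c<..} \<le> exp (- c\<^sup>2 / 2) * measure std_normal_distribution {x<..}" if "x \<ge> 0"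
    by (rule gen[of _ _ c]) (use c that in auto)
  show "measure std_normal_distribution {..x - c} \<le> exp (- c\<^sup>2 / 2) * measure std_normal_distribution {..x}" if "x \<le> 0"
    by (rule gen[of _ _ "- c"]) (use c that in \<open>auto simp: mult_nonneg_nonpos\<close>)
qed

text \<open>With \<open>T\<close> the increasing transport of \<open>N(0,1)\<close> to its tilt by \<open>exp g\<close>, the change of variables gives
  \<open>ln Z = (g \<circ> T - (T - id)\<^sup>2 / 2) - x (T - id) + ln T'\<close>, and \<open>ln T' \<le> T' - 1\<close> makes the last two terms
  bounded by \<open>((T - id) \<phi>)' / \<phi>\<close>, which integrates to zero.\<close>

lemma log_exp_integral_le_sup_convolution_1d:
  fixes g m :: "real \<Rightarrow> real"
  assumes g: "continuous_on UNIV g" "\<And>x. \<bar>g x\<bar> \<le> K" and m[measurable]: "m \<in> borel_measurable borel" and mK: "\<And>x. \<bar>m x\<bar> \<le> K'"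
    and gm: "\<And>x a. g (x + a) - a\<^sup>2 / 2 \<le> m x"
  shows "ln (LINT x|std_normal_distribution. exp (g x)) \<le> (LINT x|std_normal_distribution. m x)"
proof -
  let ?\<phi> = std_normal_density
  have \<phi>c: "continuous_on UNIV ?\<phi>" unfolding normal_density_def by (intro continuous_intros) auto
  have \<phi>pos: "?\<phi> x > 0" for x by (rule normal_density_pos) simp
  have gm'[measurable]: "g \<in> borel_measurable borel" by (rule borel_measurable_continuous_onI[OF g(1)])
  have gK: "- K \<le> g x" "g x \<le> K" for x using g(2)[of x] by auto
  define Z where "Z = (LINT x|std_normal_distribution. exp (g x))"
  have ie: "integrable std_normal_distribution (\<lambda>x. exp (g x))"
    by (rule std_normal.integrable_const_bound[of _ "exp K"]) (use gK in auto)
  have "(LINT x|std_normal_distribution. exp (- K)) \<le> Z"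
    unfolding Z_def by (rule integral_mono[OF _ ie]) (use gK in auto)
  then have ZK: "exp (- K) \<le> Z" by (simp add: std_normal.prob_space[simplified])
  then have Z: "Z > 0" by (meson exp_gt_zero less_le_trans)
  define f where "f x = exp (g x) / Z * ?\<phi> x" for x
  have Zl: "Z = (LINT x|lborel. ?\<phi> x * exp (g x))"
    unfolding Z_def by (subst integral_density) auto
  have il: "integrable lborel (\<lambda>x. ?\<phi> x * exp (g x))"
    using ie by (subst (asm) integrable_density) auto
  have fpos: "f x > 0" for x unfolding f_def using Z \<phi>pos by simp
  have fc: "continuous_on UNIV f" unfolding f_def using Z by (intro continuous_intros g(1) \<phi>c) auto
  have fi: "integrable lborel f" using il Z unfolding f_def by (simp add: mult.commute)
  have f1: "(LINT x|lborel. f x) = 1" unfolding f_def using Zl Z by (simp add: mult.commute)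
  define D where "D = density lborel (\<lambda>x. ennreal (f x))"
  note d = density_cdf[OF fc fpos fi f1, folded D_def]
  interpret D: real_distribution D by (rule d(1))
  have \<phi>i: "integrable lborel ?\<phi>" "(LINT x|lborel. ?\<phi> x) = 1" by simp_all
  note n = density_cdf[OF \<phi>c \<phi>pos \<phi>i]
  let ?F = "cdf std_normal_distribution" and ?G = "cdf D"
  have injG: "inj ?G" using d(3) by (rule strict_mono_imp_inj_on)
  define T where "T x = inv ?G (?F x)" for x
  have GT: "?G (T x) = ?F x" for x
    unfolding T_def by (rule f_inv_into_f) (metis d(4)[OF n(5,6)[of x]] rangeI)
  define T' where "T' x = ?\<phi> x / f (T x)" for x
  have invG: "isCont (inv ?G) (?G y)" for y
    by (rule isCont_inverse_function[of 1]) (auto simp: inv_f_f[OF injG] intro: DERIV_isCont[OF d(2)])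
  have DinvG: "(inv ?G has_real_derivative inverse (f y)) (at (?G y))" for y
  proof (rule DERIV_inverse_function[where f = ?G and a = 0 and b = 1])
    show "(?G has_real_derivative f y) (at (inv ?G (?G y)))" using d(2) by (simp add: inv_f_f[OF injG])
    show "f y \<noteq> 0" using fpos[of y] by simp
    show "?G (inv ?G p) = p" if "0 < p" "p < 1" for p by (rule f_inv_into_f) (metis d(4)[OF that] rangeI)
  qed (use d(5,6) invG in auto)
  have DT: "(T has_real_derivative T' x) (at x)" for x
  proof -
    have "(inv ?G has_real_derivative inverse (f (T x))) (at (?F x))" using DinvG[of "T x"] by (simp add: GT)
    from DERIV_chain2[OF this n(2)] show ?thesis unfolding T_def[symmetric] T'_def by (simp add: divide_inverse mult.commute)
  qed
  have T'pos: "T' x > 0" for x unfolding T'_def using fpos \<phi>pos by simp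
  have Tc: "isCont T x" for x by (rule DERIV_isCont[OF DT])
  have fc': "isCont f x" and \<phi>c': "isCont ?\<phi> x" for x using fc \<phi>c by (auto simp: continuous_on_eq_continuous_at)
  have T'c: "isCont T' x" for x
    unfolding T'_def using fpos[of "T x"] by (intro continuous_intros \<phi>c' isCont_o2[OF Tc fc']) auto
  define R where "R x = (T' x - 1) * ?\<phi> x - x * (T x - x) * ?\<phi> x" for x
  have lnZ: "ln Z * ?\<phi> x \<le> m x * ?\<phi> x + R x" for x
  proof -
    have "ln (T' x) = ln (?\<phi> x) - (g (T x) - ln Z + ln (?\<phi> (T x)))"
      unfolding T'_def f_def using Z \<phi>pos[of x] \<phi>pos[of "T x"]
      by (simp add: ln_div ln_mult)
    moreover have "ln (?\<phi> y) = - ln (sqrt (2 * pi)) - y\<^sup>2 / 2" for y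
      by (simp add: normal_density_def ln_div ln_mult)
    ultimately have "ln Z = (g (x + (T x - x)) - (T x - x)\<^sup>2 / 2) - x * (T x - x) + ln (T' x)"
      by (simp add: power2_eq_square algebra_simps add_divide_distrib diff_divide_distrib)
    also have "\<dots> \<le> m x - x * (T x - x) + (T' x - 1)"
      using gm[of x "T x - x"] ln_le_minus_one[OF T'pos[of x]] by linarith
    finally have "ln Z * ?\<phi> x \<le> (m x - x * (T x - x) + (T' x - 1)) * ?\<phi> x"
      using \<phi>pos[of x] by (intro mult_right_mono) auto
    then show ?thesis unfolding R_def by (simp add: algebra_simps)
  qed
  have D\<phi>: "(?\<phi> has_real_derivative - x * ?\<phi> x) (at x)" for x
    unfolding normal_density_def by (auto intro!: derivative_eq_intros simp: field_simps)
  have DR: "((\<lambda>x. (T x - x) * ?\<phi> x) has_real_derivative R x) (at x)" for x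
    unfolding R_def by (rule derivative_eq_intros DT D\<phi> refl)+ (simp add: algebra_simps)
  have Rc: "isCont R x" for x
    unfolding R_def by (intro continuous_intros T'c \<phi>c' Tc)
  \<comment> \<open>The tilt by \<open>exp g\<close> lies below \<open>exp K\<close> and its
    normalisation \<open>Z\<close> above \<open>exp (- K)\<close>, so the densities differ by a
    factor of at most \<open>exp (2 * K)\<close>.\<close>
  have comp: "measure D A \<le> exp (2 * K) * measure std_normal_distribution A" if [measurable]: "A \<in> sets borel" for A
  proof -
    have "measure D A = (LINT t|D. indicator A t)" using that by (simp add: D_def)
    also have "\<dots> = (LINT t|lborel. f t *\<^sub>R indicator A t)"
      unfolding D_def using fc by (intro integral_density) (auto intro: less_imp_le fpos borel_measurable_continuous_onI)
    also have "\<dots> \<le> (LINT t|lborel. exp (2 * K) * (?\<phi> t * indicator A t))"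
    proof (rule integral_mono)
      show "integrable lborel (\<lambda>t. f t *\<^sub>R (indicator A t :: real))"
        by (rule Bochner_Integration.integrable_bound[OF fi]) (use fi in \<open>auto simp: indicator_def\<close>)
      have "integrable lborel (\<lambda>t. ?\<phi> t * indicator A t)"
        by (rule Bochner_Integration.integrable_bound[OF \<phi>i(1)]) (auto simp: indicator_def)
      then show "integrable lborel (\<lambda>t. exp (2 * K) * (?\<phi> t * indicator A t))" by simp
      fix t
      have "exp (g t) \<le> exp (2 * K) * exp (- K)" using gK[of t] by (simp flip: exp_add)
      also have "\<dots> \<le> exp (2 * K) * Z" using ZK by simp
      finally have "exp (g t) / Z \<le> exp (2 * K)" using Z by (simp add: divide_le_eq)
      then have "f t \<le> exp (2 * K) * ?\<phi> t" unfolding f_def by (intro mult_right_mono) auto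
      then show "f t *\<^sub>R indicator A t \<le> exp (2 * K) * (?\<phi> t * indicator A t)" by (simp add: indicator_def)
    qed
    also have "\<dots> = exp (2 * K) * measure std_normal_distribution A"
    proof -
      have "measure std_normal_distribution A = (LINT t|std_normal_distribution. indicator A t)" by simp
      also have "\<dots> = (LINT t|lborel. ?\<phi> t *\<^sub>R indicator A t)" by (rule integral_density) auto
      finally show ?thesis by simp
    qed
    finally show ?thesis .
  qed
  have K0: "K \<ge> 0" using g(2)[of 0] abs_ge_zero order_trans by blast
  \<comment> \<open>With this value \<open>exp (- c\<^sup>2 / 2)\<close> equals
    \<open>exp (- (2 * K + 1))\<close>, which beats the density ratio \<open>exp (2 * K)\<close>
    from \<open>comp\<close>.\<close>
  define c where "c = sqrt (4 * K + 2)"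
  have c: "c \<ge> 0" "exp (2 * K) * exp (- c\<^sup>2 / 2) < 1"
    unfolding c_def using K0 by (simp_all add: field_simps flip: exp_add)
  \<comment> \<open>Transport preserves tails. If \<open>T x\<close> exceeded \<open>x + c\<close>,
    the tail beyond \<open>T x\<close> would be smaller than the normal tail beyond \<open>x\<close>
    by more than the density ratio can make up. This bound and its mirror image \<open>lo\<close>
    control the boundary terms at infinity from above.\<close>
  have up: "T x \<le> x + c" if x: "x \<ge> 0" for x
  proof (rule ccontr)
    assume "\<not> T x \<le> x + c"
    then have "measure std_normal_distribution {T x<..} \<le> measure std_normal_distribution {x + c<..}"
      by (intro std_normal.finite_measure_mono) auto
    also have "\<dots> \<le> exp (- c\<^sup>2 / 2) * measure std_normal_distribution {x<..}"
      by (rule std_normal_tail_shift(1)[OF c(1) x])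
    finally have *: "measure std_normal_distribution {T x<..} \<le> exp (- c\<^sup>2 / 2) * measure std_normal_distribution {x<..}" .
    have cN: "measure std_normal_distribution {y<..} = 1 - ?F y" for y
      using std_normal.prob_compl[of "{..y}"] by (simp add: cdf_def Compl_eq_Diff_UNIV[symmetric])
    have cD: "measure D {y<..} = 1 - ?G y" for y
      using D.prob_compl[of "{..y}"] by (simp add: cdf_def Compl_eq_Diff_UNIV[symmetric])
    have "measure std_normal_distribution {x<..} = measure D {T x<..}" by (simp add: cN cD GT)
    also have "\<dots> \<le> exp (2 * K) * measure std_normal_distribution {T x<..}" by (rule comp) simp
    also have "\<dots> \<le> exp (2 * K) * (exp (- c\<^sup>2 / 2) * measure std_normal_distribution {x<..})" using * by simp
    finally have "measure std_normal_distribution {x<..} \<le> (exp (2 * K) * exp (- c\<^sup>2 / 2)) * measure std_normal_distribution {x<..}" by (simp add: mult.assoc)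
    moreover have "measure std_normal_distribution {x<..} > 0" using n(6)[of x] by (simp add: cN)
    ultimately show False using c(2) by (simp add: mult_le_cancel_right)
  qed
  have lo: "T x \<ge> x - c" if x: "x \<le> 0" for x
  proof (rule ccontr)
    assume "\<not> T x \<ge> x - c"
    then have "measure std_normal_distribution {..T x} \<le> measure std_normal_distribution {..x - c}"
      by (intro std_normal.finite_measure_mono) auto
    also have "\<dots> \<le> exp (- c\<^sup>2 / 2) * measure std_normal_distribution {..x}"
      by (rule std_normal_tail_shift(2)[OF c(1) x])
    finally have *: "measure std_normal_distribution {..T x} \<le> exp (- c\<^sup>2 / 2) * measure std_normal_distribution {..x}" .
    have "measure std_normal_distribution {..x} = measure D {..T x}" using GT[of x] by (simp add: cdf_def)
    also have "\<dots> \<le> exp (2 * K) * measure std_normal_distribution {..T x}" by (rule comp) simp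
    also have "\<dots> \<le> exp (2 * K) * (exp (- c\<^sup>2 / 2) * measure std_normal_distribution {..x})" using * by simp
    finally have "measure std_normal_distribution {..x} \<le> (exp (2 * K) * exp (- c\<^sup>2 / 2)) * measure std_normal_distribution {..x}" by (simp add: mult.assoc)
    moreover have "measure std_normal_distribution {..x} > 0" using n(5)[of x] by (simp add: cdf_def)
    ultimately show False using c(2) by (simp add: mult_le_cancel_right)
  qed
  \<comment> \<open>On a bounded interval \<open>R\<close> has the primitive
    \<open>(T x - x) * std_normal_density x\<close>; by \<open>up\<close> and \<open>lo\<close> its
    two boundary terms contribute at most \<open>2 * c * std_normal_density k\<close>, which
    vanishes as \<open>k\<close> grows.\<close>
  have main: "(LINT x|lborel. ln Z * (?\<phi> x * indicator {- real k..real k} x)) \<le>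
      (LINT x|lborel. m x * (?\<phi> x * indicator {- real k..real k} x)) + 2 * c * ?\<phi> (real k)" for k
  proof -
    have i1: "integrable lborel (\<lambda>x. ?\<phi> x * indicator {- real k..real k} x)"
      by (rule Bochner_Integration.integrable_bound[OF \<phi>i(1)]) (auto simp: indicator_def)
    have i2: "integrable lborel (\<lambda>x. m x * (?\<phi> x * indicator {- real k..real k} x))"
    proof (rule Bochner_Integration.integrable_bound)
      show "integrable lborel (\<lambda>x. K' * ?\<phi> x)" using \<phi>i(1) by simp
      show "AE x in lborel. norm (m x * (?\<phi> x * indicator {- real k..real k} x)) \<le> norm (K' * ?\<phi> x)"
      proof (rule AE_I2)
        fix x
        have "\<bar>m x\<bar> * ?\<phi> x \<le> \<bar>K'\<bar> * ?\<phi> x" using mK[of x] by (intro mult_right_mono) auto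
        then show "norm (m x * (?\<phi> x * indicator {- real k..real k} x)) \<le> norm (K' * ?\<phi> x)"
          by (auto simp: indicator_def abs_mult)
      qed
    qed measurable
    have i3: "integrable lborel (\<lambda>x. R x * indicator {- real k..real k} x)"
      using borel_integrable_atLeastAtMost[of "- real k" "real k" R] Rc by (simp add: mult.commute)
    have "(LINT x|lborel. R x * indicator {- real k..real k} x) =
        (T (real k) - real k) * ?\<phi> (real k) - (T (- real k) - - real k) * ?\<phi> (- real k)"
      by (rule integral_FTC_Icc_real) (use DR Rc in auto)
    also have "\<dots> \<le> c * ?\<phi> (real k) + c * ?\<phi> (real k)"
    proof -
      have "?\<phi> (- real k) = ?\<phi> (real k)" by (simp add: normal_density_def)
      moreover have "(T (real k) - real k) * ?\<phi> (real k) \<le> c * ?\<phi> (real k)"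
        using up[of "real k"] by (intro mult_right_mono) auto
      moreover have "(- (T (- real k) - - real k)) * ?\<phi> (real k) \<le> c * ?\<phi> (real k)"
        using lo[of "- real k"] by (intro mult_right_mono) auto
      ultimately show ?thesis by (simp add: algebra_simps)
    qed
    finally have b: "(LINT x|lborel. R x * indicator {- real k..real k} x) \<le> 2 * c * ?\<phi> (real k)" by simp
    have "(LINT x|lborel. ln Z * (?\<phi> x * indicator {- real k..real k} x)) \<le>
        (LINT x|lborel. m x * (?\<phi> x * indicator {- real k..real k} x) + R x * indicator {- real k..real k} x)"
    proof (rule integral_mono[OF integrable_mult_right[OF i1] Bochner_Integration.integrable_add[OF i2 i3]])
      fix x
      show "ln Z * (?\<phi> x * indicator {- real k..real k} x) \<le> m x * (?\<phi> x * indicator {- real k..real k} x) + R x * indicator {- real k..real k} x"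
        using lnZ[of x] by (auto simp: indicator_def)
    qed
    then show ?thesis using b unfolding Bochner_Integration.integral_add[OF i2 i3] by linarith
  qed
  have lim: "(\<lambda>k. LINT x|lborel. h x * (?\<phi> x * indicator {- real k..real k} x)) \<longlonglongrightarrow> (LINT x|lborel. h x * ?\<phi> x)"
    if [measurable]: "h \<in> borel_measurable borel" and hK: "\<And>x. \<bar>h x\<bar> \<le> H" for h H
  proof (rule integral_dominated_convergence[where w = "\<lambda>x. H * ?\<phi> x"])
    show "integrable lborel (\<lambda>x. H * ?\<phi> x)" using \<phi>i(1) by simp
    show "AE x in lborel. (\<lambda>k. h x * (?\<phi> x * indicator {- real k..real k} x)) \<longlonglongrightarrow> h x * ?\<phi> x"
    proof (rule AE_I2, rule tendsto_eventually)
      fix x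
      obtain k0 :: nat where "\<bar>x\<bar> \<le> real k0" using real_arch_simple by blast
      then show "\<forall>\<^sub>F k in sequentially. h x * (?\<phi> x * indicator {- real k..real k} x) = h x * ?\<phi> x"
        by (intro eventually_sequentiallyI[of k0]) (auto simp: indicator_def abs_le_iff)
    qed
    show "AE x in lborel. norm (h x * (?\<phi> x * indicator {- real k..real k} x)) \<le> H * ?\<phi> x" for k
    proof (rule AE_I2)
      fix x
      have "\<bar>h x\<bar> * ?\<phi> x \<le> H * ?\<phi> x" using hK[of x] by (intro mult_right_mono) auto
      moreover have "0 \<le> H * ?\<phi> x" using hK[of x] by (intro mult_nonneg_nonneg) auto
      ultimately show "norm (h x * (?\<phi> x * indicator {- real k..real k} x)) \<le> H * ?\<phi> x"
        by (auto simp: indicator_def abs_mult)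
    qed
  qed measurable
  have l1: "(\<lambda>k. LINT x|lborel. ln Z * (?\<phi> x * indicator {- real k..real k} x)) \<longlonglongrightarrow> ln Z"
    using lim[of "\<lambda>_. ln Z" "\<bar>ln Z\<bar>"] by simp
  have "(\<lambda>k. ?\<phi> (real k)) \<longlonglongrightarrow> 0"
    unfolding normal_density_def by real_asymp
  then have l2: "(\<lambda>k. (LINT x|lborel. m x * (?\<phi> x * indicator {- real k..real k} x)) + 2 * c * ?\<phi> (real k)) \<longlonglongrightarrow>
      (LINT x|lborel. m x * ?\<phi> x) + 2 * c * 0"
    by (intro tendsto_add lim[OF m mK] tendsto_mult tendsto_const)
  have "ln Z \<le> (LINT x|lborel. m x * ?\<phi> x) + 2 * c * 0"
    by (rule LIMSEQ_le[OF l1 l2]) (use main in auto)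
  also have "\<dots> = (LINT x|std_normal_distribution. m x)"
    by (subst integral_density) (auto simp: mult.commute)
  finally show ?thesis unfolding Z_def .
qed

text \<open>Keeps the coordinatewise continuity hypothesis alive when one coordinate is integrated
  out.\<close>

lemma continuous_on_ln_integral_exp:
  fixes G :: "real \<Rightarrow> real \<Rightarrow> real"
  assumes K: "\<And>t y. \<bar>G t y\<bar> \<le> K" and c: "\<And>y. continuous_on UNIV (\<lambda>t. G t y)"
    and m: "\<And>t. G t \<in> borel_measurable borel"
  shows "continuous_on UNIV (\<lambda>t. ln (LINT y|std_normal_distribution. exp (G t y)))"
proof (rule continuous_on_ln)
  have KK: "- K \<le> G t y" "G t y \<le> K" for t y using K[of t y] by auto
  have int: "integrable std_normal_distribution (\<lambda>y. exp (G t y))" for t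
    by (rule std_normal.integrable_const_bound[of _ "exp K"]) (use KK m in auto)
  show "continuous_on UNIV (\<lambda>t. LINT y|std_normal_distribution. exp (G t y))"
    unfolding continuous_on_sequentially
  proof (intro ballI allI impI, elim conjE)
    fix x :: "nat \<Rightarrow> real" and a assume x: "x \<longlonglongrightarrow> a"
    have "(\<lambda>n. LINT y|std_normal_distribution. exp (G (x n) y)) \<longlonglongrightarrow> (LINT y|std_normal_distribution. exp (G a y))"
    proof (rule integral_dominated_convergence[where w = "\<lambda>_. exp K"])
      show "AE y in std_normal_distribution. (\<lambda>n. exp (G (x n) y)) \<longlonglongrightarrow> exp (G a y)"
      proof (rule AE_I2, rule tendsto_exp)
        fix y show "(\<lambda>n. G (x n) y) \<longlonglongrightarrow> G a y"
          using c[of y] x unfolding continuous_on_sequentially by (auto simp: o_def)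
      qed
    qed (use KK m in auto)
    then show "((\<lambda>t. LINT y|std_normal_distribution. exp (G t y)) \<circ> x) \<longlonglongrightarrow> (LINT y|std_normal_distribution. exp (G a y))"
      by (simp add: o_def)
  qed
  have "(LINT y|std_normal_distribution. exp (- K)) \<le> (LINT y|std_normal_distribution. exp (G t y))" for t
    by (rule integral_mono[OF _ int]) (use KK in auto)
  then have "exp (- K) \<le> (LINT y|std_normal_distribution. exp (G t y))" for t
    by (simp add: std_normal.prob_space[simplified])
  then show "\<forall>t\<in>UNIV. (LINT y|std_normal_distribution. exp (G t y)) \<noteq> 0"
    by (metis exp_gt_zero not_le)
qed

text \<open>Integrate out coordinate \<open>j\<close>: \<open>g\<close> becomes the logarithmic
  exponential mean \<open>g1\<close> and \<open>m\<close> the mean \<open>m1\<close>. For a fixed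
  shift of the other coordinates the one-dimensional inequality says exactly that \<open>g1\<close>
  and \<open>m1\<close> satisfy the hypothesis again, with no loss of constants.\<close>

lemma log_exp_integral_le_sup_convolution:
  fixes g m :: "('i \<Rightarrow> real) \<Rightarrow> real"
  assumes "finite I"
    and "g \<in> borel_measurable (PiM I (\<lambda>_. std_normal_distribution))" "\<And>z. \<bar>g z\<bar> \<le> K"
    and "\<And>z i. i \<in> I \<Longrightarrow> continuous_on UNIV (\<lambda>t. g (z(i := t)))"
    and "m \<in> borel_measurable (PiM I (\<lambda>_. std_normal_distribution))" "\<And>z. \<bar>m z\<bar> \<le> K'"
    and "\<And>z a. g (\<lambda>i. z i + a i) - (\<Sum>i\<in>I. (a i)\<^sup>2) / 2 \<le> m z"
  shows "ln (LINT z|PiM I (\<lambda>_. std_normal_distribution). exp (g z)) \<le> (LINT z|PiM I (\<lambda>_. std_normal_distribution). m z)"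
  using assms
proof (induction I arbitrary: g m K' rule: finite_induct)
  case empty
  have "g (\<lambda>i. undefined + 0) - 0 \<le> m (\<lambda>_. undefined)"
    using empty.prems(6)[of "\<lambda>_. undefined" "\<lambda>_. 0"] by simp
  then show ?case by (simp add: PiM_empty lebesgue_integral_count_space_finite)
next
  case (insert j I)
  let ?N = std_normal_distribution
  let ?PI = "PiM I (\<lambda>_. ?N)"
  let ?PJ = "PiM (insert j I) (\<lambda>_. ?N)"
  interpret PI: prob_space ?PI by (rule prob_space_PiM) (rule std_normal.prob_space_axioms)
  interpret PJ: prob_space ?PJ by (rule prob_space_PiM) (rule std_normal.prob_space_axioms)
  note gm = insert.prems(1) and gK = insert.prems(2) and gc = insert.prems(3)
    and mm = insert.prems(4) and mK = insert.prems(5) and ineq = insert.prems(6)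
  have gK': "- K \<le> g z" "g z \<le> K" for z using gK[of z] by auto
  have upd: "(\<lambda>(x, y). x(j := y)) \<in> measurable (?PI \<Otimes>\<^sub>M ?N) ?PJ"
    by (rule measurable_add_dim)
  have g2: "(\<lambda>(x, y). g (x(j := y))) \<in> borel_measurable (?PI \<Otimes>\<^sub>M ?N)"
    using measurable_compose[OF upd gm] by (simp only: case_prod_unfold)
  have m2: "(\<lambda>(x, y). m (x(j := y))) \<in> borel_measurable (?PI \<Otimes>\<^sub>M ?N)"
    using measurable_compose[OF upd mm] by (simp only: case_prod_unfold)
  have gcj: "continuous_on UNIV (\<lambda>y. g (z(j := y)))" for z by (rule gc) simp
  have gmj: "(\<lambda>y. g (z(j := y))) \<in> borel_measurable borel" for z by (rule borel_measurable_continuous_onI[OF gcj])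
  have ej: "integrable ?N (\<lambda>y. exp (g (z(j := y))))" for z
    by (rule std_normal.integrable_const_bound[of _ "exp K"]) (use gK' gmj in auto)
  define g1 where "g1 x = ln (LINT y|?N. exp (g (x(j := y))))" for x
  \<comment> \<open>Slices of \<open>m\<close> are known to be measurable only over
    \<open>space ?PI\<close>, while the hypotheses quantify over all functions. Elsewhere the value
    \<open>K + K'\<close> is large enough to dominate \<open>g1\<close> and affects no
    integral.\<close>
  define m1 where "m1 x = (if x \<in> space ?PI then LINT y|?N. m (x(j := y)) else K + K')" for x
  have bnds: "exp (- K) \<le> (LINT y|?N. exp (g (x(j := y))))" "(LINT y|?N. exp (g (x(j := y)))) \<le> exp K" for x
  proof -
    have "(LINT y|?N. exp (- K)) \<le> (LINT y|?N. exp (g (x(j := y))))"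
      by (rule integral_mono[OF _ ej]) (use gK' in auto)
    then show "exp (- K) \<le> (LINT y|?N. exp (g (x(j := y))))" by (simp add: std_normal.prob_space[simplified])
    have "(LINT y|?N. exp (g (x(j := y)))) \<le> (LINT y|?N. exp K)"
      by (rule integral_mono[OF ej]) (use gK' in auto)
    then show "(LINT y|?N. exp (g (x(j := y)))) \<le> exp K" by (simp add: std_normal.prob_space[simplified])
  qed
  have pos: "(LINT y|?N. exp (g (x(j := y)))) > 0" for x using bnds(1)[of x] by (meson exp_gt_zero less_le_trans)
  have eg1: "exp (g1 x) = (LINT y|?N. exp (g (x(j := y))))" for x unfolding g1_def using pos by simp
  have g1K: "\<bar>g1 x\<bar> \<le> K" for x
  proof -
    have "exp (- K) \<le> exp (g1 x)" "exp (g1 x) \<le> exp K" unfolding eg1 using bnds by auto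
    then show ?thesis by (simp add: abs_le_iff)
  qed
  have mmj: "(\<lambda>y. m (x(j := y))) \<in> borel_measurable borel" if "x \<in> space ?PI" for x
  proof -
    have "(\<lambda>y. m (x(j := y))) \<in> borel_measurable ?N" using measurable_Pair2[OF m2 that] by simp
    then show ?thesis by simp
  qed
  have mint: "integrable ?N (\<lambda>y. m (x(j := y)))" if "x \<in> space ?PI" for x
    by (rule std_normal.integrable_const_bound[of _ K']) (use mK mmj[OF that] in auto)
  have K0: "K \<ge> 0" using gK[of undefined] abs_ge_zero order_trans by blast
  have K'0: "K' \<ge> 0" using mK[of undefined] abs_ge_zero order_trans by blast
  have m1K: "\<bar>m1 x\<bar> \<le> K + K'" for x
  proof (cases "x \<in> space ?PI")
    case True
    have "\<bar>LINT y|?N. m (x(j := y))\<bar> \<le> (LINT y|?N. \<bar>m (x(j := y))\<bar>)" by (rule integral_abs_bound)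
    also have "\<dots> \<le> (LINT y|?N. K')"
      by (rule integral_mono) (use mint[OF True] mK in auto)
    finally show ?thesis using True K0 by (simp add: m1_def std_normal.prob_space[simplified])
  qed (use K0 K'0 in \<open>simp add: m1_def\<close>)
  have "ln (LINT x|?PI. exp (g1 x)) \<le> (LINT x|?PI. m1 x)"
  proof (rule insert.IH[OF _ g1K _ _ m1K])
    show "g1 \<in> borel_measurable ?PI"
      unfolding g1_def[abs_def]
      by (intro borel_measurable_ln std_normal.borel_measurable_lebesgue_integral)
         (use g2 in \<open>auto simp: case_prod_beta\<close>)
    show "continuous_on UNIV (\<lambda>t. g1 (x(i := t)))" if i: "i \<in> I" for x i
    proof -
      have ij: "i \<noteq> j" using i insert.hyps by auto
      have "continuous_on UNIV (\<lambda>t. ln (LINT y|?N. exp (g ((x(i := t))(j := y)))))"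
      proof (rule continuous_on_ln_integral_exp[OF gK])
        show "continuous_on UNIV (\<lambda>t. g ((x(i := t))(j := y)))" for y
          unfolding fun_upd_twist[OF ij] by (rule gc) (use i in simp)
      qed (rule gmj)
      then show ?thesis unfolding g1_def .
    qed
    have "(\<lambda>x. LINT y|?N. m (x(j := y))) \<in> borel_measurable ?PI"
      by (rule std_normal.borel_measurable_lebesgue_integral[OF m2])
    then show "m1 \<in> borel_measurable ?PI"
      unfolding m1_def[abs_def] by (rule measurable_cong[THEN iffD1, rotated]) simp
    show "g1 (\<lambda>i. x i + a i) - (\<Sum>i\<in>I. (a i)\<^sup>2) / 2 \<le> m1 x" for x a
    proof (cases "x \<in> space ?PI")
      case True
      let ?S = "(\<Sum>i\<in>I. (a i)\<^sup>2) / 2"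
      \<comment> \<open>The cost \<open>?S\<close> of shifting the coordinates in \<open>I\<close>
        is moved to the right-hand side, so the one-dimensional lemma pays only for the shift of
        coordinate \<open>j\<close>.\<close>
      have "ln (LINT y|?N. exp (g ((\<lambda>i. x i + a i)(j := y)))) \<le> (LINT y|?N. m (x(j := y)) + ?S)"
      proof (rule log_exp_integral_le_sup_convolution_1d[OF gcj gK])
        show "(\<lambda>y. m (x(j := y)) + ?S) \<in> borel_measurable borel" using mmj[OF True] by measurable
        show "\<bar>m (x(j := y)) + ?S\<bar> \<le> K' + ?S" for y
        proof -
          have "0 \<le> ?S" by (simp add: sum_nonneg)
          then show ?thesis using mK[of "x(j := y)"] by linarith
        qed
        fix y s :: real
        have "g (\<lambda>i. (x(j := y)) i + (a(j := s)) i) - (\<Sum>i\<in>insert j I. ((a(j := s)) i)\<^sup>2) / 2 \<le> m (x(j := y))"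
          by (rule ineq)
        moreover have "(\<lambda>i. (x(j := y)) i + (a(j := s)) i) = (\<lambda>i. x i + a i)(j := y + s)" by auto
        moreover have "(\<Sum>i\<in>insert j I. ((a(j := s)) i)\<^sup>2) = s\<^sup>2 + (\<Sum>i\<in>I. (a i)\<^sup>2)"
          using insert.hyps by (subst sum.insert) (auto intro!: sum.cong)
        ultimately show "g ((\<lambda>i. x i + a i)(j := y + s)) - s\<^sup>2 / 2 \<le> m (x(j := y)) + ?S"
          by (simp add: add_divide_distrib)
      qed
      also have "\<dots> = (LINT y|?N. m (x(j := y))) + ?S"
        using mint[OF True] by (simp add: std_normal.prob_space[simplified])
      finally show ?thesis using True by (simp add: g1_def m1_def)
    next
      case False
      have "0 \<le> (\<Sum>i\<in>I. (a i)\<^sup>2) / 2" by (simp add: sum_nonneg)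
      then have "g1 (\<lambda>i. x i + a i) - (\<Sum>i\<in>I. (a i)\<^sup>2) / 2 \<le> K + K'"
        using g1K[of "\<lambda>i. x i + a i"] K'0 by linarith
      then show ?thesis using False by (simp add: m1_def)
    qed
  qed
  also have "(LINT x|?PI. exp (g1 x)) = (LINT z|?PJ. exp (g z))"
    unfolding eg1
    by (rule std_normal_prod.product_integral_insert[OF insert.hyps, symmetric])
       (rule PJ.integrable_const_bound[of _ "exp K"], use gK' gm in auto)
  also have "(LINT x|?PI. m1 x) = (LINT x|?PI. LINT y|?N. m (x(j := y)))"
    by (rule Bochner_Integration.integral_cong) (auto simp: m1_def)
  also have "\<dots> = (LINT z|?PJ. m z)"
    by (rule std_normal_prod.product_integral_insert[OF insert.hyps, symmetric])
       (rule PJ.integrable_const_bound[of _ K'], use mK mm in auto)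
  finally show ?case .
qed

section \<open>The Laplace upper bound\<close>

lemma bounded_linear_bernstein_op: "bounded_linear (bernstein_op n)"
  by (rule bounded_linear_intro[of _ 1]) (simp_all add: bernstein_op_add bernstein_op_scaleR bernstein_op_norm_le)

text \<open>Pointwise convergence becomes uniform on compact sets because the operators do not
  increase norms: a finite net with mesh \<open>e / 3\<close> suffices.\<close>

lemma bernstein_op_uniform:
  fixes S :: "'d::finite path set"
  assumes S: "compact S" "S \<subseteq> C01" and e: "e > 0"
  shows "\<forall>\<^sub>F n in sequentially. \<forall>x\<in>S. norm (bernstein_op n x - x) \<le> e"
proof -
  obtain k where k: "finite k" "k \<subseteq> S" "S \<subseteq> (\<Union>x\<in>k. ball x (e / 3))"
    using seq_compact_imp_totally_bounded[OF compact_imp_seq_compact[OF S(1)], rule_format, of "e / 3"] e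
    by auto
  have "\<forall>x\<in>k. \<forall>\<^sub>F n in sequentially. dist (bernstein_op n x) x < e / 3"
    using k(2) S(2) e by (intro ballI tendstoD[OF bernstein_op_tendsto]) auto
  then have "\<forall>\<^sub>F n in sequentially. \<forall>x\<in>k. dist (bernstein_op n x) x < e / 3"
    using k(1) by (simp add: eventually_ball_finite)
  then show ?thesis
  proof (rule eventually_mono, intro ballI)
    fix n x assume n: "\<forall>x\<in>k. dist (bernstein_op n x) x < e / 3" and x: "x \<in> S"
    obtain y where y: "y \<in> k" "dist y x < e / 3" using x k(3) by auto
    have "norm (bernstein_op n (x - y)) \<le> norm (x - y)" by (rule bernstein_op_norm_le)
    then have "dist (bernstein_op n x) (bernstein_op n y) \<le> dist y x"
      by (simp add: bernstein_op_diff dist_norm norm_minus_commute)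
    moreover have "dist (bernstein_op n y) y < e / 3" using n y by blast
    ultimately have "dist (bernstein_op n x) x \<le> e"
      using y(2) dist_triangle[of "bernstein_op n x" x "bernstein_op n y"]
        dist_triangle[of "bernstein_op n y" x y] by linarith
    then show "norm (bernstein_op n x - x) \<le> e" by (simp add: dist_norm)
  qed
qed

context abstract_wiener_space
begin

lemma borel_measurable_norm_P [measurable]: "(\<lambda>\<omega>. norm \<omega>) \<in> borel_measurable P"
  unfolding measurable_P_iff by (intro borel_measurable_continuous_on_restrict continuous_intros)

lemma borel_measurable_scaled:
  assumes F: "continuous_on C01_0 F" and f: "continuous_on C01_0 f" "\<And>x. x \<in> C01_0 \<Longrightarrow> f x \<in> C01_0"
  shows "(\<lambda>\<omega>. (F (f \<omega>) :: real)) \<in> borel_measurable P"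
  unfolding measurable_P_iff
  by (intro borel_measurable_continuous_on_restrict continuous_on_compose2[OF F f(1)]) (use f(2) in auto)

text \<open>The grid values of the noise are linear in finitely many independent standard normals,
  so the Gaussian inequality applies to them. A coordinate shift \<open>a\<close> corresponds to the
  Cameron--Martin element \<open>u = sqrt \<epsilon> *\<^sub>R (\<Sum>c\<in>C. a c *\<^sub>R
  c)\<close>, and after multiplication by \<open>\<epsilon>\<close> its Gaussian cost is the cost
  \<open>(norm u)\<^sup>2 / 2\<close> of the game.\<close>

lemma log_exp_upper_finite_rank:
  fixes F :: "'d path \<Rightarrow> real"
  assumes Fc: "continuous_on C01_0 F" and FK: "\<And>x. x \<in> C01_0 \<Longrightarrow> \<bar>F x\<bar> \<le> K"
    and osc: "\<And>x y. x \<in> C01_0 \<Longrightarrow> y \<in> C01_0 \<Longrightarrow> \<bar>F x - F y\<bar> \<le> \<delta> + L * min 1 (norm (x - y))"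
    and L: "L \<ge> 0" and S: "\<And>u. F (bernstein_op n (\<iota> u)) - (norm u)\<^sup>2 / 2 \<le> S" and eps: "\<epsilon> > 0"
  shows "\<epsilon> * ln (LINT \<omega>|P. exp (F (bernstein_op n (sqrt \<epsilon> *\<^sub>R \<omega>)) / \<epsilon>)) \<le>
    S + \<delta> + L * (LINT \<omega>|P. min 1 (sqrt \<epsilon> * norm \<omega>))"
proof -
  define r where "r k i = riesz \<iota> (\<lambda>\<omega>. apply_bcontfun \<omega> (real k / real n) $ i)" for k i
  define B0 where "B0 = (\<lambda>(k, i). r k i) ` ({..n} \<times> (UNIV :: 'd set))"
  have r_range: "r k i \<in> riesz_range" for k i unfolding r_def riesz_range_def using eval_dual by blast
  obtain C where C: "finite C" "span C = span B0" "orthonormal C"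
    using orthonormal_span[of B0] by (auto simp: B0_def)
  have "span B0 \<subseteq> riesz_range" by (rule span_minimal[OF _ subspace_riesz_range]) (auto simp: B0_def r_range)
  then have CR: "C \<subseteq> riesz_range" using C(2) span_superset by blast
  define X where "X z = (\<Sum>c\<in>C. z c *\<^sub>R \<iota> c)" for z
  have Xi: "X z = \<iota> (\<Sum>c\<in>C. z c *\<^sub>R c)" for z unfolding X_def by (simp add: \<iota>.sum \<iota>.scaleR)
  have X0: "X z \<in> C01_0" for z unfolding Xi by (rule iota_in_C01_0)
  define Y where "Y z = sqrt \<epsilon> *\<^sub>R bernstein_op n (X z)" for z
  have Y0: "Y z \<in> C01_0" for z
    unfolding Y_def by (intro subspace_scale[OF subspace_C01_0] bernstein_op_in_C01_0 X0)
  \<comment> \<open>\<open>X\<close> of the coordinates is a Cameron--Martin path standing in for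
    \<open>\<omega>\<close>. The two agree only at the grid points, which is all that
    \<open>bernstein_op n\<close> sees.\<close>
  have coord: "apply_bcontfun \<omega> (real k / real n) $ i = apply_bcontfun (X (\<lambda>c\<in>C. functional c \<omega>)) (real k / real n) $ i"
    if w: "\<omega> \<in> C01_0" and k: "k \<le> n" for \<omega> k i
  proof -
    have rs: "r k i \<in> span C" unfolding C(2) by (rule span_base) (use k in \<open>auto simp: B0_def\<close>)
    have "apply_bcontfun \<omega> (real k / real n) $ i = (\<Sum>c\<in>C. inner (r k i) c * functional c \<omega>)"
      by (rule dual_expand[OF CR eval_dual _ w]) (fold r_def, rule orthonormal_expand[OF C(1,3) rs])
    also have "\<dots> = inner (\<Sum>c\<in>C. (\<lambda>c\<in>C. functional c \<omega>) c *\<^sub>R c) (r k i)"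
      unfolding inner_sum_left by (intro sum.cong) (auto simp: inner_commute)
    also have "\<dots> = apply_bcontfun (X (\<lambda>c\<in>C. functional c \<omega>)) (real k / real n) $ i"
      unfolding r_def inner_riesz[OF eval_dual] Xi ..
    finally show ?thesis .
  qed
  have bX: "bernstein_op n (sqrt \<epsilon> *\<^sub>R \<omega>) = Y (\<lambda>c\<in>C. functional c \<omega>)" if w: "\<omega> \<in> C01_0" for \<omega>
  proof -
    have "bernstein_op n \<omega> = bernstein_op n (X (\<lambda>c\<in>C. functional c \<omega>))"
      unfolding bernstein_op_def
      by (rule bcontfun_eqI, unfold apply_bernstein_path, rule sum.cong[OF refl]) (simp add: vec_eq_iff coord[OF w])
    then show ?thesis unfolding Y_def bernstein_op_scaleR by simp
  qed
  let ?N = "PiM C (\<lambda>_. std_normal_distribution)"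
  have comp: "(\<lambda>z. z c) \<in> borel_measurable ?N" if "c \<in> C" for c
    by (subst measurable_cong_sets[OF sets_PiM_std_normal refl]) (rule measurable_component_singleton[OF that])
  have Yt: "apply_bcontfun (Y z) t = sqrt \<epsilon> *\<^sub>R (\<Sum>c\<in>C. z c *\<^sub>R apply_bcontfun (bernstein_op n (\<iota> c)) t)" for z t
  proof -
    interpret b: bounded_linear "bernstein_op n :: 'd path \<Rightarrow> _" by (rule bounded_linear_bernstein_op)
    have "apply_bcontfun (\<Sum>c\<in>A. f c) t = (\<Sum>c\<in>A. apply_bcontfun (f c) t)" if "finite A" for A and f :: "'h \<Rightarrow> 'd path"
      using that by (induction A rule: finite_induct) (simp_all add: plus_bcontfun.rep_eq)
    then show ?thesis unfolding Y_def X_def by (simp add: b.sum b.scaleR scaleR_bcontfun.rep_eq C(1))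
  qed
  have Ym: "Y \<in> measurable ?N (restrict_space borel C01_0)"
  proof (rule measurable_restrict_space2)
    show "Y \<in> space ?N \<rightarrow> C01_0" using Y0 by auto
    show "Y \<in> borel_measurable ?N"
    proof (rule borel_measurable_pathI)
      show "Y z \<in> C01" for z using Y0 C01_0_subset by blast
      show "(\<lambda>z. apply_bcontfun (Y z) t) \<in> borel_measurable ?N" for t
        unfolding Yt by (intro borel_measurable_scaleR borel_measurable_const borel_measurable_sum comp)
    qed
  qed
  have Yc: "continuous_on UNIV (\<lambda>t. Y (z(c := t)))" for z c
  proof -
    have "continuous_on UNIV (\<lambda>t. X (z(c := t)))"
      unfolding X_def
    proof (intro continuous_on_sum)
      fix c' show "continuous_on UNIV (\<lambda>t. (z(c := t)) c' *\<^sub>R \<iota> c')"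
        by (cases "c' = c") (auto intro!: continuous_intros)
    qed
    then show ?thesis unfolding Y_def
      by (intro continuous_intros bounded_linear.continuous_on[OF bounded_linear_bernstein_op])
  qed
  define g where "g z = F (Y z) / \<epsilon>" for z
  \<comment> \<open>The majorant demanded by the Gaussian inequality: \<open>osc\<close> removes the
    noise \<open>Y z\<close> from the argument of \<open>F\<close>, and what remains is bounded by
    \<open>S\<close> for every shift.\<close>
  define m where "m z = (S + \<delta> + L * min 1 (norm (Y z))) / \<epsilon>" for z
  have Fm: "F \<in> borel_measurable (restrict_space borel C01_0)" by (rule borel_measurable_continuous_on_restrict[OF Fc])
  have nm: "norm \<in> borel_measurable (restrict_space borel (C01_0 :: 'd path set))"
    by (intro borel_measurable_continuous_on_restrict continuous_intros)
  have gm: "g \<in> borel_measurable ?N"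
    unfolding g_def[abs_def] using measurable_compose[OF Ym Fm] by simp
  have mm: "m \<in> borel_measurable ?N"
    unfolding m_def[abs_def] using measurable_compose[OF Ym nm] by simp
  have "ln (LINT z|?N. exp (g z)) \<le> (LINT z|?N. m z)"
  proof (rule log_exp_integral_le_sup_convolution[OF C(1) gm _ _ mm])
    show "\<bar>g z\<bar> \<le> K / \<epsilon>" for z unfolding g_def using FK[OF Y0[of z]] eps by (simp add: abs_div divide_right_mono)
    show "continuous_on UNIV (\<lambda>t. g (z(c := t)))" for z c
      unfolding g_def using eps
      by (intro continuous_on_divide continuous_on_const continuous_on_compose2[OF Fc Yc]) (use Y0 in auto)
    show "\<bar>m z\<bar> \<le> (\<bar>S + \<delta>\<bar> + L) / \<epsilon>" for z
    proof -
      have "0 \<le> L * min 1 (norm (Y z))" "L * min 1 (norm (Y z)) \<le> L * 1"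
        using L by (simp, intro mult_left_mono, simp_all)
      then have "\<bar>S + \<delta> + L * min 1 (norm (Y z))\<bar> \<le> \<bar>S + \<delta>\<bar> + L" by linarith
      then show ?thesis unfolding m_def using eps by (simp add: abs_div divide_right_mono)
    qed
    show "g (\<lambda>c. z c + a c) - (\<Sum>c\<in>C. (a c)\<^sup>2) / 2 \<le> m z" for z a
    proof -
      define u where "u = sqrt \<epsilon> *\<^sub>R (\<Sum>c\<in>C. a c *\<^sub>R c)"
      have nu: "(norm u)\<^sup>2 = \<epsilon> * (\<Sum>c\<in>C. (a c)\<^sup>2)"
        unfolding u_def norm_scaleR power_mult_distrib unfolding power2_norm_eq_inner orthonormal_inner_sum[OF C(1,3)]
        using eps by (simp add: power2_eq_square)
      have "X (\<lambda>c. z c + a c) = X z + \<iota> (\<Sum>c\<in>C. a c *\<^sub>R c)"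
        unfolding Xi by (simp add: \<iota>.add[symmetric] sum.distrib scaleR_left_distrib)
      then have Yza: "Y (\<lambda>c. z c + a c) = Y z + bernstein_op n (\<iota> u)"
        unfolding Y_def u_def by (simp add: bernstein_op_add bernstein_op_scaleR \<iota>.scaleR scaleR_right_distrib)
      have b0: "bernstein_op n (\<iota> u) \<in> C01_0" by (intro bernstein_op_in_C01_0 iota_in_C01_0)
      have "F (Y z + bernstein_op n (\<iota> u)) \<le> F (bernstein_op n (\<iota> u)) + (\<delta> + L * min 1 (norm (Y z)))"
        using osc[OF subspace_add[OF subspace_C01_0 Y0 b0] b0, of z] by simp
      then have "F (Y (\<lambda>c. z c + a c)) - \<epsilon> * (\<Sum>c\<in>C. (a c)\<^sup>2) / 2 \<le> S + \<delta> + L * min 1 (norm (Y z))"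
        using S[of u] unfolding Yza nu by simp
      then have "(F (Y (\<lambda>c. z c + a c)) - \<epsilon> * (\<Sum>c\<in>C. (a c)\<^sup>2) / 2) / \<epsilon> \<le> m z"
        unfolding m_def using eps by (simp add: divide_right_mono)
      then show ?thesis unfolding g_def using eps by (simp add: diff_divide_distrib)
    qed
  qed
  then have main: "\<epsilon> * ln (LINT z|?N. exp (g z)) \<le> \<epsilon> * (LINT z|?N. m z)" using eps by simp
  note dist = distr_functional[OF C(1) CR C(3)] and mr = measurable_restrict_functional[OF CR]
  have tr: "(LINT z|?N. h z) = (LINT \<omega>|P. h (\<lambda>c\<in>C. functional c \<omega>))" if "h \<in> borel_measurable ?N" for h :: "_ \<Rightarrow> real"
    unfolding dist[symmetric]
    by (rule integral_distr[OF mr]) (use that in \<open>simp add: measurable_cong_sets[OF sets_PiM_std_normal refl]\<close>)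
  have e1: "(LINT z|?N. exp (g z)) = (LINT \<omega>|P. exp (F (bernstein_op n (sqrt \<epsilon> *\<^sub>R \<omega>)) / \<epsilon>))"
  proof -
    have "(LINT z|?N. exp (g z)) = (LINT \<omega>|P. exp (g (\<lambda>c\<in>C. functional c \<omega>)))"
      by (rule tr) (use gm in measurable)
    also have "\<dots> = (LINT \<omega>|P. exp (F (bernstein_op n (sqrt \<epsilon> *\<^sub>R \<omega>)) / \<epsilon>))"
      by (rule Bochner_Integration.integral_cong) (simp_all add: g_def bX space_P)
    finally show ?thesis .
  qed
  have im: "integrable P (\<lambda>\<omega>. min 1 (sqrt \<epsilon> * norm \<omega>))"
    by (rule integrable_const_bound[of _ 1]) (use eps in auto)
  have "(LINT z|?N. m z) = (LINT \<omega>|P. m (\<lambda>c\<in>C. functional c \<omega>))" by (rule tr[OF mm])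
  also have "\<dots> \<le> (LINT \<omega>|P. (S + \<delta> + L * min 1 (sqrt \<epsilon> * norm \<omega>)) / \<epsilon>)"
  proof (rule integral_mono)
    have "(\<lambda>\<omega>. m (\<lambda>c\<in>C. functional c \<omega>)) \<in> borel_measurable P"
      by (rule measurable_compose[OF mr]) (use mm in \<open>simp add: measurable_cong_sets[OF sets_PiM_std_normal refl]\<close>)
    then show "integrable P (\<lambda>\<omega>. m (\<lambda>c\<in>C. functional c \<omega>))"
    proof (rule integrable_const_bound[of _ "(\<bar>S + \<delta>\<bar> + L) / \<epsilon>", rotated], intro AE_I2)
      fix \<omega>
      let ?z = "\<lambda>c\<in>C. functional c \<omega>"
      have "0 \<le> L * min 1 (norm (Y ?z))" "L * min 1 (norm (Y ?z)) \<le> L * 1"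
        using L by (simp, intro mult_left_mono, simp_all)
      then have "\<bar>S + \<delta> + L * min 1 (norm (Y ?z))\<bar> \<le> \<bar>S + \<delta>\<bar> + L" by linarith
      then show "norm (m ?z) \<le> (\<bar>S + \<delta>\<bar> + L) / \<epsilon>" unfolding m_def using eps by (simp add: abs_div divide_right_mono)
    qed
    show "integrable P (\<lambda>\<omega>. (S + \<delta> + L * min 1 (sqrt \<epsilon> * norm \<omega>)) / \<epsilon>)" using im by simp
    fix \<omega> assume "\<omega> \<in> space P"
    then have w: "\<omega> \<in> C01_0" by (simp add: space_P)
    \<comment> \<open>Contractivity of the Bernstein operator: the noise term is bounded by the norm
      of the path itself, hence independently of \<open>n\<close> and of the dimension.\<close>
    have "norm (Y (\<lambda>c\<in>C. functional c \<omega>)) \<le> norm (sqrt \<epsilon> *\<^sub>R \<omega>)"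
      unfolding bX[OF w, symmetric] by (rule bernstein_op_norm_le)
    also have "\<dots> = sqrt \<epsilon> * norm \<omega>" using eps by simp
    finally have "L * min 1 (norm (Y (\<lambda>c\<in>C. functional c \<omega>))) \<le> L * min 1 (sqrt \<epsilon> * norm \<omega>)"
      using L by (intro mult_left_mono) auto
    then show "m (\<lambda>c\<in>C. functional c \<omega>) \<le> (S + \<delta> + L * min 1 (sqrt \<epsilon> * norm \<omega>)) / \<epsilon>"
      unfolding m_def using eps by (simp add: divide_right_mono)
  qed
  also have "\<dots> = (S + \<delta> + L * (LINT \<omega>|P. min 1 (sqrt \<epsilon> * norm \<omega>))) / \<epsilon>"
    using im by (simp add: prob_space)
  finally have "\<epsilon> * (LINT z|?N. m z) \<le> S + \<delta> + L * (LINT \<omega>|P. min 1 (sqrt \<epsilon> * norm \<omega>))"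
    using eps by (simp add: field_simps)
  then show ?thesis using main unfolding e1 by linarith
qed

text \<open>Lets the degree tend to infinity in the finite-rank bound. One \<open>\<delta>\<close>
  is paid there for removing the noise, the other for replacing
  \<open>bernstein_op n (\<iota> u)\<close> by \<open>\<iota> u\<close>. That replacement must be
  uniform in \<open>u\<close>: compactness handles a ball, the quadratic cost its
  complement.\<close>

theorem log_exp_upper_bound:
  fixes F :: "'d path \<Rightarrow> real"
  assumes Fc: "continuous_on C01_0 F" and FK: "\<And>x. x \<in> C01_0 \<Longrightarrow> \<bar>F x\<bar> \<le> K"
    and osc: "\<And>x y. x \<in> C01_0 \<Longrightarrow> y \<in> C01_0 \<Longrightarrow> \<bar>F x - F y\<bar> \<le> \<delta> + L * min 1 (norm (x - y))"
    and L: "L \<ge> 0" and d: "\<delta> \<ge> 0" and S: "\<And>u. F (\<iota> u) - (norm u)\<^sup>2 / 2 \<le> S" and eps: "\<epsilon> > 0"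
  shows "\<epsilon> * ln (LINT \<omega>|P. exp (F (sqrt \<epsilon> *\<^sub>R \<omega>) / \<epsilon>)) \<le>
    S + 2 * \<delta> + L * (LINT \<omega>|P. min 1 (sqrt \<epsilon> * norm \<omega>))"
proof -
  \<comment> \<open>Beyond this radius the cost \<open>(norm u)\<^sup>2 / 2\<close> is at least
    \<open>2 * K\<close>, so the payoff is at most \<open>- K\<close>, which never exceeds
    \<open>S\<close> because \<open>u = 0\<close> is a competitor.\<close>
  define R where "R = sqrt (4 * K)"
  have K0: "K \<ge> 0" using FK[OF subspace_0[OF subspace_C01_0]] by linarith
  let ?E = "\<lambda>n. LINT \<omega>|P. exp (F (bernstein_op n (sqrt \<epsilon> *\<^sub>R \<omega>)) / \<epsilon>)"
  let ?Elim = "LINT \<omega>|P. exp (F (sqrt \<epsilon> *\<^sub>R \<omega>) / \<epsilon>)"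
  have sc: "sqrt \<epsilon> *\<^sub>R \<omega> \<in> C01_0" if "\<omega> \<in> C01_0" for \<omega> using that by (rule subspace_scale[OF subspace_C01_0])
  have Fb: "- K / \<epsilon> \<le> F x / \<epsilon>" "F x / \<epsilon> \<le> K / \<epsilon>" if "x \<in> C01_0" for x
    using FK[OF that] eps divide_right_mono[of "- K" "F x" \<epsilon>] divide_right_mono[of "F x" K \<epsilon>]
    by (auto simp only: abs_le_iff)
  have m0: "(\<lambda>\<omega>. F (sqrt \<epsilon> *\<^sub>R \<omega>)) \<in> borel_measurable P"
    by (rule borel_measurable_scaled[OF Fc _ sc]) (auto intro!: continuous_intros)
  have mn: "(\<lambda>\<omega>. F (bernstein_op n (sqrt \<epsilon> *\<^sub>R \<omega>))) \<in> borel_measurable P" for n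
    by (rule borel_measurable_scaled[OF Fc])
       (auto intro!: bounded_linear.continuous_on[OF bounded_linear_bernstein_op] continuous_intros bernstein_op_in_C01_0 sc)
  have "?E \<longlonglongrightarrow> ?Elim"
  proof (rule integral_dominated_convergence[where w = "\<lambda>_. exp (K / \<epsilon>)"])
    show "(\<lambda>\<omega>. exp (F (sqrt \<epsilon> *\<^sub>R \<omega>) / \<epsilon>)) \<in> borel_measurable P" using m0 by measurable
    show "(\<lambda>\<omega>. exp (F (bernstein_op n (sqrt \<epsilon> *\<^sub>R \<omega>)) / \<epsilon>)) \<in> borel_measurable P" for n using mn[of n] by measurable
    show "AE \<omega> in P. (\<lambda>n. exp (F (bernstein_op n (sqrt \<epsilon> *\<^sub>R \<omega>)) / \<epsilon>)) \<longlonglongrightarrow> exp (F (sqrt \<epsilon> *\<^sub>R \<omega>) / \<epsilon>)"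
    proof (rule AE_I2)
      fix \<omega> assume "\<omega> \<in> space P"
      then have w: "sqrt \<epsilon> *\<^sub>R \<omega> \<in> C01_0" by (simp add: space_P sc)
      have "(\<lambda>n. bernstein_op n (sqrt \<epsilon> *\<^sub>R \<omega>)) \<longlonglongrightarrow> sqrt \<epsilon> *\<^sub>R \<omega>"
        using w C01_0_subset by (intro bernstein_op_tendsto) auto
      then have "(\<lambda>n. F (bernstein_op n (sqrt \<epsilon> *\<^sub>R \<omega>))) \<longlonglongrightarrow> F (sqrt \<epsilon> *\<^sub>R \<omega>)"
        using Fc w bernstein_op_in_C01_0[OF w] unfolding continuous_on_sequentially by (auto simp: o_def)
      then show "(\<lambda>n. exp (F (bernstein_op n (sqrt \<epsilon> *\<^sub>R \<omega>)) / \<epsilon>)) \<longlonglongrightarrow> exp (F (sqrt \<epsilon> *\<^sub>R \<omega>) / \<epsilon>)"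
        using eps by (intro tendsto_intros) auto
    qed
    show "AE \<omega> in P. norm (exp (F (bernstein_op n (sqrt \<epsilon> *\<^sub>R \<omega>)) / \<epsilon>)) \<le> exp (K / \<epsilon>)" for n
      by (rule AE_I2) (simp add: space_P Fb bernstein_op_in_C01_0 sc)
  qed auto
  moreover have "?Elim > 0"
  proof -
    have "AE \<omega> in P. norm (exp (F (sqrt \<epsilon> *\<^sub>R \<omega>) / \<epsilon>)) \<le> exp (K / \<epsilon>)"
      by (rule AE_I2) (simp add: space_P Fb sc)
    then have "integrable P (\<lambda>\<omega>. exp (F (sqrt \<epsilon> *\<^sub>R \<omega>) / \<epsilon>))"
      by (rule integrable_const_bound) (use m0 in measurable)
    then have "(LINT \<omega>|P. exp (- K / \<epsilon>)) \<le> ?Elim"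
      by (intro integral_mono) (use Fb sc in \<open>auto simp: space_P\<close>)
    then show ?thesis by (simp add: prob_space) (meson exp_gt_zero less_le_trans)
  qed
  ultimately have lim: "(\<lambda>n. \<epsilon> * ln (?E n)) \<longlonglongrightarrow> \<epsilon> * ln ?Elim"
    by (intro tendsto_intros) auto
  let ?b = "S + 2 * \<delta> + L * (LINT \<omega>|P. min 1 (sqrt \<epsilon> * norm \<omega>))"
  have "\<epsilon> * ln ?Elim \<le> ?b + e" if e: "e > 0" for e
  proof (rule tendsto_upperbound[OF lim _ sequentially_bot])
    have "e / (L + 1) > 0" using e L by simp
    then have "\<forall>\<^sub>F n in sequentially. \<forall>x\<in>\<iota> ` cball 0 R. norm (bernstein_op n x - x) \<le> e / (L + 1)"
      by (intro bernstein_op_uniform compact_iota_cball) (use iota_in_C01_0 C01_0_subset in auto)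
    then show "\<forall>\<^sub>F n in sequentially. \<epsilon> * ln (?E n) \<le> ?b + e"
    proof (rule eventually_mono)
      fix n assume n: "\<forall>x\<in>\<iota> ` cball 0 R. norm (bernstein_op n x - x) \<le> e / (L + 1)"
      have "F (bernstein_op n (\<iota> u)) - (norm u)\<^sup>2 / 2 \<le> S + \<delta> + e" for u
      proof (cases "norm u \<le> R")
        case True
        have "norm (bernstein_op n (\<iota> u) - \<iota> u) \<le> e / (L + 1)" using n True by auto
        then have "L * min 1 (norm (bernstein_op n (\<iota> u) - \<iota> u)) \<le> L * (e / (L + 1))"
          using L by (intro mult_left_mono) auto
        also have "\<dots> \<le> e" using e L by (simp add: field_simps)
        finally have "F (bernstein_op n (\<iota> u)) \<le> F (\<iota> u) + \<delta> + e"
          using osc[OF bernstein_op_in_C01_0[OF iota_in_C01_0] iota_in_C01_0, of n u u] by linarith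
        then show ?thesis using S[of u] by linarith
      next
        case False
        then have "R\<^sup>2 \<le> (norm u)\<^sup>2" unfolding R_def using K0 by (intro power_mono) auto
        then have "4 * K \<le> (norm u)\<^sup>2" unfolding R_def using K0 by simp
        moreover have "F (bernstein_op n (\<iota> u)) \<le> K" using FK[OF bernstein_op_in_C01_0[OF iota_in_C01_0], of n u] by linarith
        moreover have "- K \<le> S" using S[of 0] FK[OF iota_in_C01_0, of 0] by simp
        ultimately show ?thesis using d e by linarith
      qed
      from log_exp_upper_finite_rank[OF Fc FK osc L this eps]
      show "\<epsilon> * ln (?E n) \<le> ?b + e" by simp
    qed
  qed
  then show ?thesis by (rule field_le_epsilon)
qed

text \<open>The truncation at one supplies the dominating function. Dominated convergence works
  along the sequence \<open>1 / real (Suc n)\<close>; monotonicity in \<open>\<epsilon>\<close>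
  carries the bound over to the filter.\<close>

lemma small_noise:
  assumes e: "e > 0"
  shows "\<forall>\<^sub>F \<epsilon> in at_right 0. (LINT \<omega>|P. min 1 (sqrt \<epsilon> * norm \<omega>)) \<le> e"
proof -
  have "(\<lambda>n. LINT \<omega>|P. min 1 (1 / real (Suc n) * norm \<omega>)) \<longlonglongrightarrow> (LINT \<omega>|P. 0)"
  proof (rule integral_dominated_convergence[where w = "\<lambda>_. 1"])
    show "AE \<omega> in P. (\<lambda>n. min 1 (1 / real (Suc n) * norm \<omega>)) \<longlonglongrightarrow> 0"
    proof (rule AE_I2)
      fix \<omega> :: "'d path"
      have "(\<lambda>n. min 1 (1 / real (Suc n) * norm \<omega>)) \<longlonglongrightarrow> min 1 (0 * norm \<omega>)"
        by (intro tendsto_intros LIMSEQ_Suc[OF lim_1_over_n])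
      then show "(\<lambda>n. min 1 (1 / real (Suc n) * norm \<omega>)) \<longlonglongrightarrow> 0" by simp
    qed
  qed auto
  then have "\<forall>\<^sub>F n in sequentially. (LINT \<omega>|P. min 1 (1 / real (Suc n) * norm \<omega>)) < e"
    using e by (intro order_tendstoD) auto
  then obtain n where n: "(LINT \<omega>|P. min 1 (1 / real (Suc n) * norm \<omega>)) < e"
    by (auto simp: eventually_sequentially)
  show ?thesis
    unfolding eventually_at_right_field
  proof (intro exI[of _ "(1 / real (Suc n))\<^sup>2"] conjI allI impI)
    fix \<epsilon> :: real assume eps: "0 < \<epsilon>" "\<epsilon> < (1 / real (Suc n))\<^sup>2"
    have "sqrt \<epsilon> \<le> sqrt ((1 / real (Suc n))\<^sup>2)" using eps by (intro real_sqrt_le_mono) simp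
    then have s: "sqrt \<epsilon> \<le> 1 / real (Suc n)" by simp
    have "(LINT \<omega>|P. min 1 (sqrt \<epsilon> * norm \<omega>)) \<le> (LINT \<omega>|P. min 1 (1 / real (Suc n) * norm \<omega>))"
    proof (rule integral_mono)
      show "integrable P (\<lambda>\<omega>. min 1 (sqrt \<epsilon> * norm \<omega>))"
        by (rule integrable_const_bound[of _ 1]) (use eps in auto)
      show "integrable P (\<lambda>\<omega>. min 1 (1 / real (Suc n) * norm \<omega>))"
        by (rule integrable_const_bound[of _ 1]) auto
      show "min 1 (sqrt \<epsilon> * norm \<omega>) \<le> min 1 (1 / real (Suc n) * norm \<omega>)" for \<omega> :: "'d path"
        using mult_right_mono[OF s, of "norm \<omega>"] by auto
    qed
    then show "(LINT \<omega>|P. min 1 (sqrt \<epsilon> * norm \<omega>)) \<le> e" using n by linarith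
  qed simp
qed

end

section \<open>The game\<close>

text \<open>The upper level sets at the attained levels have the finite intersection property; a
  common point is a maximiser.\<close>

lemma usc_attains_max:
  fixes f :: "'k::metric_space \<Rightarrow> real"
  assumes K: "compact K" "K \<noteq> {}" and usc: "\<And>c. closed {u\<in>K. c \<le> f u}"
  shows "\<exists>u\<in>K. \<forall>u'\<in>K. f u' \<le> f u"
proof -
  have "K \<inter> \<Inter>((\<lambda>u'. {u\<in>K. f u' \<le> f u}) ` K) \<noteq> {}"
  proof (rule compact_imp_fip[OF K(1)])
    fix F assume F: "finite F" "F \<subseteq> (\<lambda>u'. {u\<in>K. f u' \<le> f u}) ` K"
    then obtain V where V: "V \<subseteq> K" "finite V" "F = (\<lambda>u'. {u\<in>K. f u' \<le> f u}) ` V"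
      by (meson finite_subset_image)
    show "K \<inter> \<Inter>F \<noteq> {}"
    proof (cases "V = {}")
      case True then show ?thesis using K(2) V(3) by simp
    next
      case False
      have "Max (f ` V) \<in> f ` V" using V(2) False by simp
      then obtain w where w: "w \<in> V" "f w = Max (f ` V)" by auto
      then have "f u' \<le> f w" if "u' \<in> V" for u' using that V(2) by simp
      then have "w \<in> K \<inter> \<Inter>F" using w V by auto
      then show ?thesis by blast
    qed
  qed (use usc in auto)
  then show ?thesis by blast
qed

lemma measurable_ident_coordinate_filtration:
  fixes P :: "'d::finite path measure"
  assumes "\<And>s. (\<lambda>\<omega>. apply_bcontfun \<omega> s) \<in> borel_measurable P"
  shows "(\<lambda>\<omega>. \<omega>) \<in> measurable P (coordinate_filtration P t)"
  unfolding coordinate_filtration_def augmented_sigma_def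
proof (rule measurable_measure_of)
  let ?G = "(\<Union>f\<in>(\<lambda>s \<omega>. apply_bcontfun \<omega> s) ` {0..t}. {f -` B \<inter> space P | B. B \<in> sets borel}) \<union> null_sets P"
  have G: "?G \<subseteq> sets P" using measurable_sets[OF assms] by (auto simp: null_sets_def)
  then show "?G \<subseteq> Pow (space P)" using sets.sets_into_space by blast
  show "(\<lambda>\<omega>. \<omega>) -` y \<inter> space P \<in> sets P" if "y \<in> ?G" for y
  proof -
    have "y \<in> sets P" using that G by blast
    then show ?thesis by simp
  qed
qed simp

locale small_noise_game = coefficient \<mu> + abstract_wiener_space P \<iota>
  for \<mu> :: "real \<Rightarrow> 'd::finite path \<Rightarrow> 'l::polish_space \<Rightarrow> real ^ 'd"
    and P :: "'d path measure" and \<iota> :: "'h::{real_inner, polish_space} \<Rightarrow> 'd path" +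
  fixes x0 :: "real ^ 'd" and \<phi> :: "'d path \<Rightarrow> real" and C :: "'l control \<Rightarrow> 'h \<Rightarrow> real"
  assumes bounded_phi: "bounded (\<phi> ` C01)"
    and uniformly_continuous_phi: "uniformly_continuous_on C01 \<phi>"
    and cost: "C = game_cost \<mu> x0 \<iota> \<phi>"
    and convex_cost: "convex_in_first C"
    and concave_cost: "concave_in_second C"
begin

abbreviation sol :: "'l control \<Rightarrow> 'd path \<Rightarrow> 'd path" where
  "sol \<equiv> solution_map \<mu> x0"

lemma C_eq: "C v u = \<phi> (sol v (\<iota> u)) - (norm u)\<^sup>2 / 2"
  by (simp add: cost game_cost_def)

definition phi_bound :: real where "phi_bound = (SOME K. \<forall>x\<in>C01. \<bar>\<phi> x\<bar> \<le> K)"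

lemma phi_le: "x \<in> C01 \<Longrightarrow> \<bar>\<phi> x\<bar> \<le> phi_bound"
proof -
  have "\<exists>K. \<forall>x\<in>C01. \<bar>\<phi> x\<bar> \<le> K" using bounded_phi by (auto simp: bounded_iff)
  from someI_ex[OF this] show "x \<in> C01 \<Longrightarrow> \<bar>\<phi> x\<bar> \<le> phi_bound" unfolding phi_bound_def by blast
qed

lemma phi_sol_le: "\<bar>\<phi> (sol v w)\<bar> \<le> phi_bound"
  by (rule phi_le[OF solution_map_in_C01])

lemma phi_bound_nonneg: "phi_bound \<ge> 0"
  by (rule order_trans[OF abs_ge_zero phi_sol_le[of undefined undefined]])

text \<open>Below a threshold \<open>s\<close> the payoff moves by less than
  \<open>\<delta>\<close>; above it the slope \<open>2 * phi_bound / s\<close> pays for the largest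
  possible oscillation. \<open>L\<close> is chosen before \<open>v\<close>, so the bound also
  applies to a control that varies with the sample point.\<close>

lemma phi_sol_oscillation:
  assumes d: "\<delta> > 0"
  obtains L where "L \<ge> 0"
    "\<And>v w w'. \<bar>\<phi> (sol v w) - \<phi> (sol v w')\<bar> \<le> \<delta> + L * min 1 (norm (w - w'))"
proof -
  obtain r where r: "r > 0" "\<And>x y. x \<in> C01 \<Longrightarrow> y \<in> C01 \<Longrightarrow> dist y x < r \<Longrightarrow> dist (\<phi> y) (\<phi> x) < \<delta>"
    using uniformly_continuous_phi d unfolding uniformly_continuous_on_def by blast
  define c where "c = 2 * exp (2 * lipschitz_const)"
  have c: "c \<ge> 1"
  proof -
    have "1 \<le> exp (2 * lipschitz_const)" using lipschitz_const_pos by simp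
    then show ?thesis unfolding c_def by linarith
  qed
  \<comment> \<open>\<open>c\<close> is the Lipschitz constant of the solution map, so noises closer
    than \<open>s\<close> give solutions closer than \<open>r\<close>. The cap at one ensures
    \<open>s \<le> min 1 (norm (w - w'))\<close> beyond the threshold.\<close>
  define s where "s = min 1 (r / c)"
  have s: "s > 0" "s \<le> 1" unfolding s_def using r c by auto
  show thesis
  proof (rule that[of "2 * phi_bound / s"])
    show "2 * phi_bound / s \<ge> 0" using phi_bound_nonneg s by simp
    fix v w w'
    show "\<bar>\<phi> (sol v w) - \<phi> (sol v w')\<bar> \<le> \<delta> + 2 * phi_bound / s * min 1 (norm (w - w'))"
    proof (cases "norm (w - w') < s")
      case True
      have "dist (sol v w) (sol v w') \<le> c * norm (w - w')"
        unfolding dist_norm c_def by (rule solution_map_lipschitz)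
      also have "\<dots> < c * s" using True c by simp
      also have "\<dots> \<le> r" unfolding s_def using c by (simp add: min_def field_simps)
      finally have "dist (\<phi> (sol v w)) (\<phi> (sol v w')) < \<delta>"
        by (intro r(2) solution_map_in_C01)
      moreover have "0 \<le> 2 * phi_bound / s * min 1 (norm (w - w'))" using phi_bound_nonneg s by simp
      ultimately show ?thesis by (simp add: dist_real_def)
    next
      case False
      have "\<bar>\<phi> (sol v w) - \<phi> (sol v w')\<bar> \<le> 2 * phi_bound"
        using phi_sol_le[of v w] phi_sol_le[of v w'] by linarith
      also have "2 * phi_bound = 2 * phi_bound / s * s" using s by simp
      also have "\<dots> \<le> 2 * phi_bound / s * min 1 (norm (w - w'))"
        using False s phi_bound_nonneg by (intro mult_left_mono) auto
      finally show ?thesis using d by linarith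
    qed
  qed
qed

lemma continuous_on_phi_sol: "continuous_on A (\<lambda>w. \<phi> (sol v w))"
proof -
  have "continuous_on A (\<lambda>w. sol v w)"
    unfolding continuous_on_iff
  proof (intro ballI allI impI)
    fix w and e :: real assume e: "e > 0"
    show "\<exists>d>0. \<forall>w'\<in>A. dist w' w < d \<longrightarrow> dist (sol v w') (sol v w) < e"
    proof (intro exI[of _ "e / (2 * exp (2 * lipschitz_const))"] conjI ballI impI)
      fix w' assume "dist w' w < e / (2 * exp (2 * lipschitz_const))"
      then have "2 * exp (2 * lipschitz_const) * norm (w' - w) < e" by (simp add: dist_norm field_simps)
      then show "dist (sol v w') (sol v w) < e"
        using solution_map_lipschitz[of x0 v w' w] unfolding dist_norm by linarith
    qed (use e in simp)
  qed
  then show ?thesis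
    by (rule continuous_on_compose2[OF uniformly_continuous_imp_continuous[OF uniformly_continuous_phi]])
       (use solution_map_in_C01 in auto)
qed

text \<open>Outside this ball the quadratic cost is at least \<open>2 * phi_bound\<close>, so the
  payoff falls to \<open>- phi_bound\<close> or less and \<open>u = 0\<close> does at least as
  well.\<close>

definition radius :: real where "radius = sqrt (4 * phi_bound)"

lemma radius_sq: "radius\<^sup>2 = 4 * phi_bound" unfolding radius_def using phi_bound_nonneg by simp

abbreviation ball_image :: "'d path set" where "ball_image \<equiv> \<iota> ` cball 0 radius"

lemma inv_iota: "inv \<iota> (\<iota> u) = u" by (rule inv_f_f[OF inj_embedding])

text \<open>Compactness is available for the image of the ball in path space, so the cost is
  transported there by \<open>inv \<iota>\<close>. Its \<open>\<phi>\<close>-part is continuous in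
  the path; the norm is lower semicontinuous for convergence of images, because the image of every
  closed ball is closed.\<close>

lemma closed_upper_level: "closed {y\<in>ball_image. c \<le> C v (inv \<iota> y)}"
  unfolding closed_sequential_limits
proof (intro allI impI, elim conjE)
  fix y l assume y: "\<forall>n. y n \<in> {y\<in>ball_image. c \<le> C v (inv \<iota> y)}" and lim: "y \<longlonglongrightarrow> l"
  have cl: "closed (\<iota> ` cball 0 r)" for r by (rule compact_imp_closed[OF compact_iota_cball])
  have l: "l \<in> ball_image" by (rule closed_sequentially[OF cl _ lim]) (use y in auto)
  then obtain u where u: "l = \<iota> u" by blast
  have "\<forall>n. \<exists>w. y n = \<iota> w \<and> c \<le> C v w" using y inv_iota by fastforce
  then obtain w where w: "\<And>n. y n = \<iota> (w n)" "\<And>n. c \<le> C v (w n)" by metis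
  have "continuous_on UNIV (\<lambda>x. \<phi> (sol v x))" by (rule continuous_on_phi_sol)
  then have lim2: "(\<lambda>n. \<phi> (sol v (y n))) \<longlonglongrightarrow> \<phi> (sol v l)"
    using lim unfolding continuous_on_sequentially by (auto simp: o_def)
  have "(norm u)\<^sup>2 / 2 \<le> \<phi> (sol v l) - c + e" if e: "e > 0" for e
  proof -
    have "\<forall>\<^sub>F n in sequentially. \<phi> (sol v (y n)) < \<phi> (sol v l) + e"
      by (rule order_tendstoD(2)[OF lim2]) (use e in simp)
    then obtain N where N: "\<And>n. n \<ge> N \<Longrightarrow> \<phi> (sol v (y n)) < \<phi> (sol v l) + e"
      by (auto simp: eventually_sequentially)
    \<comment> \<open>The level condition confines \<open>w n\<close>, for large \<open>n\<close>,
      to the ball of this radius; closedness of its image then confines \<open>u\<close> as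
      well.\<close>
    define r where "r = sqrt (2 * (\<phi> (sol v l) - c + e))"
    have wn: "(norm (w n))\<^sup>2 \<le> 2 * (\<phi> (sol v l) - c + e)" if "n \<ge> N" for n
      using w(2)[of n] N[OF that] unfolding w(1) C_eq by argo
    then have nn: "0 \<le> 2 * (\<phi> (sol v l) - c + e)" using order_trans[OF zero_le_power2 wn[OF order_refl]] by simp
    have "y (n + N) \<in> \<iota> ` cball 0 r" for n
      using real_le_rsqrt[OF wn[of "n + N"]] unfolding w(1) r_def by auto
    then have "l \<in> \<iota> ` cball 0 r"
      using closed_sequentially[OF cl, of "\<lambda>n. y (n + N)" r l] LIMSEQ_ignore_initial_segment[OF lim, of N] by blast
    then have "norm u \<le> r" using u inj_embedding by (auto dest: injD)
    then have "(norm u)\<^sup>2 \<le> r\<^sup>2" by (intro power_mono) auto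
    then show ?thesis unfolding r_def using nn by simp
  qed
  then have "(norm u)\<^sup>2 / 2 \<le> \<phi> (sol v l) - c" by (rule field_le_epsilon)
  then have "c \<le> C v u" unfolding C_eq u by linarith
  then show "l \<in> {y\<in>ball_image. c \<le> C v (inv \<iota> y)}" using l u inv_iota by auto
qed

lemma max_attained: "\<exists>u. norm u \<le> radius \<and> (\<forall>u'. C v u' \<le> C v u)"
proof -
  have r0: "radius \<ge> 0" unfolding radius_def using phi_bound_nonneg by simp
  have "\<exists>y\<in>ball_image. \<forall>y'\<in>ball_image. C v (inv \<iota> y') \<le> C v (inv \<iota> y)"
    by (rule usc_attains_max[OF compact_iota_cball _ closed_upper_level]) (use r0 in auto)
  then obtain u where u: "norm u \<le> radius" "\<And>u'. norm u' \<le> radius \<Longrightarrow> C v u' \<le> C v u"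
    by (auto simp: inv_iota)
  have "C v u' \<le> C v u" for u'
  proof (cases "norm u' \<le> radius")
    case False
    then have "radius\<^sup>2 \<le> (norm u')\<^sup>2" using r0 by (intro power_mono) auto
    then have "C v u' \<le> - phi_bound" unfolding C_eq radius_sq using phi_sol_le[of v "\<iota> u'"] by linarith
    also have "\<dots> \<le> C v 0" unfolding C_eq using phi_sol_le[of v "\<iota> 0"] by simp
    also have "\<dots> \<le> C v u" by (rule u(2)) (use r0 in simp)
    finally show ?thesis .
  qed (rule u(2))
  then show ?thesis using u(1) by blast
qed

section \<open>Saddle point and values of the game\<close>

definition best :: "'l control \<Rightarrow> 'h" where
  "best v = (SOME u. norm u \<le> radius \<and> (\<forall>u'. C v u' \<le> C v u))"

lemma best: "norm (best v) \<le> radius" "C v u' \<le> C v (best v)"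
  using someI_ex[OF max_attained[of v]] unfolding best_def by auto

definition val :: real where "val = (INF v. C v (best v))"

lemma bdd_below_best: "bdd_below (range (\<lambda>v. C v (best v)))"
proof (rule bdd_belowI[of _ "- phi_bound"])
  fix x assume "x \<in> range (\<lambda>v. C v (best v))"
  then obtain v where v: "x = C v (best v)" by blast
  have "- phi_bound \<le> C v 0" unfolding C_eq using phi_sol_le[of v "\<iota> 0"] by simp
  then show "- phi_bound \<le> x" unfolding v using best(2)[of v 0] by linarith
qed

lemma val_le: "val \<le> C v (best v)"
  unfolding val_def by (rule cINF_lower[OF bdd_below_best]) simp

lemma val_approx: "e > 0 \<Longrightarrow> \<exists>v. C v (best v) < val + e"
  using cINF_less_iff[OF UNIV_not_empty bdd_below_best, of "val + e"] unfolding val_def by simp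

lemma minimax: "\<exists>u. \<forall>v. val \<le> C v u"
proof -
  have "\<exists>y\<in>ball_image. \<forall>v. val \<le> C v (inv \<iota> y)"
  proof (rule minimax_compact[OF compact_iota_cball closed_upper_level])
    fix y1 y2 and \<theta> :: real assume y: "y1 \<in> ball_image" "y2 \<in> ball_image" and th: "0 < \<theta>" "\<theta> < 1"
    obtain u1 u2 where u: "y1 = \<iota> u1" "y2 = \<iota> u2" "norm u1 \<le> radius" "norm u2 \<le> radius" using y by auto
    \<comment> \<open>The norm condition of \<open>concave_in_second\<close> keeps \<open>u0\<close>
      inside the ball, so concavity survives the restriction to it.\<close>
    obtain u0 where u0: "norm u0 \<le> max (norm u1) (norm u2)" "\<And>v. \<theta> * C v u1 + (1 - \<theta>) * C v u2 \<le> C v u0"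
      using concave_cost th unfolding concave_in_second_def by (metis greaterThanLessThan_iff)
    show "\<exists>y0\<in>ball_image. \<forall>v. \<theta> * C v (inv \<iota> y1) + (1 - \<theta>) * C v (inv \<iota> y2) \<le> C v (inv \<iota> y0)"
      by (rule bexI[of _ "\<iota> u0"]) (use u0 u in \<open>auto simp: inv_iota\<close>)
  next
    fix v1 v2 and \<theta> :: real assume th: "0 < \<theta>" "\<theta> < 1"
    then show "\<exists>v0. \<forall>y\<in>ball_image. C v0 (inv \<iota> y) \<le> \<theta> * C v1 (inv \<iota> y) + (1 - \<theta>) * C v2 (inv \<iota> y)"
      using convex_cost unfolding convex_in_first_def by (metis greaterThanLessThan_iff)
  next
    fix v show "\<exists>y\<in>ball_image. val \<le> C v (inv \<iota> y)"
      by (rule bexI[of _ "\<iota> (best v)"]) (use best(1)[of v] val_le[of v] in \<open>auto simp: inv_iota\<close>)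
  qed
  then show ?thesis by blast
qed

definition saddle :: 'h where "saddle = (SOME u. \<forall>v. val \<le> C v u)"

lemma saddle: "val \<le> C v saddle"
  using someI_ex[OF minimax] unfolding saddle_def by blast

text \<open>Moves extended-real upper bounds to the real infimum \<open>val\<close>, including the
  infinite cases.\<close>

lemma le_val_if_le_best:
  assumes "\<And>v. y \<le> ereal (C v (best v))"
  shows "y \<le> ereal val"
proof (cases y)
  case (real r)
  then have "r \<le> C v (best v)" for v using assms[of v] by simp
  then have "r \<le> val" unfolding val_def by (intro cINF_greatest) auto
  then show ?thesis using real by simp
next
  case PInf then show ?thesis using assms[of undefined] by simp
qed simp

lemma SUP_cost: "(SUP u. ereal (C v u)) = ereal (C v (best v))"
  by (rule antisym) (auto intro!: SUP_least SUP_upper simp: best(2))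

lemma INF_SUP_cost: "(INF v. SUP u. ereal (C v u)) = ereal val"
  unfolding SUP_cost
proof (rule antisym)
  show "(INF v. ereal (C v (best v))) \<le> ereal val"
    by (rule le_val_if_le_best, rule INF_lower) simp
  show "ereal val \<le> (INF v. ereal (C v (best v)))"
    by (rule INF_greatest) (simp add: val_le)
qed

lemma INF_cost_le: "(INF v. ereal (C v u)) \<le> ereal val"
proof (rule le_val_if_le_best)
  fix v
  have "(INF v. ereal (C v u)) \<le> ereal (C v u)" by (rule INF_lower) simp
  also have "\<dots> \<le> ereal (C v (best v))" using best(2) by simp
  finally show "(INF v. ereal (C v u)) \<le> ereal (C v (best v))" .
qed

lemma INF_cost_saddle: "(INF v. ereal (C v saddle)) = ereal val"
  by (rule antisym[OF INF_cost_le]) (auto intro!: INF_greatest simp: saddle)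

lemma SUP_INF_cost: "(SUP u. INF v. ereal (C v u)) = ereal val"
  by (rule antisym, rule SUP_least, rule INF_cost_le, subst INF_cost_saddle[symmetric], rule SUP_upper) simp

text \<open>From above, the reply \<open>\<alpha> v\<close> never beats \<open>best v\<close>; from
  below, always answering \<open>saddle\<close> secures \<open>val\<close> against every
  control.\<close>

lemma lower_value_eq: "lower_value \<pi> C = ereal val"
  unfolding lower_value_def
proof (rule antisym)
  show "(SUP \<alpha>\<in>strategies_max \<pi>. INF v. ereal (C v (\<alpha> v))) \<le> ereal val"
  proof (rule SUP_least, rule le_val_if_le_best)
    fix \<alpha> :: "'l control \<Rightarrow> 'h" and v :: "'l control"
    have "(INF v. ereal (C v (\<alpha> v))) \<le> ereal (C v (\<alpha> v))" by (rule INF_lower) simp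
    also have "\<dots> \<le> ereal (C v (best v))" using best(2) by simp
    finally show "(INF v. ereal (C v (\<alpha> v))) \<le> ereal (C v (best v))" .
  qed
  have "(\<lambda>_ :: 'l control. saddle) \<in> strategies_max \<pi>" by (simp add: strategies_max_def)
  then show "ereal val \<le> (SUP \<alpha>\<in>strategies_max \<pi>. INF v. ereal (C v (\<alpha> v)))"
    by (rule SUP_upper2) (simp add: INF_cost_saddle)
qed

text \<open>From above, constant strategies bring the value down to \<open>val\<close>; from below,
  the fixed choice \<open>saddle\<close> holds every \<open>\<beta>\<close> to at least
  \<open>val\<close>.\<close>

lemma upper_value_eq: "upper_value \<pi> C = ereal val"
  unfolding upper_value_def
proof (rule antisym)
  show "(INF \<beta>\<in>strategies_min \<pi>. SUP u. ereal (C (\<beta> u) u)) \<le> ereal val"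
  proof (rule le_val_if_le_best)
    fix v :: "'l control"
    have "(\<lambda>_ :: 'h. v) \<in> strategies_min \<pi>" by (simp add: strategies_min_def)
    then show "(INF \<beta>\<in>strategies_min \<pi>. SUP u. ereal (C (\<beta> u) u)) \<le> ereal (C v (best v))"
      by (rule INF_lower2) (simp add: SUP_cost)
  qed
  show "ereal val \<le> (INF \<beta>\<in>strategies_min \<pi>. SUP u. ereal (C (\<beta> u) u))"
  proof (rule INF_greatest)
    fix \<beta> :: "'h \<Rightarrow> 'l control"
    have "ereal val \<le> ereal (C (\<beta> saddle) saddle)" using saddle by simp
    then show "ereal val \<le> (SUP u. ereal (C (\<beta> u) u))" by (rule SUP_upper2[rotated]) simp
  qed
qed

section \<open>Asymptotics of the noisy value\<close>

lemma progressive_measurable: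
  assumes "a \<in> progressive P"
  shows "(\<lambda>(s, \<omega>). a s \<omega>) \<in> borel_measurable (restrict_space borel {0..1} \<Otimes>\<^sub>M P)"
proof -
  have "(\<lambda>\<omega>. apply_bcontfun \<omega> s) \<in> borel_measurable P" for s
    unfolding measurable_P_iff by (intro borel_measurable_continuous_on_restrict continuous_on_eval)
  then have id: "(\<lambda>\<omega>. \<omega>) \<in> measurable P (coordinate_filtration P 1)"
    by (rule measurable_ident_coordinate_filtration)
  have m1: "(\<lambda>p. (fst p, snd p)) \<in> measurable (restrict_space borel {0..1} \<Otimes>\<^sub>M P) (restrict_space borel {0..1} \<Otimes>\<^sub>M coordinate_filtration P 1)"
    by (intro measurable_Pair measurable_fst measurable_compose[OF measurable_snd id])
  have m2: "(\<lambda>(s, \<omega>). a s \<omega>) \<in> borel_measurable (restrict_space borel {0..1} \<Otimes>\<^sub>M coordinate_filtration P 1)"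
    using assms by (auto simp: progressive_def)
  show ?thesis using measurable_compose[OF m1 m2] by (simp only: prod.collapse)
qed

lemma rep_control_progressive: "(\<lambda>s \<omega>. rep_control v s) \<in> progressive P"
  unfolding progressive_def
proof (intro CollectI ballI)
  fix t :: real assume t: "t \<in> {0..1}"
  have "rep_control v \<in> borel_measurable (restrict_space borel {0..t})"
    by (rule measurable_restrict_mono[OF borel_rep_control]) (use t in auto)
  from measurable_compose[OF measurable_fst this]
  show "(\<lambda>(s, \<omega>). rep_control v s) \<in> borel_measurable (restrict_space borel {0..t} \<Otimes>\<^sub>M coordinate_filtration P t)"
    by (simp add: case_prod_unfold)
qed

lemma borel_measurable_phi_sol:
  assumes a: "a \<in> progressive P"
  shows "(\<lambda>\<omega>. \<phi> (sol (abs_control (\<lambda>t. a t \<omega>)) (r *\<^sub>R \<omega>))) \<in> borel_measurable P"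
proof -
  have W: "(\<lambda>\<omega>. r *\<^sub>R \<omega>) \<in> borel_measurable P"
    unfolding measurable_P_iff by (intro borel_measurable_continuous_on_restrict continuous_intros)
  have "(\<lambda>\<omega>. sol (abs_control (\<lambda>t. a t \<omega>)) (r *\<^sub>R \<omega>)) \<in> measurable P (restrict_space borel C01)"
    by (rule measurable_restrict_space2[OF _ borel_measurable_solution_map[OF progressive_measurable[OF a] W]])
       (use solution_map_in_C01 in auto)
  moreover have "\<phi> \<in> borel_measurable (restrict_space borel C01)"
    by (intro borel_measurable_continuous_on_restrict uniformly_continuous_imp_continuous uniformly_continuous_phi)
  ultimately show ?thesis by (rule measurable_compose)
qed

text \<open>The error \<open>e\<close> splits into quarters: one for choosing \<open>v\<close>
  nearly optimal, two for the doubled \<open>\<delta>\<close> of \<open>log_exp_upper_bound\<close>,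
  one for the noise term.\<close>

lemma noisy_value_upper:
  assumes e: "e > 0"
  shows "\<forall>\<^sub>F \<epsilon> in at_right 0. noisy_value \<mu> x0 P \<phi> \<epsilon> \<le> ereal (val + e)"
proof -
  obtain v where v: "C v (best v) < val + e / 4" using val_approx[of "e / 4"] e by auto
  obtain L where L: "L \<ge> 0" "\<And>v w w'. \<bar>\<phi> (sol v w) - \<phi> (sol v w')\<bar> \<le> e / 4 + L * min 1 (norm (w - w'))"
    using phi_sol_oscillation[of "e / 4"] e by auto
  have "\<forall>\<^sub>F \<epsilon> in at_right 0. (LINT \<omega>|P. min 1 (sqrt \<epsilon> * norm \<omega>)) \<le> e / 4 / (L + 1)"
    by (rule small_noise) (use e L in simp)
  moreover have "\<forall>\<^sub>F \<epsilon>::real in at_right 0. \<epsilon> > 0" by (simp add: eventually_at_right_less)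
  ultimately show ?thesis
  proof eventually_elim
    case (elim \<epsilon>)
    have "L * (LINT \<omega>|P. min 1 (sqrt \<epsilon> * norm \<omega>)) \<le> L * (e / 4 / (L + 1))"
      using elim(1) L(1) by (rule mult_left_mono)
    also have "\<dots> \<le> e / 4" using L(1) e by (simp add: field_simps)
    finally have Le: "L * (LINT \<omega>|P. min 1 (sqrt \<epsilon> * norm \<omega>)) \<le> e / 4" .
    have S: "\<phi> (sol v (\<iota> u)) - (norm u)\<^sup>2 / 2 \<le> C v (best v)" for u using best(2)[of v u] by (simp add: C_eq)
    have "\<epsilon> * ln (LINT \<omega>|P. exp (\<phi> (sol v (sqrt \<epsilon> *\<^sub>R \<omega>)) / \<epsilon>)) \<le>
        C v (best v) + 2 * (e / 4) + L * (LINT \<omega>|P. min 1 (sqrt \<epsilon> * norm \<omega>))"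
      by (rule log_exp_upper_bound[OF continuous_on_phi_sol phi_sol_le L(2) L(1) _ S elim(2)]) (use e in simp)
    then have le: "\<epsilon> * ln (LINT \<omega>|P. exp (\<phi> (sol v (sqrt \<epsilon> *\<^sub>R \<omega>)) / \<epsilon>)) \<le> val + e" using Le v by linarith
    have "abs_control (\<lambda>t. rep_control v t) = v" by (rule Quotient3_abs_rep[OF Quotient3_control])
    then have "(INF a\<in>progressive P. ereal (ln (LINT \<omega>|P. exp (\<phi> (sol (abs_control (\<lambda>t. a t \<omega>)) (sqrt \<epsilon> *\<^sub>R \<omega>)) / \<epsilon>))))
        \<le> ereal (ln (LINT \<omega>|P. exp (\<phi> (sol v (sqrt \<epsilon> *\<^sub>R \<omega>)) / \<epsilon>)))"
      by (intro INF_lower2[OF rep_control_progressive[of v]]) simp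
    then have "noisy_value \<mu> x0 P \<phi> \<epsilon> \<le> ereal \<epsilon> * ereal (ln (LINT \<omega>|P. exp (\<phi> (sol v (sqrt \<epsilon> *\<^sub>R \<omega>)) / \<epsilon>)))"
      unfolding noisy_value_def using elim(2) by (intro ereal_mult_left_mono) auto
    also have "\<dots> \<le> ereal (val + e)" using le by simp
    finally show ?case .
  qed
qed

text \<open>The shift formula is proved along \<open>riesz_range\<close>, where
  \<open>saddle\<close> need not lie. The oscillation bound makes \<open>C v\<close> continuous
  along Cameron--Martin convergence uniformly in \<open>v\<close>, so a nearby element of the dense
  range inherits the saddle property up to \<open>e\<close>.\<close>

lemma near_saddle:
  assumes e: "e > 0"
  obtains h where "h \<in> riesz_range" "\<And>v. val - e \<le> C v h"
proof -
  obtain L where L: "L \<ge> 0" "\<And>v w w'. \<bar>\<phi> (sol v w) - \<phi> (sol v w')\<bar> \<le> e / 4 + L * min 1 (norm (w - w'))"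
    using phi_sol_oscillation[of "e / 4"] e by auto
  have "saddle \<in> closure riesz_range" by (simp add: closure_riesz_range)
  then obtain h where h: "\<And>n. h n \<in> riesz_range" "h \<longlonglongrightarrow> saddle" unfolding closure_sequential by blast
  have "(\<lambda>n. L * min 1 (norm (\<iota> (h n) - \<iota> saddle))) \<longlonglongrightarrow> L * min 1 (norm (\<iota> saddle - \<iota> saddle))"
    by (intro tendsto_intros \<iota>.tendsto h(2))
  then have e1: "\<forall>\<^sub>F n in sequentially. L * min 1 (norm (\<iota> (h n) - \<iota> saddle)) < e / 4"
    by (rule order_tendstoD) (use e in simp)
  have "(\<lambda>n. (norm (h n))\<^sup>2 / 2) \<longlonglongrightarrow> (norm saddle)\<^sup>2 / 2"
    by (intro tendsto_intros h(2)) simp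
  then have e2: "\<forall>\<^sub>F n in sequentially. (norm (h n))\<^sup>2 / 2 < (norm saddle)\<^sup>2 / 2 + e / 4"
    by (rule order_tendstoD) (use e in simp)
  obtain n where n: "L * min 1 (norm (\<iota> (h n) - \<iota> saddle)) < e / 4" "(norm (h n))\<^sup>2 / 2 < (norm saddle)\<^sup>2 / 2 + e / 4"
    using eventually_happens[OF eventually_conj[OF e1 e2]] by auto
  show thesis
  proof (rule that[OF h(1)])
    fix v
    show "val - e \<le> C v (h n)"
      using L(2)[of v "\<iota> (h n)" "\<iota> saddle"] n saddle[of v] e unfolding C_eq by linarith
  qed
qed

text \<open>At each \<open>\<omega>\<close> the shifted process is a single control, frozen at that
  sample point, and \<open>near_saddle\<close> bounds the payoff below for every control with the
  same \<open>h\<close>. Averaging over the noise therefore loses only the oscillation error,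
  uniformly in \<open>a\<close>.\<close>

lemma noisy_value_lower:
  assumes e: "e > 0"
  shows "\<forall>\<^sub>F \<epsilon> in at_right 0. ereal (val - e) \<le> noisy_value \<mu> x0 P \<phi> \<epsilon>"
proof -
  obtain h where h: "h \<in> riesz_range" "\<And>v. val - e / 4 \<le> C v h" using near_saddle[of "e / 4"] e by auto
  obtain L where L: "L \<ge> 0" "\<And>v w w'. \<bar>\<phi> (sol v w) - \<phi> (sol v w')\<bar> \<le> e / 4 + L * min 1 (norm (w - w'))"
    using phi_sol_oscillation[of "e / 4"] e by auto
  have "\<forall>\<^sub>F \<epsilon> in at_right 0. (LINT \<omega>|P. min 1 (sqrt \<epsilon> * norm \<omega>)) \<le> e / 4 / (L + 1)"
    by (rule small_noise) (use e L in simp)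
  moreover have "\<forall>\<^sub>F \<epsilon>::real in at_right 0. \<epsilon> > 0" by (simp add: eventually_at_right_less)
  ultimately show ?thesis
  proof eventually_elim
    case (elim \<epsilon>)
    note eps = elim(2)
    have "L * (LINT \<omega>|P. min 1 (sqrt \<epsilon> * norm \<omega>)) \<le> L * (e / 4 / (L + 1))"
      using elim(1) L(1) by (rule mult_left_mono)
    also have "\<dots> \<le> e / 4" using L(1) e by (simp add: field_simps)
    finally have Le: "L * (LINT \<omega>|P. min 1 (sqrt \<epsilon> * norm \<omega>)) \<le> e / 4" .
    \<comment> \<open>Scaled so that \<open>sqrt \<epsilon>\<close> times the shift is
      \<open>\<iota> h\<close>, while \<open>\<epsilon>\<close> times the cost of the shift is the
      game cost of \<open>h\<close>.\<close>
    define h' where "h' = (1 / sqrt \<epsilon>) *\<^sub>R h"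
    have h': "h' \<in> riesz_range" unfolding h'_def by (intro subspace_scale[OF subspace_riesz_range] h(1))
    have nh': "\<epsilon> * ((norm h')\<^sup>2 / 2) = (norm h)\<^sup>2 / 2"
      unfolding h'_def using eps by (simp add: power_mult_distrib power_divide)
    have im: "integrable P (\<lambda>\<omega>. min 1 (sqrt \<epsilon> * norm \<omega>))"
      by (rule integrable_const_bound[of _ 1]) (use eps in auto)
    have key: "(val - e) / \<epsilon> \<le> ln (LINT \<omega>|P. exp (\<phi> (sol (abs_control (\<lambda>t. a t \<omega>)) (sqrt \<epsilon> *\<^sub>R \<omega>)) / \<epsilon>))"
      if a: "a \<in> progressive P" for a
    proof -
      define G where "G \<omega> = \<phi> (sol (abs_control (\<lambda>t. a t \<omega>)) (sqrt \<epsilon> *\<^sub>R \<omega>)) / \<epsilon>" for \<omega>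
      have Gm: "G \<in> borel_measurable P"
        unfolding G_def[abs_def] by (intro borel_measurable_divide borel_measurable_phi_sol a borel_measurable_const)
      have GK: "\<bar>G \<omega>\<bar> \<le> phi_bound / \<epsilon>" for \<omega>
        unfolding G_def using phi_sol_le eps by (simp add: abs_div divide_right_mono)
      have low: "(LINT \<omega>|P. G (\<omega> + \<iota> h')) - (norm h')\<^sup>2 / 2 \<le> ln (LINT \<omega>|P. exp (G \<omega>))"
        by (rule log_exp_lower_bound[OF h' Gm GK])
      \<comment> \<open>One quarter of \<open>e\<close> is lost to the approximate saddle point and
        one to the oscillation. The term in \<open>h\<close> compensates the cost subtracted in
        \<open>low\<close> after division by \<open>\<epsilon>\<close>.\<close>
      define b where "b = val - e / 2 + (norm h)\<^sup>2 / 2"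
      have "(LINT \<omega>|P. (b - L * min 1 (sqrt \<epsilon> * norm \<omega>)) / \<epsilon>) \<le> (LINT \<omega>|P. G (\<omega> + \<iota> h'))"
      proof (rule integral_mono)
        show "integrable P (\<lambda>\<omega>. (b - L * min 1 (sqrt \<epsilon> * norm \<omega>)) / \<epsilon>)" using im by simp
        show "integrable P (\<lambda>\<omega>. G (\<omega> + \<iota> h'))"
          by (rule integrable_const_bound[of _ "phi_bound / \<epsilon>"])
             (use GK measurable_compose[OF measurable_shift[OF iota_in_C01_0] Gm] in auto)
        fix \<omega>
        let ?v = "abs_control (\<lambda>t. a t (\<omega> + \<iota> h'))"
        have "sqrt \<epsilon> *\<^sub>R (\<omega> + \<iota> h') = sqrt \<epsilon> *\<^sub>R \<omega> + \<iota> h"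
          unfolding h'_def using eps by (simp add: scaleR_right_distrib \<iota>.scaleR)
        moreover have "norm (sqrt \<epsilon> *\<^sub>R \<omega> + \<iota> h - \<iota> h) = sqrt \<epsilon> * norm \<omega>" using eps by simp
        ultimately have "\<phi> (sol ?v (\<iota> h)) - (e / 4 + L * min 1 (sqrt \<epsilon> * norm \<omega>)) \<le> \<phi> (sol ?v (sqrt \<epsilon> *\<^sub>R (\<omega> + \<iota> h')))"
          using L(2)[of ?v "sqrt \<epsilon> *\<^sub>R \<omega> + \<iota> h" "\<iota> h"] by (simp only: abs_le_iff) linarith
        moreover have "val - e / 4 \<le> \<phi> (sol ?v (\<iota> h)) - (norm h)\<^sup>2 / 2" using h(2)[of ?v] by (simp add: C_eq)
        ultimately have "b - L * min 1 (sqrt \<epsilon> * norm \<omega>) \<le> \<phi> (sol ?v (sqrt \<epsilon> *\<^sub>R (\<omega> + \<iota> h')))"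
          unfolding b_def by linarith
        then show "(b - L * min 1 (sqrt \<epsilon> * norm \<omega>)) / \<epsilon> \<le> G (\<omega> + \<iota> h')"
          unfolding G_def using eps by (simp add: divide_right_mono)
      qed
      also have "(LINT \<omega>|P. (b - L * min 1 (sqrt \<epsilon> * norm \<omega>)) / \<epsilon>) = (b - L * (LINT \<omega>|P. min 1 (sqrt \<epsilon> * norm \<omega>))) / \<epsilon>"
        using im by (simp add: prob_space)
      finally have "(b - L * (LINT \<omega>|P. min 1 (sqrt \<epsilon> * norm \<omega>))) / \<epsilon> - (norm h')\<^sup>2 / 2 \<le> ln (LINT \<omega>|P. exp (G \<omega>))"
        using low by linarith
      moreover have "(val - e) / \<epsilon> \<le> (b - L * (LINT \<omega>|P. min 1 (sqrt \<epsilon> * norm \<omega>))) / \<epsilon> - (norm h')\<^sup>2 / 2"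
      proof -
        have "(norm h')\<^sup>2 / 2 = ((norm h)\<^sup>2 / 2) / \<epsilon>" using nh' eps by (simp add: field_simps)
        moreover have "val - e \<le> b - L * (LINT \<omega>|P. min 1 (sqrt \<epsilon> * norm \<omega>)) - (norm h)\<^sup>2 / 2"
          unfolding b_def using Le e by linarith
        ultimately show ?thesis using eps by (simp only: diff_divide_distrib[symmetric]) (rule divide_right_mono, auto)
      qed
      ultimately show ?thesis unfolding G_def by linarith
    qed
    have "ereal (val - e) = ereal \<epsilon> * ereal ((val - e) / \<epsilon>)" using eps by simp
    also have "\<dots> \<le> noisy_value \<mu> x0 P \<phi> \<epsilon>"
      unfolding noisy_value_def using eps key by (intro ereal_mult_left_mono INF_greatest) auto
    finally show ?case .
  qed
qed

lemma noisy_value_tendsto: "(noisy_value \<mu> x0 P \<phi> \<longlongrightarrow> ereal val) (at_right 0)"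
proof (rule order_tendstoI)
  fix a assume "a < ereal val"
  then obtain r where r: "a < ereal r" "ereal r < ereal val" using ereal_dense2 by blast
  have "\<forall>\<^sub>F \<epsilon> in at_right 0. ereal (val - (val - r)) \<le> noisy_value \<mu> x0 P \<phi> \<epsilon>"
    by (rule noisy_value_lower) (use r in simp)
  then show "\<forall>\<^sub>F \<epsilon> in at_right 0. a < noisy_value \<mu> x0 P \<phi> \<epsilon>"
    by eventually_elim (use r in \<open>auto intro: less_le_trans\<close>)
next
  fix a assume "ereal val < a"
  then obtain r where r: "ereal val < ereal r" "ereal r < a" using ereal_dense2 by blast
  have "\<forall>\<^sub>F \<epsilon> in at_right 0. noisy_value \<mu> x0 P \<phi> \<epsilon> \<le> ereal (val + (r - val))"
    by (rule noisy_value_upper) (use r in simp)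
  then show "\<forall>\<^sub>F \<epsilon> in at_right 0. noisy_value \<mu> x0 P \<phi> \<epsilon> < a"
    by eventually_elim (use r in \<open>auto intro: le_less_trans\<close>)
qed

end

theorem theorem3p1:
  fixes \<mu> :: "real \<Rightarrow> 'd::finite path \<Rightarrow> 'l::polish_space \<Rightarrow> real ^ 'd"
    and x0 :: "real ^ 'd"
    and P :: "'d path measure"
    and \<iota> :: "'h::{real_inner, polish_space} \<Rightarrow> 'd path"
    and J :: "'h \<Rightarrow> 'd path \<Rightarrow> real"
    and \<pi> :: "real \<Rightarrow> 'h \<Rightarrow> 'h"
    and \<phi> :: "'d path \<Rightarrow> real"
    and C :: "'l control \<Rightarrow> 'h \<Rightarrow> real"
  assumes "coefficient \<mu>"
    and "abstract_wiener_space P \<iota>"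
    and "paley_wiener P \<iota> J"
    and "resolution_of_identity \<pi>"
    and "filtration_assumption P J \<pi>"
    and "bounded (\<phi> ` C01)"
    and "uniformly_continuous_on C01 \<phi>"
    and "C = game_cost \<mu> x0 \<iota> \<phi>"
    and "convex_in_first C"
    and "concave_in_second C"
  shows "(noisy_value \<mu> x0 P \<phi> \<longlongrightarrow> lower_value \<pi> C) (at_right 0) \<and>
    lower_value \<pi> C = upper_value \<pi> C \<and>
    upper_value \<pi> C = (INF v. SUP u. ereal (C v u)) \<and>
    (INF v. SUP u. ereal (C v u)) = (SUP u. INF v. ereal (C v u)) \<and>
    (\<forall>v. \<exists>u. \<forall>u'. C v u' \<le> C v u) \<and>
    (\<exists>u. \<forall>u'. (INF v. ereal (C v u')) \<le> (INF v. ereal (C v u)))"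
proof -
  interpret coefficient \<mu> by fact
  interpret abstract_wiener_space P \<iota> by fact
  interpret small_noise_game \<mu> P \<iota> x0 \<phi> C
    by unfold_locales (use assms in auto)
  have "\<forall>v. \<exists>u. \<forall>u'. C v u' \<le> C v u" using best(2) by blast
  moreover have "\<exists>u. \<forall>u'. (INF v. ereal (C v u')) \<le> (INF v. ereal (C v u))"
    using INF_cost_le INF_cost_saddle by metis
  ultimately show ?thesis
    by (simp add: lower_value_eq upper_value_eq INF_SUP_cost SUP_INF_cost noisy_value_tendsto)
qed

end
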